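(* The prop $\mathsf{spf}_2$ (defined in the context) is a presentation for the full subcategory $(\mathsf{FSpan}_2,\times)$ of $(\mathsf{Span}(\mathsf{FinSet}),\times)$ with objects the powers of two.
   Context: A prop is a strict symmetric monoidal category generated by one object under the tensor product (objects: natural numbers $n$); a pro is the same without symmetries. $f;g$ denotes "first $f$, then $g$"; $1_n$ is the identity on $n$. A prop given by generators and relations "is a presentation for" a prop $\mathbb X$ if it is isomorphic as a prop to $\mathbb X$. $\mathsf{Span}(\mathsf{FinSet})$ has finite sets as objects and isomorphism classes of spans as morphisms, composed by pullback; the tensor is the cartesian product, and the object $n$ of $\mathsf{FSpan}_2$ is $2^n$, $2=\{0,1\}$. $\mathsf{Iso}(\mathsf f_2)$ is the prop generated by the generalized controlled-not gates $\{X,x\}$: here $X$ is a finite set of control wires and $x\notin X$ is the target wire; the gate stands for the bijection of $2^n$ that replaces the bit $x$ by its sum mod 2 with the product of the bits in $X$ and fixes the other bits ($X=\emptyset$ gives the not gate). The relations are: (a) $\{X,x\}\{X,x\}=1$; (b) if $x\notin Y$ and $y\notin X$ then $\{X,x\}\{Y,y\}=\{Y,y\}\{X,x\}$; (c) if $x\notin Y$ then $\{X,x\}\{\{x\}\sqcup Y,y\}=\{X\cup Y,y\}\{\{x\}\sqcup Y,y\}\{X,x\}$; (d) if $x\notin Y$ then $\{\{x\}\sqcup Y,y\}\{X,x\}=\{X,x\}\{\{x\}\sqcup Y,y\}\{X\cup Y,y\}$; (e) if $x\in Y$ and $y\in X$ then $\{X,x\}\{Y,y\}\{X,x\}=\{Y,y\}\{X,x\}\{Y,y\}$.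 The symmetry is the composite of three controlled-not gates. This list is only conjectured to be complete for the bijections between powers of two; its completeness is not assumed. $\mathsf{Mono}(\mathsf f_2)$ is $\mathsf{Iso}(\mathsf f_2)$ with a generator $u:0\to1$ adjoined, modulo: for all $n$, if $g$ is the generalized controlled-not gate on $n+2$ wires with controls the first $n+1$ wires and target the last, then $(u\otimes 1_{n+1});g=u\otimes1_{n+1}$. $\mathsf{sub}_2$ is the pro generated by endomorphisms $[p]:n\to n$, for all $n$ and all polynomials $p\in\mathbb F_2[x_1,\dots,x_n]$, modulo: for all $n,m$, $p,r\in\mathbb F_2[x_1,\dots,x_n]$ and $q\in\mathbb F_2[x_{n+1},\dots,x_{n+m}]$: $[1]=1_n$; $[r];[p]=[p+r+pr]$; $[p]\otimes[q]=[p\cdot q]$; and the equations of the quotient rings $\mathbb F_2[x_1,\dots,x_n]/\langle x_1^2-x_1,\dots,x_n^2-x_n\rangle$. $\mathsf{subIsof}_2$ is the prop given by a distributive law of pros $\mathsf{sub}_2\otimes\mathsf{Iso}(\mathsf f_2)$: the generators and relations of both, together with, for all $n,m,k$: (i) for $s$ the symmetry exchanging wires $n+1,n+2$ and $p\in\mathbb F_2[x_1,\dots,x_{n+2+m}]$: $s;[p(\dots,x_{n+1},x_{n+2},\dots)]=[p(\dots,x_{n+2},x_{n+1},\dots)];s$; (ii) for $g$ the generalized controlled-not gate on $n+m+1+k$ wires with controls $n+1,\dots,n+m$ and target $n+m+1$, and $q\in\mathbb F_2[x_1,\dots,x_{n+m+1+k}]$: $g;[q]=[q'];g$, where $q'$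 is $q$ with $x_{n+m+1}$ replaced by $x_{n+1}\cdots x_{n+m}+x_{n+m+1}$; (iii) for $r\in\mathbb F_2[x_1,\dots,x_n]$ and $s$ the symmetry moving the $n$ wires past a further bundle of wires: $s;([r]\otimes1)=(1\otimes[r]);s$. $\mathsf{subMonof}_2$ is the prop given by a distributive law of props $\mathsf{subIsof}_2\otimes_{\mathsf{Iso}(\mathsf f_2)}\mathsf{Mono}(\mathsf f_2)$: the generators and relations of both (sharing $\mathsf{Iso}(\mathsf f_2)$), together with $(1_n\otimes u\otimes1_m);[p(x_1,\dots,x_{n+1+m})]=[p(x_1,\dots,x_n,0,x_{n+2},\dots,x_{n+1+m})];(1_n\otimes u\otimes1_m)$ for all $n,m,p$. $\mathsf{pif}_2$ is the prop given by a distributive law of props $\mathsf{subMonof}_2^{\mathsf{op}}\otimes_{\mathsf{subIsof}_2}\mathsf{subMonof}_2$: the generators and relations of both (sharing $\mathsf{subIsof}_2$; write $u^\dagger:1\to0$ for the reverse of $u$), together with $(1_n\otimes u);\mathcal O_p;(1_n\otimes u^\dagger)=[p]$ for all polynomials $p$ in $n$ variables. Here the oracle $\mathcal O_p$ on $n+1$ wires stands for $(x,y)\mapsto(x,y+p(x))$; it is the composite of the generalized controlled-not gates with target $n+1$, one for each monomial of $p$, controlled on the variables of that monomial. $\mathsf{pf}_2$ is the pushout of props of $\mathsf{pif}_2\leftarrow\mathsf{Epi}^{\mathsf{op}}\to\mathsf{cm}^{\mathsf{op}}$, where $\mathsf{Epi}$ is the prop of a commutative associative binary operation and $\mathsf{cm}$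 the prop of a commutative monoid; the comultiplication is sent to the diagonal $\delta:1\to2$, which is $1_1\otimes u$ followed by the controlled-not gate with control wire 1 and target wire 2. That is, a counit for $\delta$ is freely added. $\mathsf{spf}_2$ is the pushout of props of $\mathsf{pf}_2^{\mathsf{op}}\leftarrow\mathsf{pif}_2\to\mathsf{pf}_2$, where $\mathsf{pif}_2$ is identified with its opposite by reversing generators (gates and boxes $[p]$ to themselves, $u\leftrightarrow u^\dagger$).
   Formalization: The relations of sub_2 are corrected to [0]=1_n and [p]⊗[q]=[p+q+pq], since [1]=1_n with [r];[p]=[p+r+pr] would make every box an identity; relation (e) is imposed only when X∖{y}=Y∖{x}, the only case in which it holds for the bijections. *)

theory Defs
  imports
    "HOL-Library.Poly_Mapping"
    "HOL-Library.Z2"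
    "HOL-Combinatorics.Transposition"
begin

section \<open>Props\<close>

text \<open>
  A prop has the natural numbers as objects, with addition as tensor product on objects.
  The hom-sets are indexed families, so they are not required to be disjoint. Composition
  \<open>Comp f g\<close> is diagrammatic: first \<open>f\<close>, then \<open>g\<close>.
\<close>

record 'm prop_struct =
  Hom  :: "nat \<Rightarrow> nat \<Rightarrow> 'm set"
  Ide  :: "nat \<Rightarrow> 'm"
  Comp :: "'m \<Rightarrow> 'm \<Rightarrow> 'm"
  Tens :: "'m \<Rightarrow> 'm \<Rightarrow> 'm"
  Symm :: "nat \<Rightarrow> nat \<Rightarrow> 'm"

locale is_prop =
  fixes P :: "'m prop_struct"
  assumes Ide_in: "Ide P n \<in> Hom P n n"
    and Comp_in: "f \<in> Hom P n m \<Longrightarrow> g \<in> Hom P m k \<Longrightarrow> Comp P f g \<in> Hom P n k"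
    and Tens_in: "f \<in> Hom P n m \<Longrightarrow> g \<in> Hom P n' m' \<Longrightarrow> Tens P f g \<in> Hom P (n + n') (m + m')"
    and Symm_in: "Symm P n m \<in> Hom P (n + m) (m + n)"
    and Comp_Ide_left: "f \<in> Hom P n m \<Longrightarrow> Comp P (Ide P n) f = f"
    and Comp_Ide_right: "f \<in> Hom P n m \<Longrightarrow> Comp P f (Ide P m) = f"
    and Comp_assoc: "f \<in> Hom P n m \<Longrightarrow> g \<in> Hom P m k \<Longrightarrow> h \<in> Hom P k l \<Longrightarrow>
      Comp P (Comp P f g) h = Comp P f (Comp P g h)"
    and Tens_Ide: "Tens P (Ide P n) (Ide P m) = Ide P (n + m)"
    and Tens_Comp: "f \<in> Hom P n m \<Longrightarrow> g \<in> Hom P m k \<Longrightarrow> f' \<in> Hom P n' m' \<Longrightarrow> g' \<in> Hom P m' k' \<Longrightarrow>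
      Tens P (Comp P f g) (Comp P f' g') = Comp P (Tens P f f') (Tens P g g')"
    and Tens_unit_left: "f \<in> Hom P n m \<Longrightarrow> Tens P (Ide P 0) f = f"
    and Tens_unit_right: "f \<in> Hom P n m \<Longrightarrow> Tens P f (Ide P 0) = f"
    and Tens_assoc: "f \<in> Hom P n m \<Longrightarrow> g \<in> Hom P n' m' \<Longrightarrow> h \<in> Hom P n'' m'' \<Longrightarrow>
      Tens P (Tens P f g) h = Tens P f (Tens P g h)"
    and Symm_natural: "f \<in> Hom P n m \<Longrightarrow> g \<in> Hom P n' m' \<Longrightarrow>
      Comp P (Tens P f g) (Symm P m m') = Comp P (Symm P n n') (Tens P g f)"
    and Symm_Symm: "Comp P (Symm P n m) (Symm P m n) = Ide P (n + m)"
    and Symm_hexagon: "Symm P n (m + k) =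
      Comp P (Tens P (Symm P n m) (Ide P k)) (Tens P (Ide P m) (Symm P n k))"

text \<open>Prop isomorphisms are the identity on objects.\<close>

definition prop_iso :: "'a prop_struct \<Rightarrow> 'b prop_struct \<Rightarrow> (nat \<Rightarrow> nat \<Rightarrow> 'a \<Rightarrow> 'b) \<Rightarrow> bool" where
  "prop_iso P Q F \<longleftrightarrow>
     (\<forall>n m. bij_betw (F n m) (Hom P n m) (Hom Q n m)) \<and>
     (\<forall>n. F n n (Ide P n) = Ide Q n) \<and>
     (\<forall>n m k. \<forall>f \<in> Hom P n m. \<forall>g \<in> Hom P m k. F n k (Comp P f g) = Comp Q (F n m f) (F m k g)) \<and>
     (\<forall>n m n' m'. \<forall>f \<in> Hom P n m. \<forall>g \<in> Hom P n' m'.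
        F (n + n') (m + m') (Tens P f g) = Tens Q (F n m f) (F n' m' g)) \<and>
     (\<forall>n m. F (n + m) (m + n) (Symm P n m) = Symm Q n m)"

definition prop_isomorphic :: "'a prop_struct \<Rightarrow> 'b prop_struct \<Rightarrow> bool" where
  "prop_isomorphic P Q \<longleftrightarrow> is_prop P \<and> is_prop Q \<and> (\<exists>F. prop_iso P Q F)"


section \<open>Spans of finite sets\<close>

text \<open>
  A span from \<open>A\<close> to \<open>B\<close> is a finite apex with its two legs. Every span is isomorphic to one
  whose apex is a finite set of natural numbers, so an isomorphism class is represented by the
  set of its members with apex in \<^typ>\<open>nat set\<close>; values of the legs outside the apex are
  irrelevant.
\<close>

type_synonym ('s, 'a, 'b) span = "'s set \<times> ('s \<Rightarrow> 'a) \<times> ('s \<Rightarrow> 'b)"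

definition is_span :: "'a set \<Rightarrow> 'b set \<Rightarrow> ('s, 'a, 'b) span \<Rightarrow> bool" where
  "is_span A B = (\<lambda>(S, l, r). finite S \<and> l ` S \<subseteq> A \<and> r ` S \<subseteq> B)"

definition span_iso :: "('s, 'a, 'b) span \<Rightarrow> ('t, 'a, 'b) span \<Rightarrow> bool" where
  "span_iso = (\<lambda>(S, l, r) (S', l', r').
     \<exists>f. bij_betw f S S' \<and> (\<forall>s \<in> S. l' (f s) = l s \<and> r' (f s) = r s))"

definition span_class :: "('s, 'a, 'b) span \<Rightarrow> (nat, 'a, 'b) span set" where
  "span_class S = {T. span_iso S T}"

definition span_hom :: "'a set \<Rightarrow> 'b set \<Rightarrow> (nat, 'a, 'b) span set set" where
  "span_hom A B = {span_class S | S :: (nat, 'a, 'b) span. is_span A B S}"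

definition span_id :: "'a set \<Rightarrow> ('a, 'a, 'a) span" where
  "span_id A = (A, \<lambda>a. a, \<lambda>a. a)"

definition span_pullback ::
    "('s, 'a, 'b) span \<Rightarrow> ('t, 'b, 'c) span \<Rightarrow> ('s \<times> 't, 'a, 'c) span" where
  "span_pullback = (\<lambda>(S, l, r) (T, l', r').
     ({(s, t). s \<in> S \<and> t \<in> T \<and> r s = l' t}, \<lambda>(s, t). l s, \<lambda>(s, t). r' t))"

text \<open>The sets in each union below coincide, as pullbacks and products respect isomorphism.\<close>

definition span_comp ::
    "(nat, 'a, 'b) span set \<Rightarrow> (nat, 'b, 'c) span set \<Rightarrow> (nat, 'a, 'c) span set" where
  "span_comp C D = (\<Union>S \<in> C. \<Union>T \<in> D. span_class (span_pullback S T))"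

text \<open>
  The set \<open>2\<^sup>n\<close> is the set of bit lists of length \<open>n\<close>; the cartesian product
  \<open>2\<^sup>n \<times> 2\<^sup>m\<close> is identified with \<open>2\<^sup>n\<^sup>+\<^sup>m\<close> by concatenation.
\<close>

definition cube :: "nat \<Rightarrow> bit list set" where
  "cube n = {xs. length xs = n}"

definition span_times ::
    "('s, bit list, bit list) span \<Rightarrow> ('t, bit list, bit list) span \<Rightarrow>
     ('s \<times> 't, bit list, bit list) span" where
  "span_times = (\<lambda>(S, l, r) (T, l', r').
     (S \<times> T, \<lambda>(s, t). l s @ l' t, \<lambda>(s, t). r s @ r' t))"

definition span_tensor ::
    "(nat, bit list, bit list) span set \<Rightarrow> (nat, bit list, bit list) span set \<Rightarrow>
     (nat, bit list, bit list) span set" where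
  "span_tensor C D = (\<Union>S \<in> C. \<Union>T \<in> D. span_class (span_times S T))"

definition span_symm :: "nat \<Rightarrow> nat \<Rightarrow> (bit list, bit list, bit list) span" where
  "span_symm n m = (cube (n + m), \<lambda>xs. xs, \<lambda>xs. drop n xs @ take n xs)"

definition FSpan2 :: "(nat, bit list, bit list) span set prop_struct" where
  "FSpan2 = \<lparr> Hom = (\<lambda>n m. span_hom (cube n) (cube m)),
              Ide = (\<lambda>n. span_class (span_id (cube n))),
              Comp = span_comp,
              Tens = span_tensor,
              Symm = (\<lambda>n m. span_class (span_symm n m)) \<rparr>"


section \<open>Polynomials over the field with two elements\<close>

text \<open>Variables and wires are numbered from \<open>0\<close>.\<close>

type_synonym poly2 = "(nat \<Rightarrow>\<^sub>0 nat) \<Rightarrow>\<^sub>0 bit"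

definition polys :: "nat \<Rightarrow> poly2 set" where
  "polys n = {p. \<forall>m \<in> Poly_Mapping.keys p. Poly_Mapping.keys m \<subseteq> {..<n}}"

definition pvar :: "nat \<Rightarrow> poly2" where
  "pvar i = Poly_Mapping.single (Poly_Mapping.single i 1) 1"

definition psubst :: "(nat \<Rightarrow> poly2) \<Rightarrow> poly2 \<Rightarrow> poly2" where
  "psubst \<sigma> p = (\<Sum>m \<in> Poly_Mapping.keys p.
     Poly_Mapping.single 0 (Poly_Mapping.lookup p m) * (\<Prod>i \<in> Poly_Mapping.keys m. \<sigma> i ^ Poly_Mapping.lookup m i))"


section \<open>Terms and presentations\<close>

text \<open>
  \<open>Gate n X x\<close> is the generalized controlled-not gate \<open>{X, x}\<close> placed on \<open>n\<close> wires;
  \<open>Box n p\<close> is \<open>[p] : n \<rightarrow> n\<close>; \<open>U : 0 \<rightarrow> 1\<close> and \<open>Udag : 1 \<rightarrow> 0\<close> are \<open>u\<close> and its reverse;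
  \<open>Counit : 1 \<rightarrow> 0\<close> and \<open>Unit : 0 \<rightarrow> 1\<close> are the counit and its reverse.
\<close>

datatype gen = Gate nat "nat set" nat | Box nat poly2 | U | Udag | Counit | Unit

fun gen_src :: "gen \<Rightarrow> nat" where
  "gen_src (Gate n X x) = n"
| "gen_src (Box n p) = n"
| "gen_src U = 0"
| "gen_src Udag = 1"
| "gen_src Counit = 1"
| "gen_src Unit = 0"

fun gen_tgt :: "gen \<Rightarrow> nat" where
  "gen_tgt (Gate n X x) = n"
| "gen_tgt (Box n p) = n"
| "gen_tgt U = 1"
| "gen_tgt Udag = 0"
| "gen_tgt Counit = 0"
| "gen_tgt Unit = 1"

datatype tm =
    Gen gen
  | Id nat
  | Swap nat nat
  | Seq tm tm (infixl \<open>\<Zsemi>\<close> 60)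
  | Par tm tm (infixl \<open>\<otimes>\<close> 65)

abbreviation gate :: "nat \<Rightarrow> nat set \<Rightarrow> nat \<Rightarrow> tm" where "gate n X x \<equiv> Gen (Gate n X x)"
abbreviation box :: "nat \<Rightarrow> poly2 \<Rightarrow> tm" where "box n p \<equiv> Gen (Box n p)"
abbreviation u :: tm where "u \<equiv> Gen U"
abbreviation udag :: tm where "udag \<equiv> Gen Udag"
abbreviation counit :: tm where "counit \<equiv> Gen Counit"

record presentation =
  gens :: "gen set"
  rels :: "(tm \<times> tm) set"

inductive typed :: "presentation \<Rightarrow> tm \<Rightarrow> nat \<Rightarrow> nat \<Rightarrow> bool" for \<Pi> where
  typed_Gen: "g \<in> gens \<Pi> \<Longrightarrow> typed \<Pi> (Gen g) (gen_src g) (gen_tgt g)"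
| typed_Id: "typed \<Pi> (Id n) n n"
| typed_Swap: "typed \<Pi> (Swap n m) (n + m) (m + n)"
| typed_Seq: "typed \<Pi> s n m \<Longrightarrow> typed \<Pi> t m k \<Longrightarrow> typed \<Pi> (s \<Zsemi> t) n k"
| typed_Par: "typed \<Pi> s n m \<Longrightarrow> typed \<Pi> t n' m' \<Longrightarrow> typed \<Pi> (s \<otimes> t) (n + n') (m + m')"

text \<open>
  The least congruence on well-typed terms containing the axioms of a strict symmetric monoidal
  category and the relations of the presentation. Related terms are well-typed of equal type, so
  only well-typed pairs in \<open>rels \<Pi>\<close> have an effect.
\<close>

inductive tm_eq :: "presentation \<Rightarrow> tm \<Rightarrow> tm \<Rightarrow> bool" for \<Pi> where
  eq_refl: "typed \<Pi> t n m \<Longrightarrow> tm_eq \<Pi> t t"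
| eq_sym: "tm_eq \<Pi> s t \<Longrightarrow> tm_eq \<Pi> t s"
| eq_trans: "tm_eq \<Pi> s t \<Longrightarrow> tm_eq \<Pi> t r \<Longrightarrow> tm_eq \<Pi> s r"
| eq_Seq: "typed \<Pi> s n m \<Longrightarrow> typed \<Pi> t m k \<Longrightarrow> tm_eq \<Pi> s s' \<Longrightarrow> tm_eq \<Pi> t t' \<Longrightarrow>
    tm_eq \<Pi> (s \<Zsemi> t) (s' \<Zsemi> t')"
| eq_Par: "tm_eq \<Pi> s s' \<Longrightarrow> tm_eq \<Pi> t t' \<Longrightarrow> tm_eq \<Pi> (s \<otimes> t) (s' \<otimes> t')"
| eq_Id_left: "typed \<Pi> s n m \<Longrightarrow> tm_eq \<Pi> (Id n \<Zsemi> s) s"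
| eq_Id_right: "typed \<Pi> s n m \<Longrightarrow> tm_eq \<Pi> (s \<Zsemi> Id m) s"
| eq_Seq_assoc: "typed \<Pi> s n m \<Longrightarrow> typed \<Pi> t m k \<Longrightarrow> typed \<Pi> r k l \<Longrightarrow>
    tm_eq \<Pi> (s \<Zsemi> t \<Zsemi> r) (s \<Zsemi> (t \<Zsemi> r))"
| eq_Par_Id: "tm_eq \<Pi> (Id n \<otimes> Id m) (Id (n + m))"
| eq_interchange: "typed \<Pi> s n m \<Longrightarrow> typed \<Pi> t m k \<Longrightarrow> typed \<Pi> s' n' m' \<Longrightarrow> typed \<Pi> t' m' k' \<Longrightarrow>
    tm_eq \<Pi> ((s \<Zsemi> t) \<otimes> (s' \<Zsemi> t')) ((s \<otimes> s') \<Zsemi> (t \<otimes> t'))"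
| eq_Par_unit_left: "typed \<Pi> s n m \<Longrightarrow> tm_eq \<Pi> (Id 0 \<otimes> s) s"
| eq_Par_unit_right: "typed \<Pi> s n m \<Longrightarrow> tm_eq \<Pi> (s \<otimes> Id 0) s"
| eq_Par_assoc: "typed \<Pi> s n m \<Longrightarrow> typed \<Pi> t n' m' \<Longrightarrow> typed \<Pi> r n'' m'' \<Longrightarrow>
    tm_eq \<Pi> (s \<otimes> t \<otimes> r) (s \<otimes> (t \<otimes> r))"
| eq_Swap_natural: "typed \<Pi> s n m \<Longrightarrow> typed \<Pi> t n' m' \<Longrightarrow>
    tm_eq \<Pi> ((s \<otimes> t) \<Zsemi> Swap m m') (Swap n n' \<Zsemi> (t \<otimes> s))"
| eq_Swap_Swap: "tm_eq \<Pi> (Swap n m \<Zsemi> Swap m n) (Id (n + m))"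
| eq_Swap_hexagon:
    "tm_eq \<Pi> (Swap n (m + k)) ((Swap n m \<otimes> Id k) \<Zsemi> (Id m \<otimes> Swap n k))"
| eq_rel: "(s, t) \<in> rels \<Pi> \<Longrightarrow> typed \<Pi> s n m \<Longrightarrow> typed \<Pi> t n m \<Longrightarrow> tm_eq \<Pi> s t"

definition tm_class :: "presentation \<Rightarrow> tm \<Rightarrow> tm set" where
  "tm_class \<Pi> t = {s. tm_eq \<Pi> t s}"

definition prop_of :: "presentation \<Rightarrow> tm set prop_struct" where
  "prop_of \<Pi> = \<lparr> Hom = (\<lambda>n m. {tm_class \<Pi> t | t. typed \<Pi> t n m}),
                 Ide = (\<lambda>n. tm_class \<Pi> (Id n)),
                 Comp = (\<lambda>C D. \<Union>s \<in> C. \<Union>t \<in> D. tm_class \<Pi> (s \<Zsemi> t)),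
                 Tens = (\<lambda>C D. \<Union>s \<in> C. \<Union>t \<in> D. tm_class \<Pi> (s \<otimes> t)),
                 Symm = (\<lambda>n m. tm_class \<Pi> (Swap n m)) \<rparr>"

definition is_presentation_for :: "presentation \<Rightarrow> 'm prop_struct \<Rightarrow> bool" where
  "is_presentation_for \<Pi> X \<longleftrightarrow> prop_isomorphic (prop_of \<Pi>) X"

text \<open>
  Joining presentations identifies generators with equal names. This presents the pushout over
  the prop on the shared generators; a distributive law adds further relations to the join.
\<close>

definition join :: "presentation \<Rightarrow> presentation \<Rightarrow> presentation" (infixl \<open>\<oplus>\<close> 65) where
  "\<Pi> \<oplus> \<Pi>' = \<lparr> gens = gens \<Pi> \<union> gens \<Pi>', rels = rels \<Pi> \<union> rels \<Pi>' \<rparr>"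

definition add_rels :: "presentation \<Rightarrow> (tm \<times> tm) set \<Rightarrow> presentation" where
  "add_rels \<Pi> R = \<lparr> gens = gens \<Pi>, rels = rels \<Pi> \<union> R \<rparr>"

text \<open>Opposite presentation, with every generator renamed to its reverse.\<close>

fun gen_op :: "gen \<Rightarrow> gen" where
  "gen_op (Gate n X x) = Gate n X x"
| "gen_op (Box n p) = Box n p"
| "gen_op U = Udag"
| "gen_op Udag = U"
| "gen_op Counit = Unit"
| "gen_op Unit = Counit"

fun tm_op :: "tm \<Rightarrow> tm" where
  "tm_op (Gen g) = Gen (gen_op g)"
| "tm_op (Id n) = Id n"
| "tm_op (Swap n m) = Swap m n"
| "tm_op (s \<Zsemi> t) = tm_op t \<Zsemi> tm_op s"
| "tm_op (s \<otimes> t) = tm_op s \<otimes> tm_op t"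

definition pres_op :: "presentation \<Rightarrow> presentation" where
  "pres_op \<Pi> = \<lparr> gens = gen_op ` gens \<Pi>, rels = (\<lambda>(s, t). (tm_op s, tm_op t)) ` rels \<Pi> \<rparr>"


section \<open>Generalized controlled-not gates\<close>

definition is_gate :: "nat \<Rightarrow> nat set \<Rightarrow> nat \<Rightarrow> bool" where
  "is_gate n X x \<longleftrightarrow> X \<subseteq> {..<n} \<and> x < n \<and> x \<notin> X"

text \<open>
  The first three relations say what the wire labels mean: gates act on the indicated wires of a
  tensor product, and exchanging adjacent wires relabels them.

  In relation (e) the two gates must have the same controls apart from the two targets: this is
  precisely when the relation holds for the bijections. For \<open>X = {y}\<close> and \<open>Y = {x, z}\<close> the two
  sides differ where the bit \<open>z\<close> is \<open>0\<close>.
\<close>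

inductive_set iso_rels :: "(tm \<times> tm) set" where
  gate_right: "is_gate n X x \<Longrightarrow> (gate n X x \<otimes> Id k, gate (n + k) X x) \<in> iso_rels"
| gate_left: "is_gate n X x \<Longrightarrow> (Id k \<otimes> gate n X x, gate (k + n) ((+) k ` X) (k + x)) \<in> iso_rels"
| gate_wires: "is_gate (n + 2 + m) X x \<Longrightarrow>
    (Id n \<otimes> Swap 1 1 \<otimes> Id m \<Zsemi>
       gate (n + 2 + m) (transpose n (n + 1) ` X) (transpose n (n + 1) x),
     gate (n + 2 + m) X x \<Zsemi> Id n \<otimes> Swap 1 1 \<otimes> Id m) \<in> iso_rels"
| symmetry: "(Swap 1 1, gate 2 {0} 1 \<Zsemi> gate 2 {1} 0 \<Zsemi> gate 2 {0} 1) \<in> iso_rels"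
| a: "is_gate n X x \<Longrightarrow> (gate n X x \<Zsemi> gate n X x, Id n) \<in> iso_rels"
| b: "is_gate n X x \<Longrightarrow> is_gate n Y y \<Longrightarrow> x \<notin> Y \<Longrightarrow> y \<notin> X \<Longrightarrow>
    (gate n X x \<Zsemi> gate n Y y, gate n Y y \<Zsemi> gate n X x) \<in> iso_rels"
| c: "is_gate n X x \<Longrightarrow> is_gate n ({x} \<union> Y) y \<Longrightarrow> is_gate n (X \<union> Y) y \<Longrightarrow> x \<notin> Y \<Longrightarrow>
    (gate n X x \<Zsemi> gate n ({x} \<union> Y) y,
     gate n (X \<union> Y) y \<Zsemi> gate n ({x} \<union> Y) y \<Zsemi> gate n X x) \<in> iso_rels"
| d: "is_gate n X x \<Longrightarrow> is_gate n ({x} \<union> Y) y \<Longrightarrow> is_gate n (X \<union> Y) y \<Longrightarrow> x \<notin> Y \<Longrightarrow>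
    (gate n ({x} \<union> Y) y \<Zsemi> gate n X x,
     gate n X x \<Zsemi> gate n ({x} \<union> Y) y \<Zsemi> gate n (X \<union> Y) y) \<in> iso_rels"
| e: "is_gate n X x \<Longrightarrow> is_gate n Y y \<Longrightarrow> x \<in> Y \<Longrightarrow> y \<in> X \<Longrightarrow> X - {y} = Y - {x} \<Longrightarrow>
    (gate n X x \<Zsemi> gate n Y y \<Zsemi> gate n X x, gate n Y y \<Zsemi> gate n X x \<Zsemi> gate n Y y) \<in> iso_rels"

definition Iso_f2 :: presentation where
  "Iso_f2 = \<lparr> gens = {Gate n X x | n X x. is_gate n X x}, rels = iso_rels \<rparr>"

inductive_set mono_rels :: "(tm \<times> tm) set" where
  "(u \<otimes> Id (n + 1) \<Zsemi> gate (n + 2) {..<n + 1} (n + 1), u \<otimes> Id (n + 1)) \<in> mono_rels"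

definition Mono_f2 :: presentation where
  "Mono_f2 = add_rels (Iso_f2 \<oplus> \<lparr> gens = {U}, rels = {} \<rparr>) mono_rels"


section \<open>Subobjects\<close>

text \<open>
  The box \<open>[p]\<close> restricts to the zero locus of \<open>p\<close>. This is the reading under which
  \<open>[r] \<Zsemi> [p] = [p + r + pr]\<close> and the oracle relation of \<open>pif2\<close> hold; it makes \<open>[0]\<close> the
  identity and \<open>[p] \<otimes> [q] = [p + q + pq]\<close>. The equations \<open>[1] = 1\<close> and \<open>[p] \<otimes> [q] = [pq]\<close>
  belong to the dual reading, in which \<open>[p]\<close> restricts to the locus \<open>p = 1\<close>. The two must not be
  mixed: \<open>[r] \<Zsemi> [1] = [1 + r + r] = [1]\<close> and \<open>[1] = 1\<close> make every box an identity.
  Renaming \<open>[p]\<close> to \<open>[1 + p]\<close> turns the presentations for the two readings into each other.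
\<close>

inductive_set sub_rels :: "(tm \<times> tm) set" where
  box_Id: "(box n 0, Id n) \<in> sub_rels"
| box_Seq: "p \<in> polys n \<Longrightarrow> r \<in> polys n \<Longrightarrow>
    (box n r \<Zsemi> box n p, box n (p + r + p * r)) \<in> sub_rels"
| box_Par: "p \<in> polys n \<Longrightarrow> q \<in> polys m \<Longrightarrow> q' = psubst (\<lambda>i. pvar (n + i)) q \<Longrightarrow>
    (box n p \<otimes> box m q, box (n + m) (p + q' + p * q')) \<in> sub_rels"
| box_quotient: "p \<in> polys n \<Longrightarrow> q \<in> polys n \<Longrightarrow> i < n \<Longrightarrow>
    (box n (p + q * (pvar i ^ 2 - pvar i)), box n p) \<in> sub_rels"

definition sub2 :: presentation where
  "sub2 = \<lparr> gens = {Box n p | n p. p \<in> polys n}, rels = sub_rels \<rparr>"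

inductive_set subIso_rels :: "(tm \<times> tm) set" where
  box_wires: "p \<in> polys (n + 2 + m) \<Longrightarrow>
    (Id n \<otimes> Swap 1 1 \<otimes> Id m \<Zsemi> box (n + 2 + m) p,
     box (n + 2 + m) (psubst (\<lambda>i. pvar (transpose n (n + 1) i)) p) \<Zsemi>
       Id n \<otimes> Swap 1 1 \<otimes> Id m) \<in> subIso_rels"
| box_gate: "N = n + m + 1 + k \<Longrightarrow> q \<in> polys N \<Longrightarrow>
    q' = psubst (pvar (n + m := (\<Prod>i \<in> {n..<n + m}. pvar i) + pvar (n + m))) q \<Longrightarrow>
    (gate N {n..<n + m} (n + m) \<Zsemi> box N q,
     box N q' \<Zsemi> gate N {n..<n + m} (n + m)) \<in> subIso_rels"
| box_Swap: "r \<in> polys n \<Longrightarrow>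
    (Swap k n \<Zsemi> box n r \<otimes> Id k, Id k \<otimes> box n r \<Zsemi> Swap k n) \<in> subIso_rels"

definition subIsof2 :: presentation where
  "subIsof2 = add_rels (sub2 \<oplus> Iso_f2) subIso_rels"

inductive_set subMono_rels :: "(tm \<times> tm) set" where
  "p \<in> polys (n + 1 + m) \<Longrightarrow>
   (Id n \<otimes> u \<otimes> Id m \<Zsemi> box (n + 1 + m) p,
    box (n + m) (psubst (\<lambda>i. if i < n then pvar i else if i = n then 0 else pvar (i - 1)) p) \<Zsemi>
      Id n \<otimes> u \<otimes> Id m) \<in> subMono_rels"

definition subMonof2 :: presentation where
  "subMonof2 = add_rels (subIsof2 \<oplus> Mono_f2) subMono_rels"


section \<open>Partial isomorphisms, partial functions and spans\<close>

text \<open>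
  The gates of an oracle commute by relation (b), so the oracle relation is imposed for every
  enumeration \<open>ms\<close> of the monomials of \<open>p\<close>.
\<close>

definition oracle_tm :: "nat \<Rightarrow> (nat \<Rightarrow>\<^sub>0 nat) list \<Rightarrow> tm" where
  "oracle_tm n ms = foldl (\<lambda>t m. t \<Zsemi> gate (n + 1) (Poly_Mapping.keys m) n) (Id (n + 1)) ms"

inductive_set oracle_rels :: "(tm \<times> tm) set" where
  "p \<in> polys n \<Longrightarrow> distinct ms \<Longrightarrow> set ms = Poly_Mapping.keys p \<Longrightarrow>
   (Id n \<otimes> u \<Zsemi> oracle_tm n ms \<Zsemi> Id n \<otimes> udag, box n p) \<in> oracle_rels"

definition pif2 :: presentation where
  "pif2 = add_rels (pres_op subMonof2 \<oplus> subMonof2) oracle_rels"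

definition diag :: tm where
  "diag = Id 1 \<otimes> u \<Zsemi> gate 2 {0} 1"

text \<open>
  The relations of a cocommutative comonoid, with the comultiplication identified with the
  diagonal.
\<close>

inductive_set comonoid_rels :: "(tm \<times> tm) set" where
  coassoc: "(diag \<Zsemi> diag \<otimes> Id 1, diag \<Zsemi> Id 1 \<otimes> diag) \<in> comonoid_rels"
| cocomm: "(diag \<Zsemi> Swap 1 1, diag) \<in> comonoid_rels"
| counit_left: "(diag \<Zsemi> counit \<otimes> Id 1, Id 1) \<in> comonoid_rels"
| counit_right: "(diag \<Zsemi> Id 1 \<otimes> counit, Id 1) \<in> comonoid_rels"

definition pf2 :: presentation where
  "pf2 = add_rels (pif2 \<oplus> \<lparr> gens = {Counit}, rels = {} \<rparr>) comonoid_rels"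

definition spf2 :: presentation where
  "spf2 = pres_op pf2 \<oplus> pf2"

end

(*
  A span from 2^n to 2^m is a relation with multiplicities, and a box [P] can carve any subset out of
  a cube. Write eta, eps for the unit and the counit. The normal form creates m + k wires with eta,
  restricts by one box, and discards k wires with eps: it is an arrow n -> n + m that leaves its
  inputs untouched.

  Reversible gates never have to be compared with each other. A gate passes through boxes, changing
  their polynomial, and is absorbed by eta on its target, because eps is the counit of the copying
  map and gates are comonoid homomorphisms. As u = eta; [x] and u^dagger = [x]; eps, normal forms are
  therefore closed under appending any generator away from the inputs. Precomposing f with copies of
  its inputs gives an arrow with a normal form, from which f is recovered by discarding the inputs.

  Two normal forms with isomorphic spans are equal: a wire whose value is determined by the others
  can be eliminated, and the box expressing the graph of the isomorphism, on the hidden wires of both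
  normal forms together, reduces to either of them.
*)

theory Submission
  imports Defs
begin

section \<open>Presented props\<close>

text \<open>The relations among gates are only conjectured to be complete, so no canonical form of a
  gate circuit is available and every comparison of arrows is shifted to boxes. Boxes have a
  complete theory: modulo the x_i^2 - x_i a polynomial is the same thing as a function on bits, so a
  box is determined by the set it keeps, and every set has a box. A wire can be eliminated because
  eta; [x]; eps collapses to the empty diagram. The oracle relation for p = 0 makes u followed by
  its reverse trivial, the one for p = x writes [x] with an ancilla and a controlled-not, and the
  symmetry as three controlled-nots then shows that the reverse of u followed by u is [x]. The
  counit law forces the scalar u; eps to be 1, whence u = eta; [x]. On the semantic side, every
  generator except the reverse of the counit denotes a partial function, and every relation or its
  reverse avoids that generator. Soundness is thus checked by evaluating partial functions on bit
  lists and transported by reversal.\<close>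

fun tsrc :: "tm \<Rightarrow> nat" where
  "tsrc (Gen g) = gen_src g"
| "tsrc (Id n) = n"
| "tsrc (Swap n m) = n + m"
| "tsrc (s \<Zsemi> t) = tsrc s"
| "tsrc (s \<otimes> t) = tsrc s + tsrc t"

fun ttgt :: "tm \<Rightarrow> nat" where
  "ttgt (Gen g) = gen_tgt g"
| "ttgt (Id n) = n"
| "ttgt (Swap n m) = m + n"
| "ttgt (s \<Zsemi> t) = ttgt t"
| "ttgt (s \<otimes> t) = ttgt s + ttgt t"

lemma typed_src_tgt: "typed \<Pi> t n m \<Longrightarrow> tsrc t = n \<and> ttgt t = m"
  by (induction rule: typed.induct) auto

lemma typed_unique:
  assumes "typed \<Pi> t n m" "typed \<Pi> t n' m'"
  shows "n = n'" "m = m'"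
  using assms typed_src_tgt by metis+

lemma tm_eq_typed: "tm_eq \<Pi> s t \<Longrightarrow> \<exists>n m. typed \<Pi> s n m \<and> typed \<Pi> t n m"
proof (induction rule: tm_eq.induct)
  case (eq_Seq s n m t k s' t')
  then show ?case by (metis typed_Seq typed_unique)
next
  case (eq_trans s t r)
  then show ?case by (metis typed_unique)
next
  case (eq_Par_assoc s n m t n' m' r n'' m'')
  have "typed \<Pi> (s \<otimes> t \<otimes> r) (n + n' + n'') (m + m' + m'')" "typed \<Pi> (s \<otimes> (t \<otimes> r)) (n + (n' + n'')) (m + (m' + m''))"
    by (intro typed_Par eq_Par_assoc)+
  then show ?case by (auto simp: add.assoc)
next
  case (eq_Par_Id n m)
  show ?case using typed_Par[OF typed_Id typed_Id] typed_Id by blast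
next
  case (eq_Par_unit_left s n m)
  then show ?case using typed_Par[OF typed_Id eq_Par_unit_left, of 0] by auto
next
  case (eq_Par_unit_right s n m)
  then show ?case using typed_Par[OF eq_Par_unit_right typed_Id, of 0] by auto
next
  case (eq_Swap_natural s n m t n' m')
  have "typed \<Pi> (s \<otimes> t \<Zsemi> Swap m m') (n + n') (m' + m)"
    by (rule typed_Seq[OF typed_Par typed_Swap]) (use eq_Swap_natural in auto)
  moreover have "typed \<Pi> (Swap n n' \<Zsemi> t \<otimes> s) (n + n') (m' + m)"
    by (rule typed_Seq[OF typed_Swap typed_Par]) (use eq_Swap_natural in auto)
  ultimately show ?case by blast
next
  case (eq_Swap_Swap n m)
  show ?case using typed_Seq[OF typed_Swap typed_Swap] typed_Id by blast
next
  case (eq_Swap_hexagon n m k)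
  have "typed \<Pi> (Swap n (m + k)) (n + (m + k)) ((m + k) + n)"
    by (rule typed_Swap)
  moreover have "typed \<Pi> (Swap n m \<otimes> Id k \<Zsemi> Id m \<otimes> Swap n k) ((n + m) + k) (m + (k + n))"
  proof (rule typed_Seq)
    show "typed \<Pi> (Swap n m \<otimes> Id k) (n + m + k) ((m + n) + k)"
      by (intro typed_Par typed_Swap typed_Id)
    have "typed \<Pi> (Id m \<otimes> Swap n k) (m + (n + k)) (m + (k + n))"
      by (intro typed_Par typed_Swap typed_Id)
    then show "typed \<Pi> (Id m \<otimes> Swap n k) ((m + n) + k) (m + (k + n))"
      by (simp add: add.assoc)
  qed
  ultimately show ?case by (auto simp: add.assoc)
qed (blast intro: typed.intros)+

lemma tm_class_eqI: "tm_eq \<Pi> s t \<Longrightarrow> tm_class \<Pi> s = tm_class \<Pi> t"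
  unfolding tm_class_def by (auto intro: eq_trans eq_sym)

lemma prop_of_Hom [simp]: "Hom (prop_of \<Pi>) n m = {tm_class \<Pi> t | t. typed \<Pi> t n m}"
  and prop_of_Ide [simp]: "Ide (prop_of \<Pi>) n = tm_class \<Pi> (Id n)"
  and prop_of_Symm [simp]: "Symm (prop_of \<Pi>) n m = tm_class \<Pi> (Swap n m)"
  by (simp_all add: prop_of_def)

text \<open>\<open>Comp\<close> is a union over representatives. Congruence makes all its members
  equal, and well-typedness makes the index sets nonempty, so the union collapses to a single
  class.\<close>

lemma prop_of_Comp [simp]:
  assumes "typed \<Pi> s n m" "typed \<Pi> t m k"
  shows "Comp (prop_of \<Pi>) (tm_class \<Pi> s) (tm_class \<Pi> t) = tm_class \<Pi> (s \<Zsemi> t)"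
proof -
  have "tm_class \<Pi> (s' \<Zsemi> t') = tm_class \<Pi> (s \<Zsemi> t)" if "tm_eq \<Pi> s s'" "tm_eq \<Pi> t t'" for s' t'
    using eq_Seq[OF assms that] tm_class_eqI eq_sym by blast
  then have "Comp (prop_of \<Pi>) (tm_class \<Pi> s) (tm_class \<Pi> t) =
      (\<Union>s' \<in> tm_class \<Pi> s. \<Union>t' \<in> tm_class \<Pi> t. tm_class \<Pi> (s \<Zsemi> t))"
    unfolding prop_of_def prop_struct.simps by (intro SUP_cong refl) (simp_all add: tm_class_def)
  moreover have "s \<in> tm_class \<Pi> s" "t \<in> tm_class \<Pi> t"
    using assms by (auto simp: tm_class_def intro: eq_refl)
  ultimately show ?thesis by (metis SUP_const empty_iff)
qed

lemma prop_of_Tens [simp]: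
  assumes "typed \<Pi> s n m" "typed \<Pi> t n' m'"
  shows "Tens (prop_of \<Pi>) (tm_class \<Pi> s) (tm_class \<Pi> t) = tm_class \<Pi> (s \<otimes> t)"
proof -
  have "tm_class \<Pi> (s' \<otimes> t') = tm_class \<Pi> (s \<otimes> t)" if "tm_eq \<Pi> s s'" "tm_eq \<Pi> t t'" for s' t'
    using eq_Par[OF that] tm_class_eqI eq_sym by blast
  then have "Tens (prop_of \<Pi>) (tm_class \<Pi> s) (tm_class \<Pi> t) =
      (\<Union>s' \<in> tm_class \<Pi> s. \<Union>t' \<in> tm_class \<Pi> t. tm_class \<Pi> (s \<otimes> t))"
    unfolding prop_of_def prop_struct.simps by (intro SUP_cong refl) (simp_all add: tm_class_def)
  moreover have "s \<in> tm_class \<Pi> s" "t \<in> tm_class \<Pi> t"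
    using assms by (auto simp: tm_class_def intro: eq_refl)
  ultimately show ?thesis by (metis SUP_const empty_iff)
qed

lemma is_prop_prop_of: "is_prop (prop_of \<Pi>)" (is "is_prop ?P")
proof
  fix f g f' g' n m k n' m' k'
  assume *: "f \<in> Hom ?P n m" "g \<in> Hom ?P m k"
    "f' \<in> Hom ?P n' m'" "g' \<in> Hom ?P m' k'"
  then obtain s t s' t' where st: "typed \<Pi> s n m" "typed \<Pi> t m k" "typed \<Pi> s' n' m'" "typed \<Pi> t' m' k'"
    and eq: "f = tm_class \<Pi> s" "g = tm_class \<Pi> t" "f' = tm_class \<Pi> s'" "g' = tm_class \<Pi> t'"
    by auto
  have "Tens ?P (Comp ?P f g) (Comp ?P f' g') = tm_class \<Pi> ((s \<Zsemi> t) \<otimes> (s' \<Zsemi> t'))"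
    using st by (simp add: eq typed_Seq prop_of_Tens[OF typed_Seq typed_Seq])
  also have "\<dots> = tm_class \<Pi> ((s \<otimes> s') \<Zsemi> (t \<otimes> t'))"
    using st by (intro tm_class_eqI eq_interchange)
  also have "\<dots> = Comp ?P (Tens ?P f f') (Tens ?P g g')"
    using st by (simp add: eq prop_of_Comp[OF typed_Par typed_Par])
  finally show "Tens ?P (Comp ?P f g) (Comp ?P f' g') =
    Comp ?P (Tens ?P f f') (Tens ?P g g')" .
next
  fix f g h n m k l
  assume *: "f \<in> Hom ?P n m" "g \<in> Hom ?P m k" "h \<in> Hom ?P k l"
  then obtain s t r where st: "typed \<Pi> s n m" "typed \<Pi> t m k" "typed \<Pi> r k l"
    and eq: "f = tm_class \<Pi> s" "g = tm_class \<Pi> t" "h = tm_class \<Pi> r"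
    by auto
  show "Comp ?P (Comp ?P f g) h = Comp ?P f (Comp ?P g h)"
    using st by (simp add: eq prop_of_Comp[OF typed_Seq] prop_of_Comp[OF _ typed_Seq]
      tm_class_eqI[OF eq_Seq_assoc])
next
  fix f g h n m n' m' n'' m''
  assume *: "f \<in> Hom ?P n m" "g \<in> Hom ?P n' m'" "h \<in> Hom ?P n'' m''"
  then obtain s t r where st: "typed \<Pi> s n m" "typed \<Pi> t n' m'" "typed \<Pi> r n'' m''"
    and eq: "f = tm_class \<Pi> s" "g = tm_class \<Pi> t" "h = tm_class \<Pi> r"
    by auto
  show "Tens ?P (Tens ?P f g) h = Tens ?P f (Tens ?P g h)"
    using st by (simp add: eq prop_of_Tens[OF typed_Par] prop_of_Tens[OF _ typed_Par]
      tm_class_eqI[OF eq_Par_assoc])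
next
  fix f n m assume "f \<in> Hom ?P n m"
  then obtain s where st: "typed \<Pi> s n m" and eq: "f = tm_class \<Pi> s" by auto
  show "Comp ?P (Ide ?P n) f = f"
    using st by (simp add: eq prop_of_Comp[OF typed_Id] tm_class_eqI[OF eq_Id_left])
  show "Comp ?P f (Ide ?P m) = f"
    using st by (simp add: eq prop_of_Comp[OF _ typed_Id] tm_class_eqI[OF eq_Id_right])
  show "Tens ?P (Ide ?P 0) f = f"
    using st by (simp add: eq prop_of_Tens[OF typed_Id] tm_class_eqI[OF eq_Par_unit_left])
  show "Tens ?P f (Ide ?P 0) = f"
    using st by (simp add: eq prop_of_Tens[OF _ typed_Id] tm_class_eqI[OF eq_Par_unit_right])
next
  fix f g n m n' m'
  assume *: "f \<in> Hom ?P n m" "g \<in> Hom ?P n' m'"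
  then obtain s t where st: "typed \<Pi> s n m" "typed \<Pi> t n' m'"
    and eq: "f = tm_class \<Pi> s" "g = tm_class \<Pi> t"
    by auto
  show "Tens ?P f g \<in> Hom ?P (n + n') (m + m')"
    using st by (auto simp add: eq intro!: exI typed_Par)
  show "Comp ?P (Tens ?P f g) (Symm ?P m m') =
    Comp ?P (Symm ?P n n') (Tens ?P g f)"
    using st by (simp add: eq prop_of_Comp[OF typed_Par typed_Swap] prop_of_Comp[OF typed_Swap typed_Par]
      tm_class_eqI[OF eq_Swap_natural])
next
  fix f g n m k
  assume *: "f \<in> Hom ?P n m" "g \<in> Hom ?P m k"
  then obtain s t where st: "typed \<Pi> s n m" "typed \<Pi> t m k"
    and eq: "f = tm_class \<Pi> s" "g = tm_class \<Pi> t"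
    by auto
  show "Comp ?P f g \<in> Hom ?P n k"
    using st by (auto simp add: eq intro!: exI typed_Seq)
next
  fix n m k
  have "typed \<Pi> (Swap n m \<otimes> Id k) (n + m + k) (m + n + k)"
    by (intro typed.intros)
  moreover have "typed \<Pi> (Id m \<otimes> Swap n k) (m + (n + k)) (m + (k + n))"
    by (intro typed.intros)
  ultimately show "Symm ?P n (m + k) = Comp ?P
      (Tens ?P (Symm ?P n m) (Ide ?P k))
      (Tens ?P (Ide ?P m) (Symm ?P n k))"
    by (simp add: prop_of_Tens[OF typed_Id typed_Swap] prop_of_Tens[OF typed_Swap typed_Id] add.assoc
      tm_class_eqI[OF eq_Swap_hexagon])
next
  fix n m
  show "Ide ?P n \<in> Hom ?P n n"
    using typed_Id by auto
  show "Symm ?P n m \<in> Hom ?P (n + m) (m + n)"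
    using typed_Swap by auto
  show "Tens ?P (Ide ?P n) (Ide ?P m) = Ide ?P (n + m)"
    by (simp add: prop_of_Tens[OF typed_Id typed_Id] tm_class_eqI[OF eq_Par_Id])
  show "Comp ?P (Symm ?P n m) (Symm ?P m n) = Ide ?P (n + m)"
    by (simp add: prop_of_Comp[OF typed_Swap typed_Swap] tm_class_eqI[OF eq_Swap_Swap])
qed

context is_prop begin

fun interp :: "(gen \<Rightarrow> 'm) \<Rightarrow> tm \<Rightarrow> 'm" where
  "interp G (Gen g) = G g"
| "interp G (Id n) = Ide P n"
| "interp G (Swap n m) = Symm P n m"
| "interp G (s \<Zsemi> t) = Comp P (interp G s) (interp G t)"
| "interp G (s \<otimes> t) = Tens P (interp G s) (interp G t)"

lemma interp_in:
  assumes "\<And>g. g \<in> gens \<Pi> \<Longrightarrow> G g \<in> Hom P (gen_src g) (gen_tgt g)"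
  shows "typed \<Pi> t n m \<Longrightarrow> interp G t \<in> Hom P n m"
  by (induction rule: typed.induct) (auto intro: assms Ide_in Comp_in Tens_in Symm_in)

text \<open>Half of the universal property of a presentation: an assignment of the generators that
  validates the well-typed relations is constant on classes of terms.\<close>

lemma interp_sound:
  assumes G: "\<And>g. g \<in> gens \<Pi> \<Longrightarrow> G g \<in> Hom P (gen_src g) (gen_tgt g)"
    and R: "\<And>s t n m. (s, t) \<in> rels \<Pi> \<Longrightarrow> typed \<Pi> s n m \<Longrightarrow> typed \<Pi> t n m \<Longrightarrow> interp G s = interp G t"
  assumes "tm_eq \<Pi> s t" shows "interp G s = interp G t"
proof -
  have T: "typed \<Pi> t n m \<Longrightarrow> interp G t \<in> Hom P n m" for t n m
    by (rule interp_in) (use G in auto)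
  show ?thesis
    using assms(3)
proof (induction rule: tm_eq.induct)
  case (eq_rel s t n m)
  then show ?case using R by blast
next
  case (eq_interchange s n m t k s' n' m' t' k')
  then show ?case by (auto intro!: Tens_Comp dest!: T)
qed (auto simp: Comp_Ide_left Comp_Ide_right Tens_Ide Tens_unit_left Tens_unit_right Symm_Symm
    intro!: Comp_assoc Tens_assoc Symm_natural Symm_hexagon dest!: T)
qed

end

section \<open>The prop of spans\<close>

lemma span_isoI:
  assumes "bij_betw f S S'" "\<And>s. s \<in> S \<Longrightarrow> l' (f s) = l s" "\<And>s. s \<in> S \<Longrightarrow> r' (f s) = r s"
  shows "span_iso (S, l, r) (S', l', r')"
  using assms by (auto simp: span_iso_def)

lemma span_isoE:
  assumes "span_iso (S, l, r) (S', l', r')"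
  obtains f where "bij_betw f S S'" "\<And>s. s \<in> S \<Longrightarrow> l' (f s) = l s" "\<And>s. s \<in> S \<Longrightarrow> r' (f s) = r s"
  using assms by (auto simp: span_iso_def)

lemma span_iso_sym:
  assumes "span_iso S T" shows "span_iso T S"
proof -
  obtain A l r B l' r' where ST: "S = (A, l, r)" "T = (B, l', r')" by (metis prod_cases3)
  obtain f where f: "bij_betw f A B" "\<And>s. s \<in> A \<Longrightarrow> l' (f s) = l s" "\<And>s. s \<in> A \<Longrightarrow> r' (f s) = r s"
    using assms unfolding ST by (elim span_isoE) blast
  have *: "inv_into A f b \<in> A" "f (inv_into A f b) = b" if "b \<in> B" for b
    using f(1) that by (auto simp: bij_betw_def inv_into_into f_inv_into_f)
  show ?thesis unfolding ST
    by (rule span_isoI[OF bij_betw_inv_into[OF f(1)]]) (metis f *)+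
qed

lemma span_iso_trans:
  assumes "span_iso S T" "span_iso T W" shows "span_iso S W"
proof -
  obtain A l r B l' r' C l'' r'' where STU: "S = (A, l, r)" "T = (B, l', r')" "W = (C, l'', r'')"
    by (metis prod_cases3)
  obtain f where f: "bij_betw f A B" "\<And>s. s \<in> A \<Longrightarrow> l' (f s) = l s" "\<And>s. s \<in> A \<Longrightarrow> r' (f s) = r s"
    using assms unfolding STU by (elim span_isoE) blast
  obtain g where g: "bij_betw g B C" "\<And>s. s \<in> B \<Longrightarrow> l'' (g s) = l' s" "\<And>s. s \<in> B \<Longrightarrow> r'' (g s) = r' s"
    using assms unfolding STU by (elim span_isoE) blast
  have "f s \<in> B" if "s \<in> A" for s using f(1) that by (auto simp: bij_betw_def)
  then show ?thesis unfolding STU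
    by (intro span_isoI[OF bij_betw_trans[OF f(1) g(1)]]) (auto simp: f g)
qed

lemma span_class_eq:
  assumes "span_iso S T" shows "span_class S = span_class T"
  unfolding span_class_def
  using span_iso_trans[OF assms] span_iso_trans[OF span_iso_sym[OF assms]] by (intro Collect_cong iffI)

text \<open>Classes only have members with apex in \<open>nat set\<close>, so the class of a span
  over another type could be empty a priori. Finiteness of the apex supplies a member.\<close>

lemma nat_span_exists:
  assumes "finite A"
  obtains T :: "(nat, 'a, 'b) span" where "span_iso (A, l, r) T"
proof -
  obtain f :: "_ \<Rightarrow> nat" where f: "inj_on f A" using assms finite_imp_inj_to_nat_seg by metis
  have "span_iso (A, l, r) (f ` A, l \<circ> inv_into A f, r \<circ> inv_into A f)"
    using f by (intro span_isoI[where f = f]) (auto simp: bij_betw_def)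
  then show thesis using that by blast
qed

lemma is_span_iso:
  assumes "span_iso S T" "is_span A B S" shows "is_span A B T"
proof -
  obtain C l r D l' r' where ST: "S = (C, l, r)" "T = (D, l', r')" by (metis prod_cases3)
  obtain f where f: "bij_betw f C D" "\<And>s. s \<in> C \<Longrightarrow> l' (f s) = l s" "\<And>s. s \<in> C \<Longrightarrow> r' (f s) = r s"
    using assms unfolding ST by (elim span_isoE) blast
  have "D = f ` C" "finite C" using f assms by (auto simp: bij_betw_def ST is_span_def)
  then show ?thesis using f assms by (auto simp: ST is_span_def)
qed

text \<open>The direction from classes to spans needs a common member, hence the finiteness
  contained in \<open>is_span\<close>: two apexes too large to embed into \<open>nat\<close> would
  have equal, empty classes.\<close>

lemma span_class_eq_iff:
  assumes "is_span A B (S :: ('s, 'a, 'b) span)"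
  shows "span_class S = span_class T \<longleftrightarrow> span_iso S T"
proof
  obtain C l r where S: "S = (C, l, r)" by (metis prod_cases3)
  obtain W :: "(nat, 'a, 'b) span" where W: "span_iso S W"
    using assms nat_span_exists[of C l r] by (auto simp: S is_span_def)
  assume "span_class S = span_class T"
  then have "span_iso T W" using W by (auto simp: span_class_def)
  then show "span_iso S T" using W span_iso_trans span_iso_sym by blast
qed (rule span_class_eq)

lemma span_homE:
  assumes "C \<in> span_hom A B"
  obtains S :: "(nat, _, _) span" where "is_span A B S" "C = span_class S"
  using assms by (auto simp: span_hom_def)

lemma span_homI:
  assumes "is_span A B S" shows "span_class S \<in> span_hom A B"
proof -
  obtain C l r where S: "S = (C, l, r)" by (metis prod_cases3)
  obtain W :: "(nat, 'a, 'b) span" where W: "span_iso S W"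
    using assms nat_span_exists[of C l r] by (auto simp: S is_span_def)
  then show ?thesis using is_span_iso[OF W assms] span_class_eq[OF W] unfolding span_hom_def by blast
qed

lemma span_pullback_iso:
  assumes "span_iso S S'" "span_iso T T'"
  shows "span_iso (span_pullback S T) (span_pullback S' T')"
proof -
  obtain A l r A' l' r' B m q B' m' q' where ST: "S = (A, l, r)" "S' = (A', l', r')"
    "T = (B, m, q)" "T' = (B', m', q')" by (metis prod_cases3)
  obtain f where f: "bij_betw f A A'" "\<And>s. s \<in> A \<Longrightarrow> l' (f s) = l s" "\<And>s. s \<in> A \<Longrightarrow> r' (f s) = r s"
    using assms unfolding ST by (elim span_isoE) blast
  obtain g where g: "bij_betw g B B'" "\<And>s. s \<in> B \<Longrightarrow> m' (g s) = m s" "\<And>s. s \<in> B \<Longrightarrow> q' (g s) = q s"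
    using assms unfolding ST by (elim span_isoE) blast
  have *: "A' = f ` A" "B' = g ` B" "inj_on f A" "inj_on g B" using f g by (auto simp: bij_betw_def)
  have "bij_betw (map_prod f g) {(s, t). s \<in> A \<and> t \<in> B \<and> r s = m t}
      {(s, t). s \<in> A' \<and> t \<in> B' \<and> r' s = m' t}"
    unfolding bij_betw_def
  proof
    show "inj_on (map_prod f g) {(s, t). s \<in> A \<and> t \<in> B \<and> r s = m t}"
      using *(3,4) by (auto simp: inj_on_def)
    show "map_prod f g ` {(s, t). s \<in> A \<and> t \<in> B \<and> r s = m t} = {(s, t). s \<in> A' \<and> t \<in> B' \<and> r' s = m' t}"
      using f g by (force simp: *(1,2) image_iff)
  qed
  then show ?thesis unfolding ST span_pullback_def
    by (auto intro!: span_isoI[where f = "map_prod f g"] simp: f g)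
qed

lemma span_times_iso:
  assumes "span_iso S S'" "span_iso T T'"
  shows "span_iso (span_times S T) (span_times S' T')"
proof -
  obtain A l r A' l' r' B m q B' m' q' where ST: "S = (A, l, r)" "S' = (A', l', r')"
    "T = (B, m, q)" "T' = (B', m', q')" by (metis prod_cases3)
  obtain f where f: "bij_betw f A A'" "\<And>s. s \<in> A \<Longrightarrow> l' (f s) = l s" "\<And>s. s \<in> A \<Longrightarrow> r' (f s) = r s"
    using assms unfolding ST by (elim span_isoE) blast
  obtain g where g: "bij_betw g B B'" "\<And>s. s \<in> B \<Longrightarrow> m' (g s) = m s" "\<And>s. s \<in> B \<Longrightarrow> q' (g s) = q s"
    using assms unfolding ST by (elim span_isoE) blast
  have "bij_betw (map_prod f g) (A \<times> B) (A' \<times> B')"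
    by (rule bij_betw_map_prod[OF f(1) g(1)])
  then show ?thesis unfolding ST span_times_def
    by (auto intro!: span_isoI[where f = "map_prod f g"] simp: f g)
qed

text \<open>Frees all later calculations from apexes in \<open>nat\<close>: they may be sets of bit
  lists or of pairs and are never recoded.\<close>

lemma span_comp_class:
  fixes S :: "('s, 'a, 'b) span" and T :: "('t, 'b, 'c) span"
  assumes "is_span A B S" "is_span B' C T"
  shows "span_comp (span_class S) (span_class T) = span_class (span_pullback S T)"
proof -
  obtain X l r Y l' r' where ST: "S = (X, l, r)" "T = (Y, l', r')" by (metis prod_cases3)
  obtain W :: "(nat, 'a, 'b) span" where W: "span_iso S W"
    using assms nat_span_exists[of X l r] by (auto simp: ST is_span_def)
  obtain V :: "(nat, 'b, 'c) span" where V: "span_iso T V"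
    using assms nat_span_exists[of Y l' r'] by (auto simp: ST is_span_def)
  have "span_class (span_pullback W' V') = span_class (span_pullback S T)"
    if "span_iso S W'" "span_iso T V'" for W' :: "(nat, 'a, 'b) span" and V' :: "(nat, 'b, 'c) span"
    using span_class_eq[OF span_pullback_iso[OF that]] by simp
  then have "span_comp (span_class S) (span_class T) =
      (\<Union>W' \<in> span_class S. \<Union>V' \<in> span_class T. span_class (span_pullback S T))"
    unfolding span_comp_def by (intro SUP_cong refl) (simp_all add: span_class_def)
  moreover have "W \<in> span_class S" "V \<in> span_class T" using W V by (simp_all add: span_class_def)
  ultimately show ?thesis by (metis SUP_const empty_iff)
qed

lemma span_tensor_class:
  fixes S :: "('s, bit list, bit list) span" and T :: "('t, bit list, bit list) span"
  assumes "is_span A B S" "is_span A' B' T"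
  shows "span_tensor (span_class S) (span_class T) = span_class (span_times S T)"
proof -
  obtain X l r Y l' r' where ST: "S = (X, l, r)" "T = (Y, l', r')" by (metis prod_cases3)
  obtain W :: "(nat, bit list, bit list) span" where W: "span_iso S W"
    using assms nat_span_exists[of X l r] by (auto simp: ST is_span_def)
  obtain V :: "(nat, bit list, bit list) span" where V: "span_iso T V"
    using assms nat_span_exists[of Y l' r'] by (auto simp: ST is_span_def)
  have "span_class (span_times W' V') = span_class (span_times S T)"
    if "span_iso S W'" "span_iso T V'" for W' V' :: "(nat, bit list, bit list) span"
    using span_class_eq[OF span_times_iso[OF that]] by simp
  then have "span_tensor (span_class S) (span_class T) =
      (\<Union>W' \<in> span_class S. \<Union>V' \<in> span_class T. span_class (span_times S T))"
    unfolding span_tensor_def by (intro SUP_cong refl) (simp_all add: span_class_def)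
  moreover have "W \<in> span_class S" "V \<in> span_class T" using W V by (simp_all add: span_class_def)
  ultimately show ?thesis by (metis SUP_const empty_iff)
qed

lemma finite_cube [simp]: "finite (cube n)"
proof -
  have "cube n = {xs. set xs \<subseteq> UNIV \<and> length xs = n}" by (auto simp: cube_def)
  moreover have "finite (UNIV :: bit set)"
    by (rule finite_subset[of _ "{0, 1}"]) (auto intro: bit.exhaust)
  ultimately show ?thesis using finite_lists_length_eq[of "UNIV :: bit set" n] by simp
qed

lemma cube_iff [simp]: "xs \<in> cube n \<longleftrightarrow> length xs = n"
  by (simp add: cube_def)

lemma is_span_pullback:
  "is_span A B S \<Longrightarrow> is_span B C T \<Longrightarrow> is_span A C (span_pullback S T)"
proof -
  assume a: "is_span A B S" "is_span B C T"
  obtain X l r Y l' r' where ST: "S = (X, l, r)" "T = (Y, l', r')" by (metis prod_cases3)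
  have "{(s, t). s \<in> X \<and> t \<in> Y \<and> r s = l' t} \<subseteq> X \<times> Y" by auto
  then have "finite {(s, t). s \<in> X \<and> t \<in> Y \<and> r s = l' t}"
    using a by (auto simp: ST is_span_def intro: finite_subset)
  then show ?thesis using a by (auto simp: ST is_span_def span_pullback_def)
qed

lemma is_span_times:
  "is_span (cube n) (cube m) S \<Longrightarrow> is_span (cube n') (cube m') T \<Longrightarrow>
   is_span (cube (n + n')) (cube (m + m')) (span_times S T)"
  by (cases S; cases T) (auto simp: is_span_def span_times_def image_subset_iff)

lemma is_span_id: "is_span (cube n) (cube n) (span_id (cube n))"
  by (simp add: is_span_def span_id_def)

lemma is_span_symm: "is_span (cube (n + m)) (cube (m + n)) (span_symm n m)"
  by (auto simp: is_span_def span_symm_def)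

lemma FSpan2_simps [simp]:
  "Hom FSpan2 n m = span_hom (cube n) (cube m)"
  "Ide FSpan2 n = span_class (span_id (cube n))"
  "Comp FSpan2 = span_comp"
  "Tens FSpan2 = span_tensor"
  "Symm FSpan2 n m = span_class (span_symm n m)"
  by (simp_all add: FSpan2_def)

lemma span_isoI_witness:
  assumes "\<And>s. s \<in> S \<Longrightarrow> f s \<in> S' \<and> g (f s) = s \<and> l' (f s) = l s \<and> r' (f s) = r s"
    and "\<And>t. t \<in> S' \<Longrightarrow> g t \<in> S \<and> f (g t) = t"
  shows "span_iso (S, l, r) (S', l', r')"
  using assms by (intro span_isoI[where f = f] bij_betw_byWitness[where f' = g]) auto

lemma is_span_cubeD:
  assumes "is_span (cube n) (cube m) (A, l, r)" "a \<in> A"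
  shows "length (l a) = n" "length (r a) = m"
  using assms by (auto simp: is_span_def)

text \<open>Strictness has two sources: concatenation of bit lists is strictly associative and
  unital, and rebracketing of apexes is an isomorphism, which disappears in the classes.\<close>

lemma is_prop_FSpan2: "is_prop FSpan2"
proof (unfold_locales, unfold FSpan2_simps)
  fix n show "span_class (span_id (cube n)) \<in> span_hom (cube n) (cube n)"
    by (intro span_homI is_span_id)
next
  fix f g n m k assume "f \<in> span_hom (cube n) (cube m)" "g \<in> span_hom (cube m) (cube k)"
  then show "span_comp f g \<in> span_hom (cube n) (cube k)"
    by (elim span_homE) (simp add: span_comp_class span_homI is_span_pullback)
next
  fix f g n m n' m' assume "f \<in> span_hom (cube n) (cube m)" "g \<in> span_hom (cube n') (cube m')"
  then show "span_tensor f g \<in> span_hom (cube (n + n')) (cube (m + m'))"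
    by (elim span_homE) (simp add: span_tensor_class span_homI is_span_times)
next
  fix n m show "span_class (span_symm n m) \<in> span_hom (cube (n + m)) (cube (m + n))"
    by (intro span_homI is_span_symm)
next
  fix f n m assume "f \<in> span_hom (cube n) (cube m)"
  then obtain S :: "(nat, bit list, bit list) span" where S: "is_span (cube n) (cube m) S" "f = span_class S"
    by (elim span_homE) blast
  obtain A l r where A: "S = (A, l, r)" by (metis prod_cases3)
  note f = S[unfolded A]
  have "span_iso (span_pullback (span_id (cube n)) (A, l, r)) (A, l, r)"
    unfolding span_pullback_def span_id_def prod.case
    by (rule span_isoI_witness[where f = snd and g = "\<lambda>a. (l a, a)"])
      (auto simp: is_span_cubeD[OF f(1)])
  from span_class_eq[OF this] show "span_comp (span_class (span_id (cube n))) f = f"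
    unfolding f(2) span_comp_class[OF is_span_id f(1)] .
  have "span_iso (span_pullback (A, l, r) (span_id (cube m))) (A, l, r)"
    unfolding span_pullback_def span_id_def prod.case
    by (rule span_isoI_witness[where f = fst and g = "\<lambda>a. (a, r a)"])
      (auto simp: is_span_cubeD[OF f(1)])
  from span_class_eq[OF this] show "span_comp f (span_class (span_id (cube m))) = f"
    unfolding f(2) span_comp_class[OF f(1) is_span_id] .
  have "span_iso (span_times (span_id (cube 0)) (A, l, r)) (A, l, r)"
    unfolding span_times_def span_id_def prod.case
    by (rule span_isoI_witness[where f = snd and g = "\<lambda>a. ([], a)"]) auto
  from span_class_eq[OF this] show "span_tensor (span_class (span_id (cube 0))) f = f"
    unfolding f(2) span_tensor_class[OF is_span_id f(1)] .
  have "span_iso (span_times (A, l, r) (span_id (cube 0))) (A, l, r)"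
    unfolding span_times_def span_id_def prod.case
    by (rule span_isoI_witness[where f = fst and g = "\<lambda>a. (a, [])"]) auto
  from span_class_eq[OF this] show "span_tensor f (span_class (span_id (cube 0))) = f"
    unfolding f(2) span_tensor_class[OF f(1) is_span_id] .
next
  fix f g h n m k l
  assume "f \<in> span_hom (cube n) (cube m)" "g \<in> span_hom (cube m) (cube k)" "h \<in> span_hom (cube k) (cube l)"
  then obtain S T W :: "(nat, bit list, bit list) span" where
    S: "is_span (cube n) (cube m) S" "f = span_class S" and
    T: "is_span (cube m) (cube k) T" "g = span_class T" and
    W: "is_span (cube k) (cube l) W" "h = span_class W" by (elim span_homE) blast
  obtain A1 l1 r1 A2 l2 r2 A3 l3 r3 where A: "S = (A1, l1, r1)" "T = (A2, l2, r2)" "W = (A3, l3, r3)"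
    by (metis prod_cases3)
  have "span_iso (span_pullback (span_pullback S T) W) (span_pullback S (span_pullback T W))"
    unfolding A span_pullback_def prod.case
    by (rule span_isoI_witness[where f = "\<lambda>((a, b), c). (a, (b, c))" and g = "\<lambda>(a, (b, c)). ((a, b), c)"]) auto
  from span_class_eq[OF this] show "span_comp (span_comp f g) h = span_comp f (span_comp g h)"
    unfolding S(2) T(2) W(2) span_comp_class[OF S(1) T(1)] span_comp_class[OF T(1) W(1)]
      span_comp_class[OF is_span_pullback[OF S(1) T(1)] W(1)] span_comp_class[OF S(1) is_span_pullback[OF T(1) W(1)]] .
next
  fix n m
  have "span_iso (span_times (span_id (cube n)) (span_id (cube m))) (span_id (cube (n + m)))"
    unfolding span_times_def span_id_def prod.case
    by (rule span_isoI_witness[where f = "\<lambda>(a, b). a @ b" and g = "\<lambda>c. (take n c, drop n c)"]) auto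
  from span_class_eq[OF this] show "span_tensor (span_class (span_id (cube n))) (span_class (span_id (cube m))) =
      span_class (span_id (cube (n + m)))"
    unfolding span_tensor_class[OF is_span_id is_span_id] .
next
  fix f g f' g' n m k n' m' k'
  assume "f \<in> span_hom (cube n) (cube m)" "g \<in> span_hom (cube m) (cube k)"
    "f' \<in> span_hom (cube n') (cube m')" "g' \<in> span_hom (cube m') (cube k')"
  then obtain S T S' T' :: "(nat, bit list, bit list) span" where
    S: "is_span (cube n) (cube m) S" "f = span_class S" and
    T: "is_span (cube m) (cube k) T" "g = span_class T" and
    S': "is_span (cube n') (cube m') S'" "f' = span_class S'" and
    T': "is_span (cube m') (cube k') T'" "g' = span_class T'" by (elim span_homE) blast
  obtain A1 l1 r1 A2 l2 r2 A3 l3 r3 A4 l4 r4 where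
    A: "S = (A1, l1, r1)" "T = (A2, l2, r2)" "S' = (A3, l3, r3)" "T' = (A4, l4, r4)"
    by (metis prod_cases3)
  have "span_iso (span_times (span_pullback S T) (span_pullback S' T'))
      (span_pullback (span_times S S') (span_times T T'))"
    unfolding A span_times_def span_pullback_def prod.case
    by (rule span_isoI_witness[where f = "\<lambda>((a, b), (c, d)). ((a, c), (b, d))"
        and g = "\<lambda>((a, c), (b, d)). ((a, b), (c, d))"])
      (auto simp: is_span_cubeD[OF S(1)[unfolded A]] is_span_cubeD[OF T(1)[unfolded A]]
        is_span_cubeD[OF S'(1)[unfolded A]] is_span_cubeD[OF T'(1)[unfolded A]])
  from span_class_eq[OF this] show "span_tensor (span_comp f g) (span_comp f' g') = span_comp (span_tensor f f') (span_tensor g g')"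
    unfolding S(2) T(2) S'(2) T'(2) span_comp_class[OF S(1) T(1)] span_comp_class[OF S'(1) T'(1)]
      span_tensor_class[OF S(1) S'(1)] span_tensor_class[OF T(1) T'(1)]
      span_tensor_class[OF is_span_pullback[OF S(1) T(1)] is_span_pullback[OF S'(1) T'(1)]]
      span_comp_class[OF is_span_times[OF S(1) S'(1)] is_span_times[OF T(1) T'(1)]] .
next
  fix f g h n m n' m' n'' m''
  assume "f \<in> span_hom (cube n) (cube m)" "g \<in> span_hom (cube n') (cube m')" "h \<in> span_hom (cube n'') (cube m'')"
  then obtain S T W :: "(nat, bit list, bit list) span" where
    S: "is_span (cube n) (cube m) S" "f = span_class S" and
    T: "is_span (cube n') (cube m') T" "g = span_class T" and
    W: "is_span (cube n'') (cube m'') W" "h = span_class W" by (elim span_homE) blast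
  obtain A1 l1 r1 A2 l2 r2 A3 l3 r3 where A: "S = (A1, l1, r1)" "T = (A2, l2, r2)" "W = (A3, l3, r3)"
    by (metis prod_cases3)
  have "span_iso (span_times (span_times S T) W) (span_times S (span_times T W))"
    unfolding A span_times_def prod.case
    by (rule span_isoI_witness[where f = "\<lambda>((a, b), c). (a, (b, c))" and g = "\<lambda>(a, (b, c)). ((a, b), c)"]) auto
  from span_class_eq[OF this] show "span_tensor (span_tensor f g) h = span_tensor f (span_tensor g h)"
    unfolding S(2) T(2) W(2) span_tensor_class[OF S(1) T(1)] span_tensor_class[OF T(1) W(1)]
      span_tensor_class[OF is_span_times[OF S(1) T(1)] W(1)] span_tensor_class[OF S(1) is_span_times[OF T(1) W(1)]] .
next
  fix f g n m n' m'
  assume "f \<in> span_hom (cube n) (cube m)" "g \<in> span_hom (cube n') (cube m')"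
  then obtain S T :: "(nat, bit list, bit list) span" where
    S: "is_span (cube n) (cube m) S" "f = span_class S" and
    T: "is_span (cube n') (cube m') T" "g = span_class T" by (elim span_homE) blast
  obtain A1 l1 r1 A2 l2 r2 where A: "S = (A1, l1, r1)" "T = (A2, l2, r2)"
    by (metis prod_cases3)
  have "span_iso (span_pullback (span_times S T) (span_symm m m')) (span_pullback (span_symm n n') (span_times T S))"
    unfolding A span_times_def span_pullback_def span_symm_def prod.case
    by (rule span_isoI_witness[where f = "\<lambda>((a, b), c). (l1 a @ l2 b, (b, a))"
        and g = "\<lambda>(c, (b, a)). ((a, b), r1 a @ r2 b)"])
      (auto simp: is_span_cubeD[OF S(1)[unfolded A]] is_span_cubeD[OF T(1)[unfolded A]], metis append_take_drop_id)
  from span_class_eq[OF this] show "span_comp (span_tensor f g) (span_class (span_symm m m')) =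
      span_comp (span_class (span_symm n n')) (span_tensor g f)"
    unfolding S(2) T(2) span_tensor_class[OF S(1) T(1)] span_tensor_class[OF T(1) S(1)]
      span_comp_class[OF is_span_times[OF S(1) T(1)] is_span_symm]
      span_comp_class[OF is_span_symm is_span_times[OF T(1) S(1)]] .
next
  fix n m
  have "span_iso (span_pullback (span_symm n m) (span_symm m n)) (span_id (cube (n + m)))"
    unfolding span_symm_def span_pullback_def span_id_def prod.case
    by (rule span_isoI_witness[where f = fst and g = "\<lambda>a. (a, drop n a @ take n a)"]) auto
  from span_class_eq[OF this] show "span_comp (span_class (span_symm n m)) (span_class (span_symm m n)) = span_class (span_id (cube (n + m)))"
    unfolding span_comp_class[OF is_span_symm is_span_symm] .
next
  fix n m k
  have eq: "span_tensor (span_class (span_symm n m)) (span_class (span_id (cube k))) =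
      span_class (span_times (span_symm n m) (span_id (cube k)))"
    "span_tensor (span_class (span_id (cube m))) (span_class (span_symm n k)) =
      span_class (span_times (span_id (cube m)) (span_symm n k))"
    by (rule span_tensor_class[OF is_span_symm is_span_id] span_tensor_class[OF is_span_id is_span_symm])+
  have "span_iso (span_symm n (m + k)) (span_pullback (span_times (span_symm n m) (span_id (cube k)))
      (span_times (span_id (cube m)) (span_symm n k)))"
    unfolding span_symm_def span_pullback_def span_id_def span_times_def prod.case
    by (rule span_isoI_witness[where
          f = "\<lambda>a. ((take (n + m) a, drop (n + m) a), (take m (drop n a), take n a @ drop (n + m) a))"
          and g = "\<lambda>((a, b), c). a @ b"])
       (auto simp: take_drop append_eq_append_conv_if add.commute)
  from span_class_eq[OF this] show "span_class (span_symm n (m + k)) =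
    span_comp (span_tensor (span_class (span_symm n m)) (span_class (span_id (cube k))))
      (span_tensor (span_class (span_id (cube m))) (span_class (span_symm n k)))"
    unfolding eq
    by (subst span_comp_class[OF is_span_times[OF is_span_symm is_span_id] is_span_times[OF is_span_id is_span_symm]])
qed

section \<open>Polynomials as functions\<close>

definition peval :: "(nat \<Rightarrow> bit) \<Rightarrow> poly2 \<Rightarrow> bit" where
  "peval v p = (\<Sum>m \<in> Poly_Mapping.keys p. Poly_Mapping.lookup p m *
     (\<Prod>i \<in> Poly_Mapping.keys m. v i ^ Poly_Mapping.lookup m i))"

definition meval :: "(nat \<Rightarrow> 'a::comm_semiring_1) \<Rightarrow> (nat \<Rightarrow>\<^sub>0 nat) \<Rightarrow> 'a" where
  "meval v m = (\<Prod>i \<in> Poly_Mapping.keys m. v i ^ Poly_Mapping.lookup m i)"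

lemma meval_superset:
  assumes "finite A" "Poly_Mapping.keys m \<subseteq> A"
  shows "meval v m = (\<Prod>i \<in> A. v i ^ Poly_Mapping.lookup m i)"
  unfolding meval_def using assms by (intro prod.mono_neutral_left) (auto simp: in_keys_iff)

lemma meval_add: "meval v (m + m') = meval v m * meval v m'"
proof -
  let ?A = "Poly_Mapping.keys m \<union> Poly_Mapping.keys m'"
  have "meval v (m + m') = (\<Prod>i \<in> ?A. v i ^ Poly_Mapping.lookup (m + m') i)"
    by (intro meval_superset keys_add) simp
  also have "\<dots> = meval v m * meval v m'"
    by (simp add: meval_superset[of ?A m] meval_superset[of ?A m'] lookup_add power_add prod.distrib)
  finally show ?thesis .
qed

lemma meval_0 [simp]: "meval v 0 = 1"
  by (simp add: meval_def)

lemma peval_superset: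
  assumes "finite A" "Poly_Mapping.keys p \<subseteq> A"
  shows "peval v p = (\<Sum>m \<in> A. Poly_Mapping.lookup p m * meval v m)"
  unfolding peval_def meval_def using assms by (intro sum.mono_neutral_left) (auto simp: in_keys_iff)

lemma peval_add [simp]: "peval v (p + q) = peval v p + peval v q"
proof -
  let ?A = "Poly_Mapping.keys p \<union> Poly_Mapping.keys q"
  have "peval v (p + q) = (\<Sum>m \<in> ?A. Poly_Mapping.lookup (p + q) m * meval v m)"
    by (intro peval_superset keys_add) simp
  also have "\<dots> = peval v p + peval v q"
    by (simp only: peval_superset[of ?A p] peval_superset[of ?A q] lookup_add distrib_right sum.distrib
      finite_UnI finite_keys Un_upper1 Un_upper2)
  finally show ?thesis .
qed

lemma peval_0 [simp]: "peval v 0 = 0"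
  by (simp add: peval_def)

lemma peval_single [simp]: "peval v (Poly_Mapping.single m c) = c * meval v m"
  by (simp add: peval_superset[of "{m}"])

lemma peval_1 [simp]: "peval v 1 = 1"
  using peval_single[of v 0 1] by (simp flip: single_one)

lemma peval_sum [simp]: "peval v (sum f A) = (\<Sum>x \<in> A. peval v (f x))"
  by (induction A rule: infinite_finite_induct) auto

lemma poly_eq_sum_single:
  "p = (\<Sum>m \<in> Poly_Mapping.keys p. Poly_Mapping.single m (Poly_Mapping.lookup p m))"
  by (rule poly_mapping_eqI) (auto simp: lookup_sum lookup_single when_def in_keys_iff)

lemma poly2_induct [case_names zero single add]:
  fixes p :: poly2
  assumes "P 0" "\<And>m. P (Poly_Mapping.single m 1)" "\<And>p q. P p \<Longrightarrow> P q \<Longrightarrow> P (p + q)"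
  shows "P p"
proof -
  have "P (\<Sum>m \<in> A. Poly_Mapping.single m (Poly_Mapping.lookup p m))" if "finite A" for A
    using that
  proof (induction A rule: finite_induct)
    case (insert m A)
    have "P (Poly_Mapping.single m (Poly_Mapping.lookup p m))"
      using assms(1,2) by (cases "Poly_Mapping.lookup p m") auto
    then show ?case using insert assms(3) by simp
  qed (use assms in simp)
  then show ?thesis using poly_eq_sum_single[of p] by (metis finite_keys)
qed

lemma lookup_keys_bit: "m \<in> Poly_Mapping.keys p \<Longrightarrow> Poly_Mapping.lookup p m = (1 :: bit)"
  by (cases "Poly_Mapping.lookup p m") (auto simp: in_keys_iff)

lemma peval_eq_sum_meval: "peval v p = (\<Sum>m \<in> Poly_Mapping.keys p. meval v m)"
  unfolding peval_superset[OF finite_keys subset_refl] by (intro sum.cong refl) (simp add: lookup_keys_bit)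

lemma peval_mult [simp]: "peval v (p * q) = peval v p * peval v q"
proof (induction p rule: poly2_induct)
  case (single m)
  show ?case
    by (induction q rule: poly2_induct) (simp_all add: mult_single meval_add distrib_left)
qed (simp_all add: distrib_right)

lemma peval_prod [simp]: "peval v (prod f A) = (\<Prod>x \<in> A. peval v (f x))"
  by (induction A rule: infinite_finite_induct) auto

lemma peval_power [simp]: "peval v (p ^ k) = peval v p ^ k"
  by (induction k) auto

lemma peval_pvar [simp]: "peval v (pvar i) = v i"
  by (simp add: pvar_def meval_def)

lemma peval_psubst [simp]: "peval v (psubst \<sigma> p) = peval (\<lambda>i. peval v (\<sigma> i)) p"
  unfolding psubst_def peval_def[of _ p] by simp

lemma minus_poly2 [simp]: "- p = (p :: poly2)"
  by (rule poly_mapping_eqI) simp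

lemma diff_poly2: "p - q = p + (q :: poly2)"
  by (metis minus_poly2 diff_conv_add_uminus)

lemma add_self_poly2: "p + p = (0 :: poly2)"
  by (metis diff_poly2 diff_self)

lemma add_self_bit: "(b :: bit) + b = 0"
  by (cases b) auto

lemma polys_0 [simp]: "0 \<in> polys n"
  and polys_1 [simp]: "1 \<in> polys n"
  by (auto simp: polys_def)

lemma polys_add [simp]: "p \<in> polys n \<Longrightarrow> q \<in> polys n \<Longrightarrow> p + q \<in> polys n"
  using keys_add[of p q] by (auto simp: polys_def)

lemma polys_mult [simp]: "p \<in> polys n \<Longrightarrow> q \<in> polys n \<Longrightarrow> p * q \<in> polys n"
proof -
  assume a: "p \<in> polys n" "q \<in> polys n"
  show ?thesis unfolding polys_def
  proof (intro CollectI ballI)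
    fix m assume "m \<in> Poly_Mapping.keys (p * q)"
    then obtain k l where m: "m = k + l" "k \<in> Poly_Mapping.keys p" "l \<in> Poly_Mapping.keys q"
      using keys_mult[of p q] by auto
    then show "Poly_Mapping.keys m \<subseteq> {..<n}"
      using a keys_add[of k l] by (fastforce simp: polys_def)
  qed
qed

lemma polys_sum [simp]: "(\<And>x. x \<in> A \<Longrightarrow> f x \<in> polys n) \<Longrightarrow> sum f A \<in> polys n"
  by (induction A rule: infinite_finite_induct) auto

lemma polys_prod [simp]: "(\<And>x. x \<in> A \<Longrightarrow> f x \<in> polys n) \<Longrightarrow> prod f A \<in> polys n"
  by (induction A rule: infinite_finite_induct) auto

lemma polys_power [simp]: "p \<in> polys n \<Longrightarrow> p ^ k \<in> polys n"
  by (induction k) auto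

lemma polys_pvar [simp]: "i < n \<Longrightarrow> pvar i \<in> polys n"
  by (auto simp: polys_def pvar_def)

lemma polys_const [simp]: "Poly_Mapping.single 0 c \<in> polys n"
  by (auto simp: polys_def split: if_splits)

lemma polys_psubst:
  assumes "p \<in> polys n" "\<And>i. i < n \<Longrightarrow> \<sigma> i \<in> polys k"
  shows "psubst \<sigma> p \<in> polys k"
  unfolding psubst_def
proof (intro polys_sum polys_mult polys_const polys_prod polys_power assms(2))
  fix m i assume "m \<in> Poly_Mapping.keys p" "i \<in> Poly_Mapping.keys m"
  then show "i < n" using assms(1) by (fastforce simp: polys_def)
qed

text \<open>Bit lists enter as assignments \<open>nth xs\<close>, whose values beyond the length of
  \<open>xs\<close> are unspecified; this lemma makes them harmless.\<close>

lemma peval_cong: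
  assumes "p \<in> polys n" "\<And>i. i < n \<Longrightarrow> v i = w i"
  shows "peval v p = peval w p"
proof -
  have "(\<Prod>i \<in> Poly_Mapping.keys m. v i ^ Poly_Mapping.lookup m i) =
        (\<Prod>i \<in> Poly_Mapping.keys m. w i ^ Poly_Mapping.lookup m i)" if "m \<in> Poly_Mapping.keys p" for m
    proof (intro prod.cong refl)
    fix i assume "i \<in> Poly_Mapping.keys m"
    then have "i < n" using that assms(1) by (fastforce simp: polys_def)
    then show "v i ^ Poly_Mapping.lookup m i = w i ^ Poly_Mapping.lookup m i" using assms(2) by simp
  qed
  then show ?thesis unfolding peval_def by (intro sum.cong) auto
qed

text \<open>Congruence modulo the ideal of the x_i^2 - x_i. The cofactors are confined to the
  variables below \<open>n\<close> because the relation \<open>box_quotient\<close> only admits such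
  multiples.\<close>

definition bcong :: "nat \<Rightarrow> poly2 \<Rightarrow> poly2 \<Rightarrow> bool" where
  "bcong n p q \<longleftrightarrow> (\<exists>c. (\<forall>i<n. c i \<in> polys n) \<and> p = q + (\<Sum>i<n. c i * (pvar i ^ 2 - pvar i)))"

lemma bcong_refl: "bcong n p p"
  unfolding bcong_def by (intro exI[of _ "\<lambda>_. 0"]) auto

lemma bcong_add: "bcong n p q \<Longrightarrow> bcong n p' q' \<Longrightarrow> bcong n (p + p') (q + q')"
proof -
  assume "bcong n p q" "bcong n p' q'"
  then obtain c c' where "\<forall>i<n. c i \<in> polys n" "p = q + (\<Sum>i<n. c i * (pvar i ^ 2 - pvar i))"
    "\<forall>i<n. c' i \<in> polys n" "p' = q' + (\<Sum>i<n. c' i * (pvar i ^ 2 - pvar i))"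
    unfolding bcong_def by auto
  then show ?thesis unfolding bcong_def
    by (intro exI[of _ "\<lambda>i. c i + c' i"]) (auto simp: distrib_right sum.distrib add_ac)
qed

lemma bcong_mult: "bcong n p q \<Longrightarrow> r \<in> polys n \<Longrightarrow> bcong n (r * p) (r * q)"
proof -
  assume "bcong n p q" and r: "r \<in> polys n"
  then obtain c where "\<forall>i<n. c i \<in> polys n" "p = q + (\<Sum>i<n. c i * (pvar i ^ 2 - pvar i))"
    unfolding bcong_def by auto
  then show ?thesis unfolding bcong_def using r
    by (intro exI[of _ "\<lambda>i. r * c i"]) (auto simp: distrib_left sum_distrib_left mult_ac)
qed

lemma bcong_trans: "bcong n p q \<Longrightarrow> bcong n q r \<Longrightarrow> bcong n p r"
proof -
  assume "bcong n p q" "bcong n q r"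
  then obtain c c' where "\<forall>i<n. c i \<in> polys n" "p = q + (\<Sum>i<n. c i * (pvar i ^ 2 - pvar i))"
    "\<forall>i<n. c' i \<in> polys n" "q = r + (\<Sum>i<n. c' i * (pvar i ^ 2 - pvar i))"
    unfolding bcong_def by auto
  then show ?thesis unfolding bcong_def
    by (intro exI[of _ "\<lambda>i. c i + c' i"]) (auto simp: distrib_right sum.distrib add_ac)
qed

lemma bcong_square: "i < n \<Longrightarrow> bcong n (pvar i * pvar i) (pvar i)"
  unfolding bcong_def
  by (intro exI[of _ "\<lambda>j. if j = i then 1 else 0"])
    (auto simp: if_distrib[of "\<lambda>x. x * _"] power2_eq_square cong: if_cong)

definition cpoly :: "bit \<Rightarrow> poly2" where "cpoly b = Poly_Mapping.single 0 b"

lemma cpoly_simps [simp]: "cpoly 0 = 0" "cpoly 1 = 1" "peval v (cpoly b) = b" "cpoly b \<in> polys n"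
  by (auto simp: cpoly_def)

text \<open>Indicator polynomial of the assignments that agree with \<open>a\<close> on the first
  \<open>j\<close> variables: over the field with two elements, x + b + 1 is 1 exactly when x =
  b.\<close>

definition point :: "(nat \<Rightarrow> bit) \<Rightarrow> nat \<Rightarrow> poly2" where
  "point a j = (\<Prod>i<j. pvar i + cpoly (a i) + 1)"

lemma polys_point [simp]: "j \<le> n \<Longrightarrow> point a j \<in> polys n"
  unfolding point_def by (intro polys_prod polys_add) auto

text \<open>The factor of index \<open>i\<close> does the work. If \<open>a i = 0\<close> it is x_i
  + 1, whose product with x_i is congruent to 0; if \<open>a i = 1\<close> it is x_i, and x_i^2 is
  congruent to x_i.\<close>

lemma point_pvar:
  assumes "i < n"
  shows "bcong n (point a n * pvar i) (point a n * cpoly (a i))"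
proof -
  let ?r = "\<Prod>j \<in> {..<n} - {i}. pvar j + cpoly (a j) + 1"
  have pt: "point a n = ?r * (pvar i + cpoly (a i) + 1)"
    unfolding point_def using assms by (subst prod.remove[of _ i]) (auto simp: mult.commute)
  have "bcong n ((pvar i + cpoly (a i) + 1) * pvar i) ((pvar i + cpoly (a i) + 1) * cpoly (a i))"
  proof (cases "a i")
    case zero
    have "bcong n (pvar i * pvar i + pvar i) (pvar i + pvar i)"
      using assms by (intro bcong_add bcong_square bcong_refl)
    then show ?thesis using zero by (simp add: add_self_poly2 distrib_right)
  next
    case one
    then show ?thesis using bcong_square[OF assms]
      by (simp add: add.assoc add_self_poly2)
  qed
  then have "bcong n (?r * ((pvar i + cpoly (a i) + 1) * pvar i)) (?r * ((pvar i + cpoly (a i) + 1) * cpoly (a i)))"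
    by (rule bcong_mult) (auto intro!: polys_prod polys_add)
  then show ?thesis by (simp add: pt mult.assoc)
qed

text \<open>The polynomials that \<open>point a n\<close> turns into their value at \<open>a\<close>
  are closed under products (\<open>mult\<close>) and sums, so the case of a single variable
  decides.\<close>

lemma point_poly:
  assumes "p \<in> polys n"
  shows "bcong n (point a n * p) (point a n * cpoly (peval a p))"
proof -
  have mult: "bcong n (point a n * (p * q)) (point a n * cpoly (b * c))"
    if "bcong n (point a n * p) (point a n * cpoly b)" "bcong n (point a n * q) (point a n * cpoly c)"
      "p \<in> polys n" "q \<in> polys n" for p q b c
  proof -
    have "bcong n (q * (point a n * p)) (q * (point a n * cpoly b))"
      by (rule bcong_mult[OF that(1,4)])
    moreover have "bcong n (cpoly b * (point a n * q)) (cpoly b * (point a n * cpoly c))"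
      by (rule bcong_mult[OF that(2)]) simp
    moreover have "cpoly b * (point a n * cpoly c) = point a n * cpoly (b * c)"
      by (cases b; cases c) auto
    moreover have "q * (point a n * cpoly b) = cpoly b * (point a n * q)"
      "q * (point a n * p) = point a n * (p * q)" by (simp_all only: mult_ac)
    ultimately show ?thesis by (auto intro: bcong_trans)
  qed
  have pow: "bcong n (point a n * pvar i ^ k) (point a n * cpoly (a i ^ k))" if "i < n" for i k
  proof (induction k)
    case (Suc k)
    then show ?case
      unfolding power_Suc by (intro mult point_pvar polys_pvar polys_power that)
  qed (simp add: bcong_refl)
  have mon: "bcong n (point a n * (\<Prod>i \<in> A. pvar i ^ f i)) (point a n * cpoly (\<Prod>i \<in> A. a i ^ f i))"
    if "finite A" "A \<subseteq> {..<n}" for A f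
    using that
  proof (induction A rule: finite_induct)
    case (insert i A)
    then have "i < n" "bcong n (point a n * (\<Prod>i \<in> A. pvar i ^ f i)) (point a n * cpoly (\<Prod>i \<in> A. a i ^ f i))"
      "(\<Prod>i \<in> A. pvar i ^ f i) \<in> polys n"
      by (auto intro!: polys_prod polys_power polys_pvar)
    then show ?case unfolding prod.insert[OF insert.hyps] by (intro mult pow polys_power polys_pvar)
  qed (simp add: bcong_refl)
  have m: "Poly_Mapping.single m 1 = (\<Prod>i \<in> Poly_Mapping.keys m. pvar i ^ Poly_Mapping.lookup m i)" for m
  proof -
    have pw: "pvar i ^ k = Poly_Mapping.single (Poly_Mapping.single i k) 1" for i k
      by (induction k) (auto simp: pvar_def mult_single simp flip: single_add)
    have "(\<Prod>i \<in> A. Poly_Mapping.single (f i) (1 :: bit)) = Poly_Mapping.single (sum f A) 1"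
      if "finite A" for A and f :: "nat \<Rightarrow> nat \<Rightarrow>\<^sub>0 nat"
      using that by (induction A rule: finite_induct) (auto simp: mult_single)
    moreover have "(\<Sum>i \<in> Poly_Mapping.keys m. Poly_Mapping.single i (Poly_Mapping.lookup m i)) = m"
      by (rule poly_mapping_eqI) (auto simp: lookup_sum lookup_single when_def in_keys_iff)
    ultimately show ?thesis unfolding pw by simp
  qed
  have "bcong n (point a n * (\<Sum>m \<in> A. Poly_Mapping.single m 1)) (point a n * cpoly (\<Sum>m \<in> A. meval a m))"
    if "finite A" "A \<subseteq> Poly_Mapping.keys p" for A
    using that
  proof (induction A rule: finite_induct)
    case (insert k A)
    have "bcong n (point a n * Poly_Mapping.single k 1) (point a n * cpoly (meval a k))"
      unfolding m meval_def using insert assms by (intro mon) (auto simp: polys_def)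
    then have "bcong n (point a n * Poly_Mapping.single k 1 + point a n * (\<Sum>m \<in> A. Poly_Mapping.single m 1))
       (point a n * cpoly (meval a k) + point a n * cpoly (\<Sum>m \<in> A. meval a m))"
      using insert by (intro bcong_add) auto
    then show ?case unfolding sum.insert[OF insert.hyps] cpoly_def single_add distrib_left .
  qed (simp add: bcong_refl)
  note * = this[OF finite_keys subset_refl]
  have "p = (\<Sum>m \<in> Poly_Mapping.keys p. Poly_Mapping.single m 1)"
    using poly_eq_sum_single[of p] by (simp add: lookup_keys_bit cong: sum.cong)
  then show ?thesis using * peval_eq_sum_meval[of a p] by metis
qed

text \<open>
  Multiplying by \<open>point a n\<close> evaluates at \<open>a\<close>, and \<open>point a j\<close> is the sum of its two extensions to
  \<open>j + 1\<close> coordinates, so \<open>point a j * p\<close> vanishes for all \<open>a\<close> by downward induction on \<open>j\<close>.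
\<close>

lemma bcong_zero:
  assumes "p \<in> polys n" "\<And>v. peval v p = 0"
  shows "bcong n p 0"
proof -
  have "bcong n (point a j * p) 0" if "j \<le> n" for a j
    using that
  proof (induction arbitrary: a rule: inc_induct)
    case base
    show ?case using point_poly[OF assms(1), of a] assms(2) by simp
  next
    case (step j)
    have "point (a(j := b)) (Suc j) = point a j * (pvar j + cpoly b + 1)" for b
      by (simp add: point_def)
    moreover have "point a j * (pvar j + cpoly 0 + 1) + point a j * (pvar j + cpoly 1 + 1) = point a j"
    proof -
      have "(pvar j + cpoly 0 + 1) + (pvar j + cpoly 1 + 1) = (pvar j + pvar j) + (1 + 1) + (1 :: poly2)"
        by (simp only: cpoly_simps add_0_right add_0_left add_ac)
      then show ?thesis unfolding distrib_left[symmetric] add_self_poly2 by simp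
    qed
    moreover have "bcong n (point (a(j := 0)) (Suc j) * p + point (a(j := 1)) (Suc j) * p) (0 + 0)"
      by (intro bcong_add step)
    ultimately show ?case by (metis distrib_right add_0)
  qed
  from this[of 0] show ?thesis by (simp add: point_def)
qed

lemma bcong_iff_peval:
  assumes "p \<in> polys n" "q \<in> polys n" "\<And>v. peval v p = peval v q"
  shows "bcong n p q"
proof -
  have "bcong n (p + q) 0" using assms by (intro bcong_zero) (auto simp: add_self_bit)
  then have "bcong n (p + q + q) (0 + q)" by (intro bcong_add bcong_refl)
  then show ?thesis by (simp add: add.assoc add_self_poly2)
qed

text \<open>Expansion in the last variable: \<open>p\<close> and \<open>q\<close> solve the problem
  on the halves of the cube where that variable is 0 and 1, and x_n selects between them.\<close>

lemma ex_poly_zeros: "\<exists>p \<in> polys n. \<forall>xs \<in> cube n. peval (nth xs) p = 0 \<longleftrightarrow> P xs"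
proof (induction n arbitrary: P)
  case 0
  show ?case
    by (rule bexI[of _ "if P [] then 0 else 1"]) (auto simp: cube_def)
next
  case (Suc n)
  obtain p where p: "p \<in> polys n" "\<forall>xs \<in> cube n. peval (nth xs) p = 0 \<longleftrightarrow> P (xs @ [0])"
    using Suc[of "\<lambda>xs. P (xs @ [0])"] by auto
  obtain q where q: "q \<in> polys n" "\<forall>xs \<in> cube n. peval (nth xs) q = 0 \<longleftrightarrow> P (xs @ [1])"
    using Suc[of "\<lambda>xs. P (xs @ [1])"] by auto
  have mono: "r \<in> polys (Suc n)" if "r \<in> polys n" for r using that by (fastforce simp: polys_def)
  show ?case
  proof (intro bexI ballI)
    show "p * (pvar n + 1) + q * pvar n \<in> polys (Suc n)"
      using p q mono by simp
    fix xs assume xs: "xs \<in> cube (Suc n)"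
    define ys where "ys = take n xs"
    have l: "length ys = n" "xs = ys @ [xs ! n]"
      using xs take_Suc_conv_app_nth[of n xs] by (auto simp: cube_def ys_def)
    have "peval (nth xs) r = peval (nth ys) r" if "r \<in> polys n" for r
      by (rule peval_cong[OF that]) (simp add: ys_def)
    then show "peval (nth xs) (p * (pvar n + 1) + q * pvar n) = 0 \<longleftrightarrow> P xs"
      using p q l by (cases "xs ! n") (auto simp: cube_def)
  qed
qed

section \<open>Interpretation in spans\<close>

lemma gen_op_op [simp]: "gen_op (gen_op g) = g"
  by (cases g) auto

lemma tm_op_op [simp]: "tm_op (tm_op t) = t"
  by (induction t) auto

lemma gen_src_op [simp]: "gen_src (gen_op g) = gen_tgt g"
  and gen_tgt_op [simp]: "gen_tgt (gen_op g) = gen_src g"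
  by (cases g; simp)+

lemma tsrc_op [simp]: "tsrc (tm_op t) = ttgt t"
  and ttgt_op [simp]: "ttgt (tm_op t) = tsrc t"
  by (induction t) auto

fun wf_gen :: "gen \<Rightarrow> bool" where
  "wf_gen (Gate n X x) = is_gate n X x"
| "wf_gen (Box n p) = (p \<in> polys n)"
| "wf_gen _ = True"

lemma gens_spf2: "gens spf2 = {g. wf_gen g}"
proof -
  have "g \<in> gens pf2 \<longleftrightarrow> wf_gen g \<and> g \<noteq> Unit" for g
    by (cases g) (auto simp: pf2_def add_rels_def join_def pif2_def pres_op_def subMonof2_def subIsof2_def
      sub2_def Iso_f2_def Mono_f2_def image_Un image_iff)
  moreover have "g \<in> gen_op ` A \<longleftrightarrow> gen_op g \<in> A" for g A by (metis gen_op_op image_iff)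
  moreover have "wf_gen (gen_op g) = wf_gen g" for g by (cases g) auto
  ultimately show ?thesis
    by (auto simp: spf2_def join_def pres_op_def)
qed

definition base_rels :: "(tm \<times> tm) set" where
  "base_rels = iso_rels \<union> mono_rels \<union> sub_rels \<union> subIso_rels \<union> subMono_rels \<union> oracle_rels \<union> comonoid_rels"

text \<open>As reversal is an involution, the opposites nested in \<open>pif2\<close> and
  \<open>spf2\<close> collapse: a relation is a listed one or the reverse of a listed one. None of
  the listed ones mentions \<open>Unit\<close>.\<close>

lemma rels_spf2: "(s, t) \<in> rels spf2 \<longleftrightarrow> (s, t) \<in> base_rels \<or> (tm_op s, tm_op t) \<in> base_rels"
proof -
  have op: "(s, t) \<in> (\<lambda>(s, t). (tm_op s, tm_op t)) ` R \<longleftrightarrow> (tm_op s, tm_op t) \<in> R" for R s t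
    by force
  show ?thesis
    by (simp add: spf2_def pf2_def pif2_def subMonof2_def subIsof2_def Mono_f2_def Iso_f2_def sub2_def
      join_def add_rels_def pres_op_def op base_rels_def) blast
qed

lemma typed_op: "typed spf2 t n m \<Longrightarrow> typed spf2 (tm_op t) m n"
proof (induction rule: typed.induct)
  case (typed_Gen g)
  then have "gen_op g \<in> gens spf2" by (cases g) (auto simp: gens_spf2)
  from typed.typed_Gen[OF this] show ?case by simp
qed (auto intro: typed.intros)

section \<open>Partial functions denoted by terms\<close>

definition gfun :: "nat set \<Rightarrow> nat \<Rightarrow> bit list \<Rightarrow> bit list" where
  "gfun X x xs = xs[x := xs ! x + of_bool (\<forall>i \<in> X. xs ! i = 1)]"

lemma length_gfun [simp]: "length (gfun X x xs) = length xs"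
  by (simp add: gfun_def)

lemma nth_gfun: "i < length xs \<Longrightarrow>
    gfun X x xs ! i = (if i = x then xs ! x + of_bool (\<forall>i \<in> X. xs ! i = 1) else xs ! i)"
  by (simp add: gfun_def)

lemma gfun_involutory [simp]: "x \<notin> X \<Longrightarrow> gfun X x (gfun X x xs) = xs"
  by (cases "x < length xs") (auto simp: gfun_def list_eq_iff_nth_eq nth_list_update)

text \<open>Every generator but \<open>Unit\<close> denotes a partial function; \<open>Unit\<close>
  is multivalued. Its value here is a dummy, and the passage from \<open>pf\<close> to spans is
  restricted by \<open>no_unit\<close>.\<close>

fun pg :: "gen \<Rightarrow> bit list \<Rightarrow> bit list option" where
  "pg (Gate n X x) xs = Some (gfun X x xs)"
| "pg (Box n p) xs = (if peval (nth xs) p = 0 then Some xs else None)"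
| "pg U xs = Some [0]"
| "pg Udag xs = (if xs = [0] then Some [] else None)"
| "pg Counit xs = Some []"
| "pg Unit xs = None"

fun pf :: "tm \<Rightarrow> bit list \<Rightarrow> bit list option" where
  "pf (Gen g) xs = pg g xs"
| "pf (Id n) xs = Some xs"
| "pf (Swap n m) xs = Some (drop n xs @ take n xs)"
| "pf (s \<Zsemi> t) xs = Option.bind (pf s xs) (pf t)"
| "pf (s \<otimes> t) xs = Option.bind (pf s (take (tsrc s) xs)) (\<lambda>a.
     Option.bind (pf t (drop (tsrc s) xs)) (\<lambda>b. Some (a @ b)))"

fun no_unit :: "tm \<Rightarrow> bool" where
  "no_unit (Gen g) = (g \<noteq> Unit)"
| "no_unit (s \<Zsemi> t) = (no_unit s \<and> no_unit t)"
| "no_unit (s \<otimes> t) = (no_unit s \<and> no_unit t)"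
| "no_unit _ = True"

definition pspan :: "nat \<Rightarrow> (bit list \<Rightarrow> bit list option) \<Rightarrow> (bit list, bit list, bit list) span" where
  "pspan n F = ({xs \<in> cube n. F xs \<noteq> None}, \<lambda>xs. xs, \<lambda>xs. the (F xs))"

lemma is_span_pspan:
  assumes "\<And>xs ys. length xs = n \<Longrightarrow> F xs = Some ys \<Longrightarrow> length ys = m"
  shows "is_span (cube n) (cube m) (pspan n F)"
proof -
  have "finite {xs \<in> cube n. F xs \<noteq> None}" by (rule finite_subset[OF _ finite_cube[of n]]) auto
  moreover have "the (F xs) \<in> cube m" if "xs \<in> {xs \<in> cube n. F xs \<noteq> None}" for xs
  proof -
    obtain ys where "length xs = n" "F xs = Some ys" using \<open>xs \<in> _\<close> by auto
    with assms[OF this] show ?thesis by simp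
  qed
  ultimately show ?thesis by (auto simp: is_span_def pspan_def simp del: cube_iff)
qed

lemma pf_length: "typed spf2 t n m \<Longrightarrow> no_unit t \<Longrightarrow> length xs = n \<Longrightarrow> pf t xs = Some ys \<Longrightarrow> length ys = m"
proof (induction arbitrary: xs ys rule: typed.induct)
  case (typed_Gen g)
  then show ?case by (cases g) (auto split: if_splits)
next
  case (typed_Par s n m t n' m')
  have "tsrc s = n" using typed_src_tgt typed_Par by blast
  then obtain a b where ab: "pf s (take n xs) = Some a" "pf t (drop n xs) = Some b" "ys = a @ b"
    using typed_Par.prems by (auto simp: bind_eq_Some_conv)
  have "length a = m" by (rule typed_Par.IH(1)[OF _ _ ab(1)]) (use typed_Par.prems in auto)
  moreover have "length b = m'" by (rule typed_Par.IH(2)[OF _ _ ab(2)]) (use typed_Par.prems in auto)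
  ultimately show ?case using ab by simp
next
  case (typed_Seq s n m t k)
  from typed_Seq.prems obtain a where a: "pf s xs = Some a" "pf t a = Some ys"
    by (auto simp: bind_eq_Some_conv)
  have "length a = m" by (rule typed_Seq.IH(1)[OF _ _ a(1)]) (use typed_Seq.prems in auto)
  then show ?case by (rule typed_Seq.IH(2)[OF _ _ a(2), rotated]) (use typed_Seq.prems in auto)
qed auto

definition gsem :: "gen \<Rightarrow> (nat, bit list, bit list) span set" where
  "gsem g = (if g = Unit then span_class (cube 1, \<lambda>_. [], \<lambda>xs. xs) else span_class (pspan (gen_src g) (pg g)))"

interpretation FS: is_prop FSpan2
  by (rule is_prop_FSpan2)

abbreviation sem :: "tm \<Rightarrow> (nat, bit list, bit list) span set" where
  "sem \<equiv> FS.interp gsem"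

lemma gsem_in: "g \<in> gens spf2 \<Longrightarrow> gsem g \<in> Hom FSpan2 (gen_src g) (gen_tgt g)"
proof -
  assume g: "g \<in> gens spf2"
  have "is_span (cube 0) (cube 1) (cube 1, \<lambda>_. [], \<lambda>xs. xs)"
    by (auto simp: is_span_def)
  moreover have "is_span (cube (gen_src g)) (cube (gen_tgt g)) (pspan (gen_src g) (pg g))" if "g \<noteq> Unit"
    using that by (intro is_span_pspan pf_length[OF typed_Gen[OF g]]) auto
  ultimately show ?thesis by (auto simp: gsem_def intro: span_homI)
qed

lemma sem_in: "typed spf2 t n m \<Longrightarrow> sem t \<in> span_hom (cube n) (cube m)"
  using FS.interp_in[OF gsem_in] by simp

lemma is_span_pf: "typed spf2 t n m \<Longrightarrow> no_unit t \<Longrightarrow> is_span (cube n) (cube m) (pspan n (pf t))"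
  by (rule is_span_pspan) (rule pf_length)

text \<open>When left legs are inclusions of domains there is no multiplicity: a point of the
  pullback is determined by its image under the left leg. Composition of such spans is therefore
  composition of partial functions.\<close>

lemma sem_pf: "typed spf2 t n m \<Longrightarrow> no_unit t \<Longrightarrow> sem t = span_class (pspan n (pf t))"
proof (induction rule: typed.induct)
  case (typed_Gen g)
  then show ?case by (simp add: gsem_def pspan_def)
next
  case (typed_Id n)
  then show ?case by (simp add: pspan_def span_id_def cube_def)
next
  case (typed_Swap n m)
  then show ?case by (simp add: pspan_def span_symm_def cube_def)
next
  case (typed_Seq s n m t k)
  have sp: "is_span (cube n) (cube m) (pspan n (pf s))" "is_span (cube m) (cube k) (pspan m (pf t))"
    using typed_Seq by (auto intro: is_span_pf)
  have "span_iso (span_pullback (pspan n (pf s)) (pspan m (pf t))) (pspan n (pf (s \<Zsemi> t)))"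
    unfolding pspan_def span_pullback_def prod.case
  proof (rule span_isoI_witness[where f = fst and g = "\<lambda>xs. (xs, the (pf s xs))"])
    fix xs assume "xs \<in> {xs \<in> cube n. pf (s \<Zsemi> t) xs \<noteq> None}"
    then obtain ys zs where "length xs = n" "pf s xs = Some ys" "pf t ys = Some zs"
      by (auto simp: bind_eq_Some_conv)
    moreover from this have "length ys = m"
      using typed_Seq.prems by (intro pf_length[OF typed_Seq.hyps(1)]) auto
    ultimately show "(xs, the (pf s xs)) \<in> {(s', t'). s' \<in> {xs \<in> cube n. pf s xs \<noteq> None} \<and>
        t' \<in> {xs \<in> cube m. pf t xs \<noteq> None} \<and> the (pf s s') = t'} \<and> fst (xs, the (pf s xs)) = xs"
      by simp
  qed auto
  from span_class_eq[OF this] show ?case using typed_Seq span_comp_class[OF sp] by (simp del: pf.simps)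
next
  case (typed_Par s n m t n' m')
  have sp: "is_span (cube n) (cube m) (pspan n (pf s))" "is_span (cube n') (cube m') (pspan n' (pf t))"
    using typed_Par by (auto intro: is_span_pf)
  have "tsrc s = n" using typed_src_tgt typed_Par by blast
  then have "span_iso (span_times (pspan n (pf s)) (pspan n' (pf t))) (pspan (n + n') (pf (s \<otimes> t)))"
    unfolding pspan_def span_times_def prod.case
    by (intro span_isoI_witness[where f = "\<lambda>(a, b). a @ b" and g = "\<lambda>xs. (take n xs, drop n xs)"])
      (auto simp: bind_eq_Some_conv)
  from span_class_eq[OF this] show ?case using typed_Par span_tensor_class[OF sp] by (simp del: pf.simps)
qed

lemma sem_eqI:
  assumes "typed spf2 s n m" "typed spf2 t n m" "no_unit s" "no_unit t"
    "\<And>xs. length xs = n \<Longrightarrow> pf s xs = pf t xs"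
  shows "sem s = sem t"
proof -
  have "span_iso (pspan n (pf s)) (pspan n (pf t))"
    unfolding pspan_def using assms(5)
    by (intro span_isoI_witness[where f = "\<lambda>x. x" and g = "\<lambda>x. x"]) auto
  from span_class_eq[OF this] show ?thesis using assms by (simp add: sem_pf)
qed

section \<open>Reversal of spans\<close>

definition dag :: "(nat, 'a, 'b) span set \<Rightarrow> (nat, 'b, 'a) span set" where
  "dag C = (\<lambda>(S, l, r). (S, r, l)) ` C"

definition span_op :: "('s, 'a, 'b) span \<Rightarrow> ('s, 'b, 'a) span" where
  "span_op = (\<lambda>(S, l, r). (S, r, l))"

lemma span_op_op [simp]: "span_op (span_op S) = S"
  by (cases S) (simp add: span_op_def)

lemma span_iso_op: "span_iso (span_op S) (span_op T) \<longleftrightarrow> span_iso S T"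
  by (cases S; cases T) (auto simp: span_iso_def span_op_def)

lemma is_span_op: "is_span A B (span_op S) \<longleftrightarrow> is_span B A S"
  by (cases S) (auto simp: is_span_def span_op_def)

lemma dag_eq_image: "dag C = span_op ` C"
  by (auto simp: dag_def span_op_def)

lemma dag_class:
  fixes S :: "('s, 'a, 'b) span"
  shows "dag (span_class S) = span_class (span_op S)"
proof (rule set_eqI)
  fix T :: "(nat, 'b, 'a) span"
  have "T \<in> dag (span_class S) \<longleftrightarrow> span_op T \<in> span_class S"
  proof
    assume "span_op T \<in> span_class S"
    then have "span_op (span_op T) \<in> span_op ` span_class S" by (rule imageI)
    then show "T \<in> dag (span_class S)" by (simp add: dag_eq_image)
  qed (auto simp: dag_eq_image)
  then show "T \<in> dag (span_class S) \<longleftrightarrow> T \<in> span_class (span_op S)"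
    using span_iso_op[of S "span_op T"] by (simp add: span_class_def)
qed

lemma dag_comp:
  assumes "C \<in> span_hom A B" "D \<in> span_hom B E"
  shows "dag (span_comp C D) = span_comp (dag D) (dag C)"
proof -
  obtain S T :: "(nat, _, _) span" where S: "is_span A B S" "C = span_class S" and
    T: "is_span B E T" "D = span_class T" using assms by (elim span_homE) blast
  have "span_iso (span_op (span_pullback S T)) (span_pullback (span_op T) (span_op S))"
    by (cases S; cases T) (auto simp: span_op_def span_pullback_def
      intro!: span_isoI_witness[where f = "\<lambda>(a, b). (b, a)" and g = "\<lambda>(a, b). (b, a)"])
  from span_class_eq[OF this] show ?thesis
    using span_comp_class[OF S(1) T(1)] span_comp_class[of E B "span_op T" B A "span_op S"]
    by (simp add: S T dag_class is_span_op)
qed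

lemma dag_tensor:
  assumes "C \<in> span_hom A B" "D \<in> span_hom A' B'"
  shows "dag (span_tensor C D) = span_tensor (dag C) (dag D)"
proof -
  obtain S T :: "(nat, _, _) span" where S: "is_span A B S" "C = span_class S" and
    T: "is_span A' B' T" "D = span_class T" using assms by (elim span_homE) blast
  have "span_op (span_times S T) = span_times (span_op S) (span_op T)"
    by (cases S; cases T) (auto simp: span_op_def span_times_def)
  then show ?thesis
    using span_tensor_class[OF S(1) T(1)] span_tensor_class[of B A "span_op S" B' A' "span_op T"] S(1) T(1)
    by (simp add: S(2) T(2) dag_class is_span_op)
qed

lemma dag_gsem:
  assumes "wf_gen g" shows "gsem (gen_op g) = dag (gsem g)"
proof (cases g)
  case (Gate n X x)
  then have "x \<notin> X" using assms by (auto simp: is_gate_def)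
  \<comment> \<open>A gate is an involution, so the gate itself is an isomorphism between its graph
    and the reversed graph.\<close>
  then have "span_iso (pspan n (pg g)) (span_op (pspan n (pg g)))"
    unfolding Gate pspan_def span_op_def prod.case
    by (intro span_isoI_witness[where f = "gfun X x" and g = "gfun X x"]) auto
  from span_class_eq[OF this] show ?thesis by (simp add: Gate gsem_def dag_class)
next
  case (Box n p)
  have "span_iso (pspan n (pg g)) (span_op (pspan n (pg g)))"
    unfolding Box pspan_def span_op_def prod.case
    by (intro span_isoI_witness[where f = "\<lambda>x. x" and g = "\<lambda>x. x"]) (auto split: if_splits)
  from span_class_eq[OF this] show ?thesis by (simp add: Box gsem_def dag_class)
next
  case U
  have "span_iso (pspan 1 (pg Udag)) (span_op (pspan 0 (pg U)))"
    unfolding pspan_def span_op_def prod.case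
    by (intro span_isoI_witness[where f = "\<lambda>x. []" and g = "\<lambda>x. [0]"]) (auto split: if_splits)
  from span_class_eq[OF this] show ?thesis by (simp add: U gsem_def dag_class)
next
  case Udag
  have "span_iso (pspan 0 (pg U)) (span_op (pspan 1 (pg Udag)))"
    unfolding pspan_def span_op_def prod.case
    by (intro span_isoI_witness[where g = "\<lambda>x. []" and f = "\<lambda>x. [0]"]) (auto split: if_splits)
  from span_class_eq[OF this] show ?thesis by (simp add: Udag gsem_def dag_class)
next
  case Counit
  have "span_iso (cube 1, \<lambda>_. [], \<lambda>xs. xs) (span_op (pspan 1 (pg Counit)))"
    unfolding pspan_def span_op_def prod.case
    by (intro span_isoI_witness[where f = "\<lambda>x. x" and g = "\<lambda>x. x"]) auto
  from span_class_eq[OF this] show ?thesis by (simp add: Counit gsem_def dag_class)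
next
  case Unit
  have "span_iso (pspan 1 (pg Counit)) (span_op (cube 1, \<lambda>_. [], \<lambda>xs. xs))"
    unfolding pspan_def span_op_def prod.case
    by (intro span_isoI_witness[where f = "\<lambda>x. x" and g = "\<lambda>x. x"]) auto
  from span_class_eq[OF this] show ?thesis by (simp add: Unit gsem_def dag_class)
qed

lemma sem_op: "typed spf2 t n m \<Longrightarrow> sem (tm_op t) = dag (sem t)"
proof (induction rule: typed.induct)
  case (typed_Gen g)
  then show ?case by (simp add: gens_spf2 dag_gsem)
next
  case (typed_Id n)
  then show ?case by (simp add: dag_class span_op_def span_id_def)
next
  case (typed_Swap n m)
  have "span_iso (span_symm m n) (span_op (span_symm n m))"
    unfolding span_op_def span_symm_def prod.case
    by (intro span_isoI_witness[where f = "\<lambda>xs. drop m xs @ take m xs" and g = "\<lambda>xs. drop n xs @ take n xs"]) auto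
  from span_class_eq[OF this] show ?case by (simp add: dag_class)
next
  case (typed_Seq s n m t k)
  then show ?case using dag_comp[OF sem_in sem_in] by simp
next
  case (typed_Par s n m t n' m')
  then show ?case using dag_tensor[OF sem_in sem_in] by simp
qed

section \<open>Soundness\<close>

definition pf_sound :: "(tm \<times> tm) \<Rightarrow> bool" where
  "pf_sound = (\<lambda>(s, t). no_unit s \<and> no_unit t \<and> (\<forall>xs. length xs = tsrc s \<longrightarrow> pf s xs = pf t xs))"

lemma pf_soundI:
  "no_unit s \<Longrightarrow> no_unit t \<Longrightarrow> (\<And>xs. length xs = tsrc s \<Longrightarrow> pf s xs = pf t xs) \<Longrightarrow> pf_sound (s, t)"
  by (auto simp: pf_sound_def)

definition swp :: "nat \<Rightarrow> bit list \<Rightarrow> bit list" where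
  "swp n xs = map (\<lambda>i. xs ! transpose n (n + 1) i) [0..<length xs]"

lemma length_swp [simp]: "length (swp n xs) = length xs"
  by (simp add: swp_def)

lemma nth_swp: "i < length xs \<Longrightarrow> swp n xs ! i = xs ! transpose n (n + 1) i"
  by (simp add: swp_def)

lemma pf_swap_wires: "length xs = n + 2 + m \<Longrightarrow> pf (Id n \<otimes> Swap 1 1 \<otimes> Id m) xs = Some (swp n xs)"
proof -
  assume l: "length xs = n + 2 + m"
  have "take n xs @ (drop 1 (drop n (take (n + 2) xs)) @ take 1 (drop n (take (n + 2) xs))) @ drop (n + 2) xs = swp n xs"
  proof (rule nth_equalityI)
    fix i assume "i < length (take n xs @ (drop 1 (drop n (take (n + 2) xs)) @ take 1 (drop n (take (n + 2) xs))) @ drop (n + 2) xs)"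
    then have i: "i < length xs" using l by simp
    have s: "Suc (Suc (i - 2)) = i" if "i > n + 1" using that by simp
    consider "i < n" | "i = n" | "i = n + 1" | "i > n + 1" by linarith
    then show "(take n xs @ (drop 1 (drop n (take (n + 2) xs)) @ take 1 (drop n (take (n + 2) xs))) @ drop (n + 2) xs) ! i = swp n xs ! i"
      using i l by cases (auto simp: nth_swp nth_append min_def transpose_def s)
  qed (use l in simp)
  then show ?thesis using l by (simp add: add.commute)
qed

lemma pf_swap_wires_Suc: "length xs = Suc (Suc (n + m)) \<Longrightarrow>
    pf (Id n \<otimes> Swap (Suc 0) (Suc 0) \<otimes> Id m) xs = Some (swp n xs)"
  using pf_swap_wires[of xs n m] by (simp del: pf.simps)

lemma bij_image_Ball: "(\<forall>i \<in> f ` X. P i) \<longleftrightarrow> (\<forall>i \<in> X. P (f i))"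
  by auto

lemma swp_gfun:
  assumes "X \<subseteq> {..<length xs}" "x < length xs" "n + 1 < length xs"
  shows "gfun (transpose n (n + 1) ` X) (transpose n (n + 1) x) (swp n xs) = swp n (gfun X x xs)"
proof (rule nth_equalityI)
  let ?t = "transpose n (n + 1)"
  have t: "?t i < length xs" if "i < length xs" for i using that assms(3) by (auto simp: transpose_def)
  fix i assume "i < length (gfun (?t ` X) (?t x) (swp n xs))"
  then have i: "i < length xs" by simp
  have "i = ?t x \<longleftrightarrow> ?t i = x" by (metis transpose_involutory)
  moreover have "(\<forall>j \<in> ?t ` X. swp n xs ! j = 1) \<longleftrightarrow> (\<forall>j \<in> X. xs ! j = 1)"
    unfolding bij_image_Ball using assms(1) t by (intro ball_cong refl) (auto simp: nth_swp)
  ultimately show "gfun (?t ` X) (?t x) (swp n xs) ! i = swp n (gfun X x xs) ! i"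
    using i t[OF i] t[OF assms(2)] by (simp add: nth_gfun nth_swp)
qed simp

lemma gfun_append_right: "X \<subseteq> {..<length xs} \<Longrightarrow> x < length xs \<Longrightarrow> gfun X x (xs @ ys) = gfun X x xs @ ys"
proof -
  assume a: "X \<subseteq> {..<length xs}" "x < length xs"
  then have "(\<forall>i \<in> X. (xs @ ys) ! i = 1) \<longleftrightarrow> (\<forall>i \<in> X. xs ! i = 1)"
    by (intro ball_cong refl) (auto simp: nth_append)
  then show ?thesis using a by (simp add: gfun_def list_update_append nth_append)
qed

lemma gfun_append_left: "x < length ys \<Longrightarrow> gfun ((+) (length xs) ` X) (length xs + x) (xs @ ys) = xs @ gfun X x ys"
  by (simp add: gfun_def bij_image_Ball list_update_append nth_append)

lemma two_bits:
  assumes "length xs = 2" obtains a b :: bit where "xs = [a, b]"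
  using assms by (auto simp: numeral_2_eq_2 length_Suc_conv)

lemma ball_nth_update: "k \<notin> Z \<Longrightarrow> (\<forall>i \<in> Z. (xs[k := v]) ! i = w) \<longleftrightarrow> (\<forall>i \<in> Z. xs ! i = w)"
  by (intro ball_cong refl) (metis nth_list_update_neq)

text \<open>Adding the product over \<open>X\<close> to bit \<open>x\<close> changes the product
  over \<open>{x} \<union> Y\<close> by the product over \<open>X \<union> Y\<close>; the extra gate
  compensates for this.\<close>

lemma gfun_split:
  assumes "x < length xs" "y < length xs" "x \<notin> X" "y \<notin> X" "x \<noteq> y" "x \<notin> Y" "y \<notin> Y"
  shows "gfun ({x} \<union> Y) y (gfun X x xs) = gfun X x (gfun ({x} \<union> Y) y (gfun (X \<union> Y) y xs))"
    "gfun X x (gfun ({x} \<union> Y) y xs) = gfun (X \<union> Y) y (gfun ({x} \<union> Y) y (gfun X x xs))"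
proof -
  obtain P Q where PQ: "(\<forall>i \<in> X. xs ! i = 1) = P" "(\<forall>i \<in> Y. xs ! i = 1) = Q" by simp
  show "gfun ({x} \<union> Y) y (gfun X x xs) = gfun X x (gfun ({x} \<union> Y) y (gfun (X \<union> Y) y xs))"
    "gfun X x (gfun ({x} \<union> Y) y xs) = gfun (X \<union> Y) y (gfun ({x} \<union> Y) y (gfun X x xs))"
    using assms by (cases P; cases Q; cases "xs ! x"; simp add: gfun_def ball_nth_update ball_Un PQ list_update_swap[of x y])+
qed

text \<open>Where all the common controls are 1, both sides exchange the bits \<open>x\<close> and
  \<open>y\<close> by three controlled-nots; elsewhere no gate fires.\<close>

lemma gfun_exchange:
  assumes "x < length xs" "y < length xs" "x \<in> Y" "y \<in> X" "x \<notin> X" "y \<notin> Y" "X - {y} = Y - {x}"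
  shows "gfun X x (gfun Y y (gfun X x xs)) = gfun Y y (gfun X x (gfun Y y xs))"
proof -
  define Z where "Z = X - {y}"
  have XY: "X = {y} \<union> Z" "Y = {x} \<union> Z" "x \<notin> Z" "y \<notin> Z" "x \<noteq> y" using assms by (auto simp: Z_def)
  show ?thesis unfolding XY(1,2) using assms(1,2) XY(3-5)
    by (cases "xs ! x"; cases "xs ! y"; cases "\<forall>i \<in> Z. xs ! i = 1")
      (simp_all add: gfun_def ball_nth_update ball_Un list_update_swap[of x y])
qed

lemma gfun_commute:
  assumes "x \<notin> Y" "y \<notin> X"
  shows "gfun X x (gfun Y y xs) = gfun Y y (gfun X x xs)"
proof (cases "x = y")
  case True
  show ?thesis
  proof (cases "x < length xs")
    case lt: True
    have nX: "y \<notin> X" "y \<notin> Y" "y < length xs" using assms True lt by auto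
    show ?thesis
      unfolding True gfun_def ball_nth_update[OF nX(1)] ball_nth_update[OF nX(2)] nth_list_update_eq[OF nX(3)] list_update_overwrite
      by (simp only: add_ac)
  qed (use True in \<open>simp add: gfun_def list_update_beyond leI\<close>)
next
  case False
  show ?thesis using assms False by (simp add: gfun_def ball_nth_update list_update_swap[of x y])
qed

lemma pf_gate_right: "is_gate n X x \<Longrightarrow> length xs = n + k \<Longrightarrow>
    pf (gate n X x \<otimes> Id k) xs = Some (gfun X x xs)"
  using gfun_append_right[of X "take n xs" x "drop n xs"] by (simp add: is_gate_def)

lemma iso_pf_sound: "(s, t) \<in> iso_rels \<Longrightarrow> pf_sound (s, t)"
proof (induction rule: iso_rels.induct)
  case (gate_right n X x k)
  then show ?case by (intro pf_soundI) (simp_all add: pf_gate_right del: pf.simps(5))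
next
  case (gate_left n X x k)
  have "pf (Id k \<otimes> gate n X x) xs = Some (gfun ((+) k ` X) (k + x) xs)" if "length xs = k + n" for xs
    using gfun_append_left[of x "drop k xs" "take k xs" X] that gate_left by (simp add: is_gate_def)
  then show ?case by (intro pf_soundI) simp_all
next
  case (gate_wires n m X x)
  have "gfun (transpose n (n + 1) ` X) (transpose n (n + 1) x) (swp n xs) = swp n (gfun X x xs)"
    if "length xs = n + 2 + m" for xs
    using gate_wires that by (intro swp_gfun) (auto simp: is_gate_def)
  then show ?case by (intro pf_soundI) (simp_all add: pf_swap_wires_Suc del: pf.simps(5))
next
  case symmetry
  show ?case
  proof (rule pf_soundI)
    fix xs :: "bit list" assume "length xs = tsrc (Swap 1 1)"
    then have "length xs = 2" by simp
    then obtain a b where "xs = [a, b]" by (rule two_bits)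
    then show "pf (Swap 1 1) xs = pf (gate 2 {0} 1 \<Zsemi> gate 2 {1} 0 \<Zsemi> gate 2 {0} 1) xs"
      by (cases a; cases b) (simp_all add: gfun_def)
  qed simp_all
next
  case (a n X x)
  then show ?case by (intro pf_soundI) (simp_all add: is_gate_def)
next
  case (b n X x Y y)
  then show ?case using gfun_commute[of y X x Y] by (intro pf_soundI) simp_all
next
  case (c n X x Y y)
  then show ?case using gfun_split(1)[of x _ y X Y] by (intro pf_soundI) (auto simp: is_gate_def)
next
  case (d n X x Y y)
  then show ?case using gfun_split(2)[of x _ y X Y] by (intro pf_soundI) (auto simp: is_gate_def)
next
  case (e n X x Y y)
  then show ?case using gfun_exchange[of x _ y Y X] by (intro pf_soundI) (auto simp: is_gate_def)
qed

lemma mono_pf_sound: "(s, t) \<in> mono_rels \<Longrightarrow> pf_sound (s, t)"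
proof (induction rule: mono_rels.induct)
  case (1 n)
  have "gfun {..<n + 1} (n + 1) (0 # xs) = 0 # xs" for xs
  proof -
    have "\<not> (\<forall>i \<in> {..<n + 1}. (0 # xs) ! i = 1)" by (auto intro!: bexI[of _ 0])
    then have "gfun {..<n + 1} (n + 1) (0 # xs) = (0 # xs)[n + 1 := (0 # xs) ! (n + 1) + 0]"
      unfolding gfun_def by (simp only: of_bool_eq)
    then show ?thesis by (simp only: add_0_right list_update_id)
  qed
  then show ?case by (intro pf_soundI) simp_all
qed

lemma peval_take:
  assumes "p \<in> polys n" "length xs = n + m"
  shows "peval (nth (take n xs)) p = peval (nth xs) p"
  using assms by (intro peval_cong) auto

lemma bit_or_zero: "p + q + p * q = (0 :: bit) \<longleftrightarrow> p = 0 \<and> q = 0"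
  by (cases p; cases q) auto

lemma sub_pf_sound: "(s, t) \<in> sub_rels \<Longrightarrow> pf_sound (s, t)"
proof (induction rule: sub_rels.induct)
  case (box_Id n)
  then show ?case by (intro pf_soundI) simp_all
next
  case (box_Seq p n r)
  then show ?case by (intro pf_soundI) (auto simp: bit_or_zero simp del: bit_not_zero_iff)
next
  case (box_Par p n q m q')
  have "peval (nth (drop n xs)) q = peval (nth xs) q'" if "length xs = n + m" for xs
    using box_Par that by (auto intro: peval_cong)
  then show ?case using peval_take[OF box_Par(1)]
    by (intro pf_soundI) (auto simp: bit_or_zero simp del: bit_not_zero_iff)
next
  case (box_quotient p n q i)
  have "peval v (p + q * (pvar i ^ 2 - pvar i)) = peval v p" for v
    by (cases "v i") (simp_all add: diff_poly2)
  then show ?case by (intro pf_soundI) simp_all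
qed

lemma subIso_pf_sound: "(s, t) \<in> subIso_rels \<Longrightarrow> pf_sound (s, t)"
proof (induction rule: subIso_rels.induct)
  case (box_wires p n m)
  have "peval (nth (swp n xs)) p = peval (\<lambda>i. xs ! transpose n (n + 1) i) p" if "length xs = n + 2 + m" for xs
    using box_wires that by (intro peval_cong) (auto simp: nth_swp)
  then show ?case by (intro pf_soundI) (simp_all add: pf_swap_wires_Suc del: pf.simps(5))
next
  case (box_gate N n m k q q')
  have "peval (nth (gfun {n..<n + m} (n + m) xs)) q = peval (nth xs) q'" if "length xs = N" for xs
    unfolding box_gate(3) peval_psubst
  proof (rule peval_cong[OF box_gate(2)])
    fix i assume "i < N"
    have "(\<Prod>j \<in> {n..<n + m}. xs ! j) = of_bool (\<forall>j \<in> {n..<n + m}. xs ! j = 1)"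
      by (cases "\<forall>j \<in> {n..<n + m}. xs ! j = 1") auto
    then show "gfun {n..<n + m} (n + m) xs ! i =
        peval (nth xs) ((pvar (n + m := (\<Prod>i = n..<n + m. pvar i) + pvar (n + m))) i)"
      using \<open>i < N\<close> that by (simp add: nth_gfun add.commute del: plus_bit_def)
  qed
  then show ?case by (intro pf_soundI) simp_all
next
  case (box_Swap r n k)
  then show ?case by (intro pf_soundI) simp_all
qed

lemma subMono_pf_sound: "(s, t) \<in> subMono_rels \<Longrightarrow> pf_sound (s, t)"
proof (induction rule: subMono_rels.induct)
  case (1 p n m)
  have "peval (nth (take n xs @ 0 # drop n xs)) p =
      peval (\<lambda>i. peval (nth xs) (if i < n then pvar i else if i = n then 0 else pvar (i - 1))) p"
    if "length xs = n + m" for xs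
    using that by (intro peval_cong[OF 1]) (auto simp: nth_append nth_Cons')
  then show ?case by (intro pf_soundI) simp_all
qed

lemma no_unit_foldl: "no_unit (foldl (\<lambda>t m. t \<Zsemi> gate (n + 1) (K m) n) t ms) = no_unit t"
  by (induction ms arbitrary: t) auto

lemma meval_bit: "meval v m = of_bool (\<forall>i \<in> Poly_Mapping.keys m. v i = (1 :: bit))"
proof (cases "\<forall>i \<in> Poly_Mapping.keys m. v i = 1")
  case False
  then obtain i where "i \<in> Poly_Mapping.keys m" "v i = 0" by auto
  then have "\<exists>i \<in> Poly_Mapping.keys m. v i ^ Poly_Mapping.lookup m i = 0"
    by (intro bexI[of _ i]) (auto simp: in_keys_iff)
  then show ?thesis using False unfolding meval_def by (subst prod_zero) auto
qed (simp add: meval_def)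

lemma pf_oracle:
  assumes "\<And>m. m \<in> set ms \<Longrightarrow> Poly_Mapping.keys m \<subseteq> {..<n}" "length xs = n"
  shows "pf (oracle_tm n ms) (xs @ [y]) = Some (xs @ [y + (\<Sum>m \<leftarrow> ms. meval (nth xs) m)])"
proof -
  have "pf (foldl (\<lambda>t m. t \<Zsemi> gate (n + 1) (Poly_Mapping.keys m) n) t ms) zs =
      Some (xs @ [y + (\<Sum>m \<leftarrow> ms. meval (nth xs) m)])"
    if "pf t zs = Some (xs @ [y])" "\<And>m. m \<in> set ms \<Longrightarrow> Poly_Mapping.keys m \<subseteq> {..<n}" for t zs y
    using that
  proof (induction ms arbitrary: t y)
    case (Cons m ms)
    have "(\<forall>i \<in> Poly_Mapping.keys m. (xs @ [y]) ! i = 1) \<longleftrightarrow> (\<forall>i \<in> Poly_Mapping.keys m. xs ! i = 1)"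
      using Cons.prems(2)[of m] assms(2) by (intro ball_cong refl) (auto simp: nth_append)
    then have "gfun (Poly_Mapping.keys m) n (xs @ [y]) = xs @ [y + meval (nth xs) m]"
      using assms(2) nth_append_length[of xs y] by (simp add: gfun_def list_update_append meval_bit)
    then have "pf (t \<Zsemi> gate (n + 1) (Poly_Mapping.keys m) n) zs = Some (xs @ [y + meval (nth xs) m])"
      using Cons.prems(1) by simp
    from Cons.IH[OF this] Cons.prems(2) show ?case
      by (simp only: foldl.simps list.map sum_list.Cons add.assoc list.set_intros)
  qed simp
  from this[of "Id (n + 1)" "xs @ [y]" y] show ?thesis using assms by (simp add: oracle_tm_def)
qed

lemma oracle_pf_sound: "(s, t) \<in> oracle_rels \<Longrightarrow> pf_sound (s, t)"
proof (induction rule: oracle_rels.induct)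
  case (1 p n ms)
  have "(\<Sum>m \<leftarrow> ms. meval v m) = peval v p" for v
    unfolding peval_eq_sum_meval 1(3)[symmetric] using 1(2) by (simp add: sum_list_distinct_conv_sum_set)
  moreover have "Poly_Mapping.keys m \<subseteq> {..<n}" if "m \<in> set ms" for m using that 1 by (auto simp: polys_def)
  ultimately have *: "pf (oracle_tm n ms) (xs @ [0]) = Some (xs @ [peval (nth xs) p])" if "length xs = n" for xs
    using pf_oracle[of ms n xs 0] that by simp
  have "no_unit (oracle_tm n ms)" unfolding oracle_tm_def no_unit_foldl by simp
  then show ?case by (intro pf_soundI) (auto simp: *)
qed

lemma pf_diag: "pf diag [a] = Some [a, a]"
  by (cases a) (simp_all add: diag_def gfun_def)

lemma comonoid_pf_sound: "(s, t) \<in> comonoid_rels \<Longrightarrow> pf_sound (s, t)"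
proof (induction rule: comonoid_rels.induct)
qed (rule pf_soundI; (auto simp: diag_def; fail)?; auto simp: length_Suc_conv pf_diag diag_def[THEN arg_cong[of _ _ tsrc]])+

lemma base_pf_sound: "(s, t) \<in> base_rels \<Longrightarrow> pf_sound (s, t)"
  unfolding base_rels_def
  using iso_pf_sound mono_pf_sound sub_pf_sound subIso_pf_sound subMono_pf_sound oracle_pf_sound comonoid_pf_sound
  by blast

lemma sem_sound: assumes "tm_eq spf2 s t" shows "sem s = sem t"
proof (rule FS.interp_sound[OF gsem_in _ assms])
  fix s t n m assume st: "(s, t) \<in> rels spf2" "typed spf2 s n m" "typed spf2 t n m"
  have base: "sem s = sem t" if "(s, t) \<in> base_rels" "typed spf2 s n m" "typed spf2 t n m" for s t n m
    using that base_pf_sound[OF that(1)] typed_src_tgt[OF that(2)]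
    by (intro sem_eqI[OF that(2,3)]) (auto simp: pf_sound_def)
  from st(1) show "sem s = sem t"
    unfolding rels_spf2
  proof
    \<comment> \<open>A reversed relation may contain \<open>Unit\<close>, out of the reach of
      partial functions. It is obtained by reversing the spans of the relation it comes
      from.\<close>
    assume "(tm_op s, tm_op t) \<in> base_rels"
    from base[OF this typed_op typed_op] have "sem (tm_op s) = sem (tm_op t)" using st by blast
    then have "dag (sem (tm_op s)) = dag (sem (tm_op t))" by simp
    then show ?thesis using sem_op[OF typed_op] st by (metis tm_op_op)
  qed (use base st in blast)
qed

section \<open>Arrows of the presented prop\<close>

fun wtm :: "tm \<Rightarrow> bool" where
  "wtm (Gen g) = wf_gen g"
| "wtm (s \<Zsemi> t) = (wtm s \<and> wtm t \<and> ttgt s = tsrc t)"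
| "wtm (s \<otimes> t) = (wtm s \<and> wtm t)"
| "wtm _ = True"

lemma typed_iff: "typed spf2 t n m \<longleftrightarrow> wtm t \<and> tsrc t = n \<and> ttgt t = m"
proof
  assume "typed spf2 t n m"
  then show "wtm t \<and> tsrc t = n \<and> ttgt t = m"
    by (induction rule: typed.induct) (auto simp: gens_spf2)
next
  have "wtm t \<Longrightarrow> typed spf2 t (tsrc t) (ttgt t)"
    by (induction t) (auto intro!: typed.intros typed_Gen simp: gens_spf2)
  then show "wtm t \<and> tsrc t = n \<and> ttgt t = m \<Longrightarrow> typed spf2 t n m" by blast
qed

lemma tm_eq_wtm: "tm_eq spf2 s t \<Longrightarrow> wtm s \<and> wtm t \<and> tsrc s = tsrc t \<and> ttgt s = ttgt t"
  using tm_eq_typed typed_iff by metis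

\<comment> \<open>One type for all hom-sets: ill-typed terms are excluded because the relation is
  partial, and source and target are invariant, so they survive as \<open>dom\<close> and
  \<open>cod\<close>. Diagrammatic reasoning becomes rewriting with side conditions on
  types.\<close>
quotient_type arr = tm / partial: "tm_eq spf2"
proof (rule part_equivpI)
  show "\<exists>t. tm_eq spf2 t t" by (rule exI[of _ "Id 0"]) (auto intro: eq_refl typed_Id)
  show "symp (tm_eq spf2)" by (auto intro: sympI eq_sym)
  show "transp (tm_eq spf2)" by (auto intro: transpI eq_trans)
qed

lemma tm_eq_refl_iff: "tm_eq spf2 t t \<longleftrightarrow> wtm t"
  using tm_eq_wtm eq_refl typed_iff by metis

lift_definition ide :: "nat \<Rightarrow> arr" is Id by (simp add: tm_eq_refl_iff)
lift_definition swap :: "nat \<Rightarrow> nat \<Rightarrow> arr" is Swap by (simp add: tm_eq_refl_iff)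
lift_definition tens :: "arr \<Rightarrow> arr \<Rightarrow> arr" (infixl \<open>\<parallel>\<close> 65) is Par by (rule eq_Par)
lift_definition dom :: "arr \<Rightarrow> nat" is tsrc by (simp add: tm_eq_wtm)
lift_definition cod :: "arr \<Rightarrow> nat" is ttgt by (simp add: tm_eq_wtm)
text \<open>On arrows that do not fit the value is the first arrow, so that composition is total and
  \<open>dom_comp\<close> holds without a side condition.\<close>

lift_definition comp :: "arr \<Rightarrow> arr \<Rightarrow> arr" (infixl \<open>\<cdot>\<close> 60) is "\<lambda>s t. if ttgt s = tsrc t then s \<Zsemi> t else s"
  using tm_eq_wtm by (fastforce intro!: eq_Seq simp: typed_iff)
text \<open>An ill-formed generator denotes an identity, which makes \<open>dom_ar\<close>
  unconditional.\<close>

lift_definition ar :: "gen \<Rightarrow> arr" is "\<lambda>g. if wf_gen g then Gen g else Id (gen_src g)"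
  by (simp add: tm_eq_refl_iff)
lift_definition asem :: "arr \<Rightarrow> (nat, bit list, bit list) span set" is sem by (rule sem_sound)

lemma dom_ide [simp]: "dom (ide n) = n" by transfer simp
lemma cod_ide [simp]: "cod (ide n) = n" by transfer simp
lemma dom_swap [simp]: "dom (swap n m) = n + m" by transfer simp
lemma cod_swap [simp]: "cod (swap n m) = m + n" by transfer simp
lemma dom_tens [simp]: "dom (f \<parallel> g) = dom f + dom g" by transfer simp
lemma cod_tens [simp]: "cod (f \<parallel> g) = cod f + cod g" by transfer simp
lemma dom_comp [simp]: "dom (f \<cdot> g) = dom f" by transfer simp
lemma cod_comp [simp]: "cod f = dom g \<Longrightarrow> cod (f \<cdot> g) = cod g" by transfer simp
lemma dom_ar [simp]: "dom (ar g) = gen_src g" by transfer simp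
lemma cod_ar: "wf_gen g \<Longrightarrow> cod (ar g) = gen_tgt g" by transfer simp

lemma comp_ide_left [simp]: "dom f = n \<Longrightarrow> ide n \<cdot> f = f"
  by transfer (auto simp: tm_eq_refl_iff typed_iff intro!: eq_Id_left)
lemma comp_ide_right [simp]: "cod f = n \<Longrightarrow> f \<cdot> ide n = f"
  by transfer (auto simp: tm_eq_refl_iff typed_iff intro!: eq_Id_right)
lemma comp_assoc: "cod f = dom g \<Longrightarrow> cod g = dom h \<Longrightarrow> f \<cdot> g \<cdot> h = f \<cdot> (g \<cdot> h)"
  by transfer (auto simp: tm_eq_refl_iff typed_iff intro!: eq_Seq_assoc)
lemma tens_ide: "ide n \<parallel> ide m = ide (n + m)"
  by transfer (rule eq_Par_Id)
lemma tens_comp: "cod f = dom g \<Longrightarrow> cod f' = dom g' \<Longrightarrow> (f \<cdot> g) \<parallel> (f' \<cdot> g') = (f \<parallel> f') \<cdot> (g \<parallel> g')"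
  by transfer (auto simp: tm_eq_refl_iff typed_iff intro!: eq_interchange)
lemma tens_ide0_left [simp]: "ide 0 \<parallel> f = f"
  by transfer (auto simp: tm_eq_refl_iff typed_iff intro!: eq_Par_unit_left)
lemma tens_ide0_right [simp]: "f \<parallel> ide 0 = f"
  by transfer (auto simp: tm_eq_refl_iff typed_iff intro!: eq_Par_unit_right)
lemma tens_assoc: "f \<parallel> g \<parallel> h = f \<parallel> (g \<parallel> h)"
  by transfer (auto simp: tm_eq_refl_iff typed_iff intro!: eq_Par_assoc)
lemma swap_natural: "cod f = m \<Longrightarrow> cod g = m' \<Longrightarrow> (f \<parallel> g) \<cdot> swap m m' = swap (dom f) (dom g) \<cdot> (g \<parallel> f)"
  by transfer (auto simp: tm_eq_refl_iff typed_iff intro!: eq_Swap_natural)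
lemma swap_swap: "swap n m \<cdot> swap m n = ide (n + m)"
  by transfer (auto intro: eq_Swap_Swap)
lemma swap_hexagon: "swap n (m + k) = (swap n m \<parallel> ide k) \<cdot> (ide m \<parallel> swap n k)"
  by transfer (auto intro: eq_Swap_hexagon)

text \<open>Only one hexagon is an axiom. The other one consists of the inverses of its factors in
  reverse order, and inverses are unique.\<close>

lemma swap_hexagon_left: "swap (m + k) n = (ide m \<parallel> swap k n) \<cdot> (swap m n \<parallel> ide k)"
proof -
  let ?h = "(swap n m \<parallel> ide k) \<cdot> (ide m \<parallel> swap n k)"
  let ?h' = "(ide m \<parallel> swap k n) \<cdot> (swap m n \<parallel> ide k)"
  have "(ide m \<parallel> swap n k) \<cdot> ?h' = (ide m \<parallel> swap n k) \<cdot> (ide m \<parallel> swap k n) \<cdot> (swap m n \<parallel> ide k)"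
    by (rule comp_assoc[symmetric]) auto
  also have "\<dots> = ide (m + (n + k)) \<cdot> (swap m n \<parallel> ide k)"
    by (simp add: tens_comp[symmetric] swap_swap tens_ide)
  also have "\<dots> = swap m n \<parallel> ide k" by simp
  finally have *: "?h \<cdot> ?h' = (swap n m \<parallel> ide k) \<cdot> (swap m n \<parallel> ide k)"
    by (simp add: comp_assoc)
  have hh': "?h \<cdot> ?h' = ide (n + m + k)"
    unfolding * by (simp add: tens_comp[symmetric] swap_swap tens_ide)
  have "swap (m + k) n = swap (m + k) n \<cdot> (?h \<cdot> ?h')" unfolding hh' by simp
  also have "\<dots> = swap (m + k) n \<cdot> ?h \<cdot> ?h'" by (rule comp_assoc[symmetric]) auto
  also have "\<dots> = ?h'" unfolding swap_hexagon[symmetric] swap_swap by simp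
  finally show ?thesis .
qed

text \<open>Reversal sends axioms to axioms and relations to relations, up to the symmetry of
  equality, except that it exchanges the two hexagons.\<close>

lemma tm_eq_op: "tm_eq spf2 s t \<Longrightarrow> tm_eq spf2 (tm_op s) (tm_op t)"
proof (induction rule: tm_eq.induct)
  case (eq_Swap_hexagon n m k)
  have "abs_arr (Swap (m + k) n) = abs_arr ((Id m \<otimes> Swap k n) \<Zsemi> (Swap m n \<otimes> Id k))"
    using swap_hexagon_left[of m k n]
    by (simp add: swap.abs_eq ide.abs_eq tens.abs_eq comp.abs_eq tm_eq_refl_iff)
  then show ?case
    using Quotient3_rel[OF Quotient3_arr, of "Swap (m + k) n" "(Id m \<otimes> Swap k n) \<Zsemi> (Swap m n \<otimes> Id k)"]
    by (simp add: tm_eq_refl_iff)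
next
  case (eq_rel s t n m)
  then show ?case by (intro tm_eq.eq_rel[of _ _ _ m n] typed_op) (auto simp: rels_spf2)
next
  case (eq_trans s t r)
  show ?case using eq_trans.IH by (rule tm_eq.eq_trans)
next
  case (eq_Seq s n m t k s' t')
  then show ?case by (auto intro: tm_eq.eq_Seq typed_op)
next
  case (eq_Seq_assoc s n m t k r l)
  then show ?case by (auto intro!: eq_sym[OF tm_eq.eq_Seq_assoc] typed_op)
next
  case (eq_interchange s n m t k s' n' m' t' k')
  then show ?case by (auto intro!: tm_eq.eq_interchange typed_op)
next
  case (eq_Swap_natural s n m t n' m')
  then show ?case by (auto intro!: eq_sym[OF tm_eq.eq_Swap_natural] typed_op)
next
  case (eq_Id_left s n m) then show ?case by (auto intro: tm_eq.eq_Id_right typed_op)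
next
  case (eq_Id_right s n m) then show ?case by (auto intro: tm_eq.eq_Id_left typed_op)
next
  case (eq_Swap_Swap n m)
  then show ?case using tm_eq.eq_Swap_Swap by (metis add.commute tm_op.simps)
next
  case (eq_sym s t)
  show ?case using eq_sym.IH by (rule tm_eq.eq_sym)
qed (auto intro: tm_eq.intros typed_op)

lemma wtm_op: "wtm t \<Longrightarrow> wtm (tm_op t)"
  using tm_eq_op tm_eq_refl_iff by metis

text \<open>Halves the work below: each law for \<open>et\<close> and \<open>un\<close> yields the
  mirrored law for \<open>ep\<close> and \<open>ud\<close>, and conversely.\<close>

lift_definition rev :: "arr \<Rightarrow> arr" is tm_op by (rule tm_eq_op)

lemma dom_rev [simp]: "dom (rev f) = cod f" by transfer simp
lemma cod_rev [simp]: "cod (rev f) = dom f" by transfer simp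

lemma rev_ide [simp]: "rev (ide n) = ide n"
  by transfer (simp add: tm_eq_refl_iff)
lemma rev_swap [simp]: "rev (swap n m) = swap m n"
  by transfer (simp add: tm_eq_refl_iff)
lemma rev_tens [simp]: "rev (f \<parallel> g) = rev f \<parallel> rev g"
  by transfer (auto simp: tm_eq_refl_iff wtm_op)
lemma rev_comp [simp]: "cod f = dom g \<Longrightarrow> rev (f \<cdot> g) = rev g \<cdot> rev f"
  by transfer (auto simp: tm_eq_refl_iff wtm_op)

text \<open>Mediates between terms and arrows: \<open>ev\<close> unfolds by its equations, so a
  relation between terms turns into an equation between arrows.\<close>

fun ev :: "tm \<Rightarrow> arr" where
  "ev (Gen g) = ar g"
| "ev (Id n) = ide n"
| "ev (Swap n m) = swap n m"
| "ev (s \<Zsemi> t) = ev s \<cdot> ev t"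
| "ev (s \<otimes> t) = ev s \<parallel> ev t"

lemma dom_ev [simp]: "dom (ev t) = tsrc t"
  by (induction t) auto

lemma cod_ev: "wtm t \<Longrightarrow> cod (ev t) = ttgt t"
  by (induction t) (auto simp: cod_ar)

lemma ev_eq_abs: "wtm t \<Longrightarrow> ev t = abs_arr t"
proof (induction t)
  case (Gen g)
  then show ?case by (simp add: ar.abs_eq)
next
  case (Id n)
  then show ?case by (simp add: ide.abs_eq)
next
  case (Swap n m)
  then show ?case by (simp add: swap.abs_eq)
next
  case (Seq s t)
  then show ?case by (simp add: comp.abs_eq tm_eq_refl_iff)
next
  case (Par s t)
  then show ?case by (simp add: tens.abs_eq tm_eq_refl_iff)
qed

lemma ev_eq_iff: "wtm s \<Longrightarrow> wtm t \<Longrightarrow> ev s = ev t \<longleftrightarrow> tm_eq spf2 s t"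
  by (simp add: ev_eq_abs Quotient3_rel_abs[OF Quotient3_arr] tm_eq_refl_iff)
    (metis Quotient3_arr Quotient3_rel tm_eq_refl_iff)

lemma asem_ev: "wtm t \<Longrightarrow> asem (ev t) = sem t"
  by (simp add: ev_eq_abs asem.abs_eq tm_eq_refl_iff)

lemma arr_ev: obtains t where "wtm t" "f = ev t"
proof (induction f rule: arr.abs_induct)
  case (1 t)
  then show ?case using ev_eq_abs tm_eq_refl_iff by metis
qed

lemma ev_rel:
  assumes "(s, t) \<in> base_rels" "wtm s" "wtm t" "tsrc s = tsrc t" "ttgt s = ttgt t"
  shows "ev s = ev t"
  using assms by (subst ev_eq_iff) (auto intro!: eq_rel simp: rels_spf2 typed_iff)

lemma asem_ide: "asem (ide n) = span_class (span_id (cube n))"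
  by transfer simp
lemma asem_tens: "asem (f \<parallel> g) = span_tensor (asem f) (asem g)"
  by transfer simp
lemma asem_comp: "cod f = dom g \<Longrightarrow> asem (f \<cdot> g) = span_comp (asem f) (asem g)"
  by transfer simp

section \<open>Gates and boxes\<close>

text \<open>The identity as default value makes \<open>gt_inverse\<close>, \<open>rev_gt\<close> and
  the typing rules unconditional.\<close>

definition gt :: "nat \<Rightarrow> nat set \<Rightarrow> nat \<Rightarrow> arr" where
  "gt n X x = (if is_gate n X x then ar (Gate n X x) else ide n)"

text \<open>Boxes are indexed by the set they keep instead of by a polynomial.
  \<open>ex_poly_zeros\<close> provides a polynomial, and \<open>box_eqI\<close> shows that its
  choice does not matter.\<close>

definition bx :: "nat \<Rightarrow> (bit list \<Rightarrow> bool) \<Rightarrow> arr" where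
  "bx n P = ar (Box n (SOME p. p \<in> polys n \<and> (\<forall>xs \<in> cube n. peval (nth xs) p = 0 \<longleftrightarrow> P xs)))"

abbreviation "un \<equiv> ar U"
abbreviation "ud \<equiv> ar Udag"
abbreviation "ep \<equiv> ar Counit"
abbreviation "et \<equiv> ar Unit"

lemma bx_poly:
  obtains p where "p \<in> polys n" "\<And>xs. length xs = n \<Longrightarrow> peval (nth xs) p = 0 \<longleftrightarrow> P xs" "bx n P = ar (Box n p)"
proof -
  have "\<exists>p. p \<in> polys n \<and> (\<forall>xs \<in> cube n. peval (nth xs) p = 0 \<longleftrightarrow> P xs)"
    using ex_poly_zeros[of n P] by blast
  from someI_ex[OF this] show thesis by (intro that[OF _ _ bx_def]) auto
qed

lemma cod_ar_simps [simp]: "cod un = 1" "cod ud = 0" "cod ep = 0" "cod et = 1"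
  by (simp_all add: cod_ar)

lemma dom_gt [simp]: "dom (gt n X x) = n" and cod_gt [simp]: "cod (gt n X x) = n"
  by (simp_all add: gt_def cod_ar)

lemma dom_bx [simp]: "dom (bx n P) = n" and cod_bx [simp]: "cod (bx n P) = n"
  by (rule bx_poly[of n P]; simp add: cod_ar)+

lemma rev_ar: "wf_gen g \<Longrightarrow> rev (ar g) = ar (gen_op g)"
  by (cases g; transfer) (auto simp: tm_eq_refl_iff)

lemma rev_gt [simp]: "rev (gt n X x) = gt n X x"
  by (simp add: gt_def rev_ar)

lemma rev_bx [simp]: "rev (bx n P) = bx n P"
  by (rule bx_poly[of n P]) (simp add: rev_ar)

lemma rev_ar_simps [simp]: "rev un = ud" "rev ud = un" "rev ep = et" "rev et = ep"
  by (simp_all add: rev_ar)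

lemma ar_gate [simp]: "is_gate n X x \<Longrightarrow> ar (Gate n X x) = gt n X x"
  by (simp add: gt_def)

lemma gt_right:
  assumes "is_gate n X x" shows "gt n X x \<parallel> ide k = gt (n + k) X x"
proof -
  have "is_gate (n + k) X x" using assms by (auto simp: is_gate_def)
  then show ?thesis using ev_rel[of "gate n X x \<otimes> Id k" "gate (n + k) X x"] assms
    by (simp add: base_rels_def iso_rels.gate_right)
qed

lemma gt_left:
  assumes "is_gate n X x" shows "ide k \<parallel> gt n X x = gt (k + n) ((+) k ` X) (k + x)"
proof -
  have "is_gate (k + n) ((+) k ` X) (k + x)" using assms by (auto simp: is_gate_def)
  then show ?thesis using ev_rel[of "Id k \<otimes> gate n X x" "gate (k + n) ((+) k ` X) (k + x)"] assms
    by (simp add: base_rels_def iso_rels.gate_left)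
qed

definition sw :: "nat \<Rightarrow> nat \<Rightarrow> arr" where
  "sw n m = ide n \<parallel> swap 1 1 \<parallel> ide m"

lemma dom_sw [simp]: "dom (sw n m) = n + 2 + m" and cod_sw [simp]: "cod (sw n m) = n + 2 + m"
  by (simp_all add: sw_def)

lemma sw_inverse: "sw n m \<cdot> sw n m = ide (n + 2 + m)"
  by (simp add: sw_def tens_comp[symmetric] swap_swap tens_ide)

lemma is_gate_transpose:
  assumes "is_gate N X x" "n + 1 < N"
  shows "is_gate N (transpose n (n + 1) ` X) (transpose n (n + 1) x)"
  using assms by (auto simp: is_gate_def transpose_def split: if_splits)

lemma gt_wires:
  assumes "is_gate (n + 2 + m) X x"
  shows "sw n m \<cdot> gt (n + 2 + m) (transpose n (n + 1) ` X) (transpose n (n + 1) x) = gt (n + 2 + m) X x \<cdot> sw n m"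
  using ev_rel[OF _ _ _ _ _, of "Id n \<otimes> Swap 1 1 \<otimes> Id m \<Zsemi> gate (n + 2 + m) (transpose n (n + 1) ` X) (transpose n (n + 1) x)"
     "gate (n + 2 + m) X x \<Zsemi> Id n \<otimes> Swap 1 1 \<otimes> Id m"] assms is_gate_transpose[OF assms, of n]
  by (simp add: base_rels_def iso_rels.gate_wires[simplified] sw_def)

lemma swap_eq_gates: "swap 1 1 = gt 2 {0} 1 \<cdot> gt 2 {1} 0 \<cdot> gt 2 {0} 1"
  using ev_rel[of "Swap 1 1" "gate 2 {0} 1 \<Zsemi> gate 2 {1} 0 \<Zsemi> gate 2 {0} 1"] iso_rels.symmetry
  by (simp add: base_rels_def is_gate_def)

lemma gt_inverse: "gt n X x \<cdot> gt n X x = ide n"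
proof (cases "is_gate n X x")
  case True
  then show ?thesis using ev_rel[of "gate n X x \<Zsemi> gate n X x" "Id n"] iso_rels.a[of n X x]
    by (simp add: base_rels_def)
qed (simp add: gt_def)

lemma gt_commute:
  assumes "is_gate n X x" "is_gate n Y y" "x \<notin> Y" "y \<notin> X"
  shows "gt n X x \<cdot> gt n Y y = gt n Y y \<cdot> gt n X x"
  using ev_rel[of "gate n X x \<Zsemi> gate n Y y" "gate n Y y \<Zsemi> gate n X x"] iso_rels.b[OF assms] assms
  by (simp add: base_rels_def)

lemma gt_split:
  assumes "is_gate n X x" "is_gate n (insert x Y) y" "x \<notin> Y" "y \<notin> X"
  shows "gt n X x \<cdot> gt n (insert x Y) y = gt n (X \<union> Y) y \<cdot> gt n (insert x Y) y \<cdot> gt n X x"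
proof -
  have XY: "is_gate n (X \<union> Y) y" using assms by (auto simp: is_gate_def)
  show ?thesis
    using ev_rel[of "gate n X x \<Zsemi> gate n ({x} \<union> Y) y" "gate n (X \<union> Y) y \<Zsemi> gate n ({x} \<union> Y) y \<Zsemi> gate n X x"]
      iso_rels.c[of n X x Y y] assms XY
    by (simp add: base_rels_def)
qed

lemma un_cnot: "(un \<parallel> ide 1) \<cdot> gt 2 {0} 1 = un \<parallel> ide 1"
proof -
  have "{..<0 + 1 :: nat} = {0}" by auto
  then have "(u \<otimes> Id 1 \<Zsemi> gate 2 {0} 1, u \<otimes> Id 1) \<in> base_rels"
    using mono_rels.intros[of 0] by (simp add: base_rels_def numeral_2_eq_2)
  from ev_rel[OF this] show ?thesis by (simp add: is_gate_def)
qed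

text \<open>The oracle relation on no wires for the zero polynomial, whose list of monomials is
  empty: the oracle is an identity, and so is the box [0].\<close>

lemma un_ud: "un \<cdot> ud = ide 0"
proof -
  have "(Id 0 \<otimes> u \<Zsemi> oracle_tm 0 [] \<Zsemi> Id 0 \<otimes> udag, box 0 0) \<in> base_rels"
    using oracle_rels.intros[of 0 0 "[]"] by (simp add: base_rels_def)
  from ev_rel[OF this] have "un \<cdot> ud = ar (Box 0 0)" by (simp add: oracle_tm_def)
  moreover have "ar (Box 0 0) = ide 0"
    using ev_rel[of "box 0 0" "Id 0"] sub_rels.box_Id[of 0] by (simp add: base_rels_def)
  ultimately show ?thesis by simp
qed

lemma box_bcong:
  assumes "p \<in> polys n" "q \<in> polys n" "bcong n p q"
  shows "ar (Box n p) = ar (Box n q)"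
proof -
  obtain c where c: "\<forall>i<n. c i \<in> polys n" "p = q + (\<Sum>i<n. c i * (pvar i ^ 2 - pvar i))"
    using assms(3) by (auto simp: bcong_def)
  have "ar (Box n (q + (\<Sum>i<k. c i * (pvar i ^ 2 - pvar i)))) = ar (Box n q)" if "k \<le> n" for k
    using that
  proof (induction k)
    case (Suc k)
    let ?r = "q + (\<Sum>i<k. c i * (pvar i ^ 2 - pvar i))"
    have mem: "c i * (pvar i ^ 2 - pvar i) \<in> polys n" if "i < n" for i
      using c(1) that by (auto simp: diff_poly2)
    have r: "?r \<in> polys n"
      using Suc.prems assms(2) by (intro polys_add polys_sum mem) auto
    have "(box n (?r + c k * (pvar k ^ 2 - pvar k)), box n ?r) \<in> base_rels"
      using Suc.prems r c(1) by (auto simp: base_rels_def intro!: sub_rels.box_quotient)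
    from ev_rel[OF this] have "ar (Box n (?r + c k * (pvar k ^ 2 - pvar k))) = ar (Box n ?r)"
      using r mem[of k] Suc.prems by (simp del: power2_eq_square)
    then show ?case using Suc by (simp add: add.assoc)
  qed simp
  from this[of n] show ?thesis using c(2) by simp
qed

text \<open>Over the field with two elements equal zeros mean equal values, and equal values mean
  congruence modulo the x_i^2 - x_i. In this sense the relations for boxes are complete.\<close>

lemma box_eqI:
  assumes "p \<in> polys n" "q \<in> polys n"
    "\<And>xs. length xs = n \<Longrightarrow> peval (nth xs) p = 0 \<longleftrightarrow> peval (nth xs) q = 0"
  shows "ar (Box n p) = ar (Box n q)"
proof (intro box_bcong bcong_iff_peval assms(1,2))
  fix v :: "nat \<Rightarrow> bit"
  have eq: "peval v r = peval (nth (map v [0..<n])) r" if "r \<in> polys n" for r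
    using that by (rule peval_cong) simp
  have "peval v p = 0 \<longleftrightarrow> peval v q = 0"
    unfolding eq[OF assms(1)] eq[OF assms(2)] by (rule assms(3)) simp
  then show "peval v p = peval v q"
    by (cases "peval v p"; cases "peval v q") auto
qed

lemma box_bx: "p \<in> polys n \<Longrightarrow> ar (Box n p) = bx n (\<lambda>xs. peval (nth xs) p = 0)"
proof -
  assume p: "p \<in> polys n"
  obtain q where q: "q \<in> polys n" "\<And>xs. length xs = n \<Longrightarrow> peval (nth xs) q = 0 \<longleftrightarrow> peval (nth xs) p = 0"
    "bx n (\<lambda>xs. peval (nth xs) p = 0) = ar (Box n q)"
    by (rule bx_poly[of n "\<lambda>xs. peval (nth xs) p = 0"]) (rule that)
  show ?thesis unfolding q(3) by (rule box_eqI[OF p q(1)]) (rule q(2)[symmetric])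
qed

lemma bx_cong: "(\<And>xs. length xs = n \<Longrightarrow> P xs \<longleftrightarrow> Q xs) \<Longrightarrow> bx n P = bx n Q"
  unfolding bx_def by (intro arg_cong[of _ _ ar] arg_cong[of _ _ "Box n"] arg_cong[of _ _ Eps] ext) auto

lemma bx_True: "(\<And>xs. length xs = n \<Longrightarrow> P xs) \<Longrightarrow> bx n P = ide n"
proof -
  assume "\<And>xs. length xs = n \<Longrightarrow> P xs"
  then have "bx n P = ar (Box n 0)" by (subst box_bx) (auto intro: bx_cong)
  also have "\<dots> = ide n"
    using ev_rel[of "box n 0" "Id n"] sub_rels.box_Id[of n] by (simp add: base_rels_def)
  finally show ?thesis .
qed

lemma bx_bx: "bx n P \<cdot> bx n Q = bx n (\<lambda>xs. P xs \<and> Q xs)"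
proof -
  obtain p where p: "p \<in> polys n" "\<And>xs. length xs = n \<Longrightarrow> peval (nth xs) p = 0 \<longleftrightarrow> P xs" "bx n P = ar (Box n p)"
    by (rule bx_poly[of n P]) (rule that)
  obtain q where q: "q \<in> polys n" "\<And>xs. length xs = n \<Longrightarrow> peval (nth xs) q = 0 \<longleftrightarrow> Q xs" "bx n Q = ar (Box n q)"
    by (rule bx_poly[of n Q]) (rule that)
  have "(box n p \<Zsemi> box n q, box n (q + p + q * p)) \<in> base_rels"
    using sub_rels.box_Seq[OF q(1) p(1)] by (simp add: base_rels_def)
  from ev_rel[OF this] have "bx n P \<cdot> bx n Q = ar (Box n (q + p + q * p))" using p q by simp
  also have "\<dots> = bx n (\<lambda>xs. P xs \<and> Q xs)"
    using p q by (subst box_bx) (auto intro!: bx_cong simp: bit_or_zero simp del: bit_not_zero_iff)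
  finally show ?thesis .
qed

lemma bx_tens: "bx n P \<parallel> bx m Q = bx (n + m) (\<lambda>xs. P (take n xs) \<and> Q (drop n xs))"
proof -
  obtain p where p: "p \<in> polys n" "\<And>xs. length xs = n \<Longrightarrow> peval (nth xs) p = 0 \<longleftrightarrow> P xs" "bx n P = ar (Box n p)"
    by (rule bx_poly[of n P]) (rule that)
  obtain q where q: "q \<in> polys m" "\<And>xs. length xs = m \<Longrightarrow> peval (nth xs) q = 0 \<longleftrightarrow> Q xs" "bx m Q = ar (Box m q)"
    by (rule bx_poly[of m Q]) (rule that)
  define q' where "q' = psubst (\<lambda>i. pvar (n + i)) q"
  have q': "q' \<in> polys (n + m)" unfolding q'_def by (rule polys_psubst[OF q(1)]) simp
  have p': "p \<in> polys (n + m)" using p(1) by (fastforce simp: polys_def)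
  have ev_q': "peval (nth xs) q' = peval (nth (drop n xs)) q" if "length xs = n + m" for xs
    unfolding q'_def peval_psubst using that by (intro peval_cong[OF q(1)]) simp
  have ev_p: "peval (nth xs) p = peval (nth (take n xs)) p" if "length xs = n + m" for xs
    using that by (intro peval_cong[OF p(1)]) simp
  have "(box n p \<otimes> box m q, box (n + m) (p + q' + p * q')) \<in> base_rels"
    using sub_rels.box_Par[OF p(1) q(1) q'_def] by (simp add: base_rels_def)
  from ev_rel[OF this] have "bx n P \<parallel> bx m Q = ar (Box (n + m) (p + q' + p * q'))" using p q p' q' by simp
  also have "\<dots> = bx (n + m) (\<lambda>xs. P (take n xs) \<and> Q (drop n xs))"
    using p q p' q' ev_p ev_q'
    by (subst box_bx) (auto intro!: bx_cong simp: bit_or_zero simp del: bit_not_zero_iff)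
  finally show ?thesis .
qed

lemma bx_sw: "sw n m \<cdot> bx (n + 2 + m) P = bx (n + 2 + m) (\<lambda>xs. P (swp n xs)) \<cdot> sw n m"
proof -
  let ?N = "n + 2 + m"
  obtain p where p: "p \<in> polys ?N" "\<And>xs. length xs = ?N \<Longrightarrow> peval (nth xs) p = 0 \<longleftrightarrow> P xs" "bx ?N P = ar (Box ?N p)"
    by (rule bx_poly[of ?N P]) (rule that)
  define p' where "p' = psubst (\<lambda>i. pvar (transpose n (n + 1) i)) p"
  have p': "p' \<in> polys ?N" unfolding p'_def by (rule polys_psubst[OF p(1)]) (auto simp: transpose_def)
  have ev_p': "peval (nth xs) p' = peval (nth (swp n xs)) p" if "length xs = ?N" for xs
    unfolding p'_def peval_psubst using that by (intro peval_cong[OF p(1)]) (simp add: nth_swp)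
  have "(Id n \<otimes> Swap 1 1 \<otimes> Id m \<Zsemi> box ?N p, box ?N p' \<Zsemi> Id n \<otimes> Swap 1 1 \<otimes> Id m) \<in> base_rels"
    using subIso_rels.box_wires[OF p(1)] by (simp add: base_rels_def p'_def)
  from ev_rel[OF this] have "sw n m \<cdot> bx ?N P = ar (Box ?N p') \<cdot> sw n m" using p p' by (simp add: sw_def)
  also have "ar (Box ?N p') = bx ?N (\<lambda>xs. P (swp n xs))"
    using p p' ev_p' by (subst box_bx) (auto intro!: bx_cong)
  finally show ?thesis .
qed

text \<open>The relation \<open>box_gate\<close> speaks of consecutive controls directly below the
  target. Its case without wires before the controls suffices, since \<open>gt_bx\<close> brings
  every gate to this shape by exchanging wires.\<close>

lemma bx_gt_initial:
  assumes "x < N"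
  shows "gt N {..<x} x \<cdot> bx N Q = bx N (\<lambda>xs. Q (gfun {..<x} x xs)) \<cdot> gt N {..<x} x"
proof -
  obtain q where q: "q \<in> polys N" "\<And>xs. length xs = N \<Longrightarrow> peval (nth xs) q = 0 \<longleftrightarrow> Q xs" "bx N Q = ar (Box N q)"
    by (rule bx_poly[of N Q]) (rule that)
  define q' where "q' = psubst (pvar (0 + x := (\<Prod>i \<in> {0..<0 + x}. pvar i) + pvar (0 + x))) q"
  have N: "N = 0 + x + 1 + (N - x - 1)" using assms by simp
  have q': "q' \<in> polys N" unfolding q'_def
    by (rule polys_psubst[OF q(1)]) (use assms in \<open>auto intro!: polys_add polys_prod\<close>)
  have i: "{0..<0 + x} = {..<x}" by auto
  have "(gate N {0..<0 + x} (0 + x) \<Zsemi> box N q, box N q' \<Zsemi> gate N {0..<0 + x} (0 + x)) \<in> base_rels"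
    using subIso_rels.box_gate[OF N q(1) q'_def] by (simp add: base_rels_def)
  note rel = this[unfolded i]
  have g: "is_gate N {..<x} x" using assms by (auto simp: is_gate_def)
  \<comment> \<open>The zeros of the substituted polynomial are read off from the soundness of the
    relation itself, instead of computing the substitution.\<close>
  have "pf_sound (gate N {..<x} (0 + x) \<Zsemi> box N q, box N q' \<Zsemi> gate N {..<x} (0 + x))"
    by (rule base_pf_sound[OF rel])
  then have ev_q': "peval (nth (gfun {..<x} x xs)) q = 0 \<longleftrightarrow> peval (nth xs) q' = 0" if "length xs = N" for xs
    using that by (auto simp: pf_sound_def split: if_splits)
  from ev_rel[OF rel] have "gt N {..<x} x \<cdot> bx N Q = ar (Box N q') \<cdot> gt N {..<x} x" using q q' g by simp
  also have "ar (Box N q') = bx N (\<lambda>xs. Q (gfun {..<x} x xs))"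
    using q q' ev_q' by (subst box_bx) (auto intro!: bx_cong)
  finally show ?thesis .
qed

text \<open>The oracle relation for p = x_0, through which boxes and ancillas interact.\<close>

lemma un_cnot_ud: "(ide 1 \<parallel> un) \<cdot> gt 2 {0} 1 \<cdot> (ide 1 \<parallel> ud) = bx 1 (\<lambda>xs. xs ! 0 = 0)"
proof -
  have "Poly_Mapping.keys (pvar 0) = {Poly_Mapping.single 0 1}"
    by (simp add: pvar_def)
  then have "(Id 1 \<otimes> u \<Zsemi> oracle_tm 1 [Poly_Mapping.single 0 1] \<Zsemi> Id 1 \<otimes> udag, box 1 (pvar 0)) \<in> oracle_rels"
    by (intro oracle_rels.intros) simp_all
  then have "(Id 1 \<otimes> u \<Zsemi> oracle_tm 1 [Poly_Mapping.single 0 1] \<Zsemi> Id 1 \<otimes> udag, box 1 (pvar 0)) \<in> base_rels"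
    unfolding base_rels_def by blast
  then have "(Id 1 \<otimes> u \<Zsemi> (Id 2 \<Zsemi> gate 2 {0} 1) \<Zsemi> Id 1 \<otimes> udag, box 1 (pvar 0)) \<in> base_rels"
    by (simp add: oracle_tm_def numeral_2_eq_2)
  from ev_rel[OF this] have "(ide 1 \<parallel> un) \<cdot> gt 2 {0} 1 \<cdot> (ide 1 \<parallel> ud) = ar (Box 1 (pvar 0))"
    by (simp add: is_gate_def)
  then show ?thesis by (simp add: box_bx)
qed

lemma counit_right: "(ide 1 \<parallel> un) \<cdot> gt 2 {0} 1 \<cdot> (ide 1 \<parallel> ep) = ide 1"
  using ev_rel[of "diag \<Zsemi> Id 1 \<otimes> counit" "Id 1"] comonoid_rels.counit_right
  by (simp add: base_rels_def diag_def is_gate_def)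

lemma counit_left: "(ide 1 \<parallel> un) \<cdot> gt 2 {0} 1 \<cdot> (ep \<parallel> ide 1) = ide 1"
  using ev_rel[of "diag \<Zsemi> counit \<otimes> Id 1" "Id 1"] comonoid_rels.counit_left
  by (simp add: base_rels_def diag_def is_gate_def)

section \<open>Ancillas and discarding\<close>

text \<open>Lets an equation for \<open>a \<cdot> b\<close> rewrite inside a composite bracketed to
  the right, the usual form of the calculations below.\<close>

lemma comp_eq_assoc: "a \<cdot> b = c \<Longrightarrow> cod a = dom b \<Longrightarrow> cod b = dom r \<Longrightarrow> a \<cdot> (b \<cdot> r) = c \<cdot> r"
  by (metis comp_assoc)

lemma slide1: "cod f = a \<Longrightarrow> dom g = b \<Longrightarrow> (f \<parallel> ide b) \<cdot> (ide a \<parallel> g) = f \<parallel> g"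
  by (simp add: tens_comp[symmetric])

lemma slide2: "dom f = a \<Longrightarrow> cod g = b \<Longrightarrow> (ide a \<parallel> g) \<cdot> (f \<parallel> ide b) = f \<parallel> g"
  by (simp add: tens_comp[symmetric])

lemma slide: "cod f = a \<Longrightarrow> dom g = b \<Longrightarrow> dom f = c \<Longrightarrow> cod g = d \<Longrightarrow>
    (f \<parallel> ide b) \<cdot> (ide a \<parallel> g) = (ide c \<parallel> g) \<cdot> (f \<parallel> ide d)"
  by (simp add: slide1 slide2)

lemma ide_tens_comp: "cod f = dom g \<Longrightarrow> ide a \<parallel> (f \<cdot> g) = (ide a \<parallel> f) \<cdot> (ide a \<parallel> g)"
  by (simp add: tens_comp[symmetric])

lemma comp_tens_ide: "cod f = dom g \<Longrightarrow> (f \<cdot> g) \<parallel> ide a = (f \<parallel> ide a) \<cdot> (g \<parallel> ide a)"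
  by (simp add: tens_comp[symmetric])

lemma ide_ide_tens: "ide a \<parallel> (ide b \<parallel> f) = ide (a + b) \<parallel> f"
  by (metis tens_assoc tens_ide)

text \<open>The hexagon with \<open>m\<close> and \<open>k\<close> zero makes
  \<open>swap n 0\<close> idempotent, and an invertible idempotent is an identity.\<close>

lemma swap_0_right [simp]: "swap n 0 = ide n"
proof -
  have xx: "swap n 0 = swap n 0 \<cdot> swap n 0"
    using swap_hexagon[of n 0 0] by simp
  have "swap n 0 = swap n 0 \<cdot> (swap n 0 \<cdot> swap 0 n)" by (simp add: swap_swap)
  also have "\<dots> = swap n 0 \<cdot> swap n 0 \<cdot> swap 0 n" by (simp add: comp_assoc)
  also have "\<dots> = ide n" unfolding xx[symmetric] by (simp add: swap_swap)
  finally show ?thesis .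
qed

lemma swap_0_left [simp]: "swap 0 n = ide n"
  using rev_swap[of n 0] by simp

lemma swap_into: "dom f = 0 \<Longrightarrow> cod f = m \<Longrightarrow> (ide n \<parallel> f) \<cdot> swap n m = f \<parallel> ide n"
  by (simp add: swap_natural)

lemma swap_into': "dom f = 0 \<Longrightarrow> cod f = m \<Longrightarrow> (f \<parallel> ide n) \<cdot> swap m n = ide n \<parallel> f"
  by (simp add: swap_natural)

lemma swap_out': "cod f = 0 \<Longrightarrow> dom f = m \<Longrightarrow> swap m n \<cdot> (ide n \<parallel> f) = f \<parallel> ide n"
  using swap_natural[of f 0 "ide n" n] by simp

abbreviation "cnot \<equiv> gt 2 {0} 1"

definition z0 :: arr where "z0 = bx 1 (\<lambda>xs. xs ! 0 = 0)"

lemma dom_z0 [simp]: "dom z0 = 1" and cod_z0 [simp]: "cod z0 = 1" and rev_z0 [simp]: "rev z0 = z0"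
  by (simp_all add: z0_def)

lemma z0_z0: "z0 \<cdot> z0 = z0"
  by (simp add: z0_def bx_bx)

lemma z0_eq: "z0 = (ide 1 \<parallel> un) \<cdot> cnot \<cdot> (ide 1 \<parallel> ud)"
  by (simp only: z0_def un_cnot_ud)

text \<open>The wire consumed by \<open>f\<close> lies between the controls and the target of the
  gate. It is exchanged with the target first, and this renumbers nothing but the target.\<close>

lemma gt_skip:
  assumes "dom f = 1" "cod f = 0" "X \<subseteq> {..<N}"
  shows "(ide N \<parallel> f \<parallel> ide 1) \<cdot> gt (N + 1) X N = gt (N + 2) X (N + 1) \<cdot> (ide N \<parallel> f \<parallel> ide 1)"
proof -
  have g: "is_gate (N + 1) X N" "is_gate (N + 2 + 0) X (N + 1)" using assms(3) by (auto simp: is_gate_def)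
  have "transpose N (N + 1) ` X = (\<lambda>i. i) ` X"
    using assms(3) by (intro image_cong) (auto simp: transpose_def)
  then have t: "transpose N (N + 1) ` X = X" by simp
  have F: "ide N \<parallel> f \<parallel> ide 1 = sw N 0 \<cdot> (ide (N + 1) \<parallel> f)"
  proof -
    have "ide N \<parallel> f \<parallel> ide 1 = ide N \<parallel> (swap 1 1 \<cdot> (ide 1 \<parallel> f))"
      using assms by (simp add: swap_out' tens_assoc)
    then show ?thesis using assms by (simp add: ide_tens_comp sw_def ide_ide_tens)
  qed
  have "(ide (N + 1) \<parallel> f) \<cdot> gt (N + 1) X N = (gt (N + 1) X N \<parallel> ide 1) \<cdot> (ide (N + 1) \<parallel> f)"
    using slide[of "gt (N + 1) X N" "N + 1" f 1 "N + 1" 0] assms by simp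
  also have "\<dots> = gt (N + 2) X N \<cdot> (ide (N + 1) \<parallel> f)"
    using gt_right[OF g(1), of 1] by simp
  finally have "(ide N \<parallel> f \<parallel> ide 1) \<cdot> gt (N + 1) X N = sw N 0 \<cdot> gt (N + 2) X N \<cdot> (ide (N + 1) \<parallel> f)"
    unfolding F using assms by (simp add: comp_assoc)
  also have "sw N 0 \<cdot> gt (N + 2) X N = gt (N + 2) X (N + 1) \<cdot> sw N 0"
    using gt_wires[OF g(2)] by (simp add: t[simplified])
  finally show ?thesis unfolding F using assms by (simp add: comp_assoc)
qed

lemma is_gate_small [simp]:
  "is_gate 2 {0} 1" "is_gate 2 {1} 0" "is_gate 3 {0} 1" "is_gate 3 {0} 2" "is_gate 3 {1} 2"
  "is_gate 2 {0} (Suc 0)" "is_gate 2 {Suc 0} 0" "is_gate 3 {0} (Suc 0)" "is_gate 3 {Suc 0} 2"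
  by (auto simp: is_gate_def)

text \<open>Write \<open>z0\<close> with an ancilla on a middle wire. By \<open>AC\<close> the
  controlled-not \<open>?C\<close> is traded for two gates \<open>?B\<close> controlled by the
  ancilla, one at each end. The ancilla is created as 0 and tested to be 0, so both are
  absorbed.\<close>

lemma z0_cnot: "(z0 \<parallel> ide 1) \<cdot> cnot = z0 \<parallel> ide 1"
proof -
  let ?A = "gt 3 {0} 1" and ?B = "gt 3 {1} 2" and ?C = "gt 3 {0} 2"
  let ?I = "ide 1 \<parallel> un \<parallel> ide 1" and ?D = "ide 1 \<parallel> ud \<parallel> ide 1"
  have z: "z0 \<parallel> ide 1 = ?I \<cdot> (?A \<cdot> ?D)"
  proof -
    have "cnot \<parallel> ide 1 = ?A" using gt_right[of 2 "{0}" 1 1] by simp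
    then show ?thesis unfolding z0_eq by (simp add: comp_tens_ide comp_assoc)
  qed
  have AB: "?A \<cdot> ?B = ?C \<cdot> (?B \<cdot> ?A)"
    using gt_split[of 3 "{0}" 1 "{}" 2] by (simp add: comp_assoc)
  have CB: "?C \<cdot> ?B = ?B \<cdot> ?C" by (rule gt_commute) auto
  have CA: "?C \<cdot> ?A = ?A \<cdot> ?C" by (rule gt_commute) auto
  have "?B \<cdot> (?A \<cdot> ?B) = ?B \<cdot> (?B \<cdot> (?C \<cdot> ?A))"
    unfolding AB by (simp add: comp_eq_assoc[OF CB] comp_assoc del: One_nat_def)
  also have "\<dots> = ?C \<cdot> ?A" by (simp add: comp_eq_assoc[OF gt_inverse])
  finally have AC: "?A \<cdot> ?C = ?B \<cdot> (?A \<cdot> ?B)" unfolding CA ..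
  have B: "?B = ide 1 \<parallel> cnot" using gt_left[of 2 "{0}" 1 1] by (simp add: numeral_2_eq_2 numeral_3_eq_3 is_gate_def)
  have IB: "?I \<cdot> ?B = ?I"
    unfolding B tens_assoc by (simp add: ide_tens_comp[symmetric] un_cnot[simplified])
  have BD: "?B \<cdot> ?D = ?D" using arg_cong[OF IB, of rev] by (simp add: tens_assoc)
  have "(z0 \<parallel> ide 1) \<cdot> cnot = ?I \<cdot> (?A \<cdot> (?D \<cdot> cnot))"
    unfolding z by (simp add: comp_assoc)
  also have "?D \<cdot> cnot = ?C \<cdot> ?D"
    using gt_skip[of ud "{0}" 1] by (simp add: numeral_2_eq_2 numeral_3_eq_3)
  also have "?I \<cdot> (?A \<cdot> (?C \<cdot> ?D)) = ?I \<cdot> (?B \<cdot> (?A \<cdot> (?B \<cdot> ?D)))"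
    by (simp add: comp_eq_assoc[OF AC] comp_assoc del: One_nat_def)
  also have "\<dots> = ?I \<cdot> (?A \<cdot> ?D)" unfolding BD by (simp add: comp_eq_assoc[OF IB] del: One_nat_def)
  finally show ?thesis unfolding z .
qed

lemma un_gt_left: "(ide 1 \<parallel> un) \<cdot> gt 2 {1} 0 = ide 1 \<parallel> un"
proof -
  have t: "transpose 0 1 ` {Suc 0} = {0}" "transpose 0 (Suc 0) 0 = Suc 0" by (auto simp: transpose_def)
  have g: "swap 1 1 \<cdot> cnot = gt 2 {1} 0 \<cdot> swap 1 1"
    using gt_wires[of 0 0 "{1}" 0] t by (simp add: sw_def is_gate_def numeral_2_eq_2)
  have "(ide 1 \<parallel> un) \<cdot> gt 2 {1} 0 = (ide 1 \<parallel> un) \<cdot> (gt 2 {1} 0 \<cdot> (swap 1 1 \<cdot> swap 1 1))"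
    by (simp add: swap_swap[simplified])
  also have "\<dots> = (ide 1 \<parallel> un) \<cdot> (swap 1 1 \<cdot> (cnot \<cdot> swap 1 1))"
    by (simp add: comp_eq_assoc[OF g[symmetric]] comp_assoc del: One_nat_def)
  also have "\<dots> = (un \<parallel> ide 1) \<cdot> (cnot \<cdot> swap 1 1)"
    by (simp add: comp_eq_assoc[OF swap_into] del: One_nat_def)
  also have "\<dots> = (un \<parallel> ide 1) \<cdot> swap 1 1"
    by (simp add: comp_eq_assoc[OF un_cnot] del: One_nat_def)
  also have "\<dots> = ide 1 \<parallel> un" by (simp add: swap_into' del: One_nat_def)
  finally show ?thesis .
qed

lemma un_un: "un \<cdot> (ide 1 \<parallel> un) = un \<cdot> (un \<parallel> ide 1)"
  using slide[of un 1 un 0 0 1] by simp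

text \<open>Of two new ancillas either may be regarded as the first (\<open>un_un\<close>), so the
  controlled-not inside \<open>z0\<close> gets a control that is 0 and disappears;
  \<open>un_ud\<close> cancels what remains.\<close>

lemma un_z0: "un \<cdot> z0 = un"
proof -
  have "un \<cdot> z0 = un \<cdot> ((ide 1 \<parallel> un) \<cdot> (cnot \<cdot> (ide 1 \<parallel> ud)))"
    unfolding z0_eq by (simp add: comp_assoc)
  also have "\<dots> = un \<cdot> ((un \<parallel> ide 1) \<cdot> (cnot \<cdot> (ide 1 \<parallel> ud)))"
    by (simp add: comp_eq_assoc[OF un_un] comp_assoc del: One_nat_def)
  also have "\<dots> = un \<cdot> ((un \<parallel> ide 1) \<cdot> (ide 1 \<parallel> ud))"
    by (simp add: comp_eq_assoc[OF un_cnot] del: One_nat_def)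
  also have "(un \<parallel> ide 1) \<cdot> (ide 1 \<parallel> ud) = un \<parallel> ud" by (simp add: slide1 del: One_nat_def)
  also have "\<dots> = ud \<cdot> un" using slide2[of un 0 ud 0] by simp
  also have "un \<cdot> (ud \<cdot> un) = un" by (simp add: comp_eq_assoc[OF un_ud])
  finally show ?thesis .
qed

lemma z0_ud: "z0 \<cdot> ud = ud"
  using arg_cong[OF un_z0, of rev] by simp

text \<open>Testing a wire and then creating one amounts to letting an ancilla take the place of the
  tested wire, hence to a symmetry between \<open>un\<close> and \<open>ud\<close>. Of its three
  controlled-nots, \<open>z0\<close> put in front absorbs the first and the ancilla the second; the
  third is the one in \<open>z0_eq\<close>.\<close>

lemma ud_un: "ud \<cdot> un = z0"
proof -
  have "ud \<cdot> un = un \<parallel> ud" using slide2[of un 0 ud 0] by simp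
  also have "\<dots> = (un \<parallel> ide 1) \<cdot> (ide 1 \<parallel> ud)" by (simp add: slide1 del: One_nat_def)
  also have "\<dots> = (ide 1 \<parallel> un) \<cdot> (swap 1 1 \<cdot> (ide 1 \<parallel> ud))"
    by (simp add: comp_eq_assoc[OF swap_into] del: One_nat_def)
  also have "\<dots> = (ide 1 \<parallel> un) \<cdot> (cnot \<cdot> (gt 2 {1} 0 \<cdot> (cnot \<cdot> (ide 1 \<parallel> ud))))"
    unfolding swap_eq_gates by (simp add: comp_assoc del: One_nat_def)
  finally have *: "ud \<cdot> un = (ide 1 \<parallel> un) \<cdot> (cnot \<cdot> (gt 2 {1} 0 \<cdot> (cnot \<cdot> (ide 1 \<parallel> ud))))" .
  have zu: "z0 \<cdot> (ide 1 \<parallel> un) = (ide 1 \<parallel> un) \<cdot> (z0 \<parallel> ide 1)"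
    using slide[of z0 1 un 0 1 1] by simp
  have "z0 \<cdot> (ud \<cdot> un) = (ide 1 \<parallel> un) \<cdot> ((z0 \<parallel> ide 1) \<cdot> (cnot \<cdot> (gt 2 {1} 0 \<cdot> (cnot \<cdot> (ide 1 \<parallel> ud)))))"
    unfolding * by (simp add: comp_eq_assoc[OF zu] comp_assoc del: One_nat_def)
  also have "\<dots> = (ide 1 \<parallel> un) \<cdot> ((z0 \<parallel> ide 1) \<cdot> (gt 2 {1} 0 \<cdot> (cnot \<cdot> (ide 1 \<parallel> ud))))"
    by (simp add: comp_eq_assoc[OF z0_cnot] del: One_nat_def)
  also have "\<dots> = z0 \<cdot> ((ide 1 \<parallel> un) \<cdot> (gt 2 {1} 0 \<cdot> (cnot \<cdot> (ide 1 \<parallel> ud))))"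
    by (simp add: comp_eq_assoc[OF zu] comp_assoc del: One_nat_def)
  also have "\<dots> = z0 \<cdot> z0"
    by (simp add: comp_eq_assoc[OF un_gt_left] z0_eq comp_assoc del: One_nat_def)
  finally have "z0 \<cdot> (ud \<cdot> un) = z0" unfolding z0_z0 .
  then show ?thesis by (simp add: comp_eq_assoc[OF z0_ud])
qed

text \<open>The counit law for the left wire gives \<open>*\<close>, in which the scalar
  \<open>un \<cdot> ep\<close> splits off from \<open>un\<close>; closing with \<open>ud\<close>
  then cancels \<open>un\<close> on both sides.\<close>

lemma un_ep: "un \<cdot> ep = ide 0"
proof -
  have "un = un \<cdot> ((ide 1 \<parallel> un) \<cdot> (cnot \<cdot> (ep \<parallel> ide 1)))"
    using counit_left by (simp add: comp_assoc)
  also have "\<dots> = un \<cdot> ((un \<parallel> ide 1) \<cdot> (ep \<parallel> ide 1))"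
    by (simp add: comp_eq_assoc[OF un_un] comp_eq_assoc[OF un_cnot] comp_assoc del: One_nat_def)
  also have "\<dots> = un \<cdot> ((un \<cdot> ep) \<parallel> ide 1)" by (simp add: comp_tens_ide)
  also have "\<dots> = (un \<cdot> ep) \<parallel> un" using slide2[of "un \<cdot> ep" 0 un 1] by simp
  finally have *: "un = (un \<cdot> ep) \<parallel> un" .
  have "ide 0 = un \<cdot> ud" by (simp add: un_ud)
  also have "\<dots> = ((un \<cdot> ep) \<parallel> un) \<cdot> (ide 0 \<parallel> ud)" using * by simp
  also have "\<dots> = (un \<cdot> ep) \<parallel> (un \<cdot> ud)" by (subst tens_comp[symmetric]) simp_all
  finally show ?thesis by (simp add: un_ud)
qed

lemma et_ud: "et \<cdot> ud = ide 0"
  using arg_cong[OF un_ep, of rev] by simp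

lemma un_eq: "un = et \<cdot> z0"
  unfolding ud_un[symmetric] by (simp add: comp_eq_assoc[OF et_ud])

lemma ud_eq: "ud = z0 \<cdot> ep"
  using arg_cong[OF un_eq, of rev] by simp

text \<open>
  Writing \<open>d\<close> for the copy of the target and \<open>g'\<close> for the gate acting on the copy, \<open>g; d = d; g'; g\<close>, so
  discarding the copy shows that \<open>d; g'\<close> followed by this discarding is the identity. Discarding
  the original instead turns this into the claim.
\<close>

lemma gt_ep:
  assumes "X \<subseteq> {..<N}"
  shows "gt (N + 1) X N \<cdot> (ide N \<parallel> ep) = ide N \<parallel> ep"
proof -
  define g where "g = gt (N + 1) X N"
  define G where "G = gt (N + 2) X N"
  define G' where "G' = gt (N + 2) X (N + 1)"
  define K where "K = gt (N + 2) {N} (N + 1)"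
  define I where "I = ide (N + 1) \<parallel> un"
  define E where "E = ide (N + 1) \<parallel> ep"
  define F where "F = ide N \<parallel> ep \<parallel> ide 1"
  define e where "e = ide N \<parallel> ep"
  have [simp]: "dom g = N + 1" "cod g = N + 1" "dom G = N + 2" "cod G = N + 2" "dom G' = N + 2" "cod G' = N + 2"
    "dom K = N + 2" "cod K = N + 2" "dom I = N + 1" "cod I = N + 2" "dom E = N + 2" "cod E = N + 1"
    "dom F = N + 2" "cod F = N + 1" "dom e = N + 1" "cod e = N"
    by (simp_all add: g_def G_def G'_def K_def I_def E_def F_def e_def)
  have gates: "is_gate (N + 1) X N" "is_gate (N + 2) X N" "is_gate (N + 2) X (N + 1)" "is_gate (N + 2) {N} (N + 1)"
    using assms by (auto simp: is_gate_def)
  have notin: "N \<notin> X" "N + 1 \<notin> X" using assms by auto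
  have gg: "g \<cdot> g = ide (N + 1)" unfolding g_def by (rule gt_inverse)
  have G: "G = g \<parallel> ide 1" using gt_right[OF gates(1), of 1] by (simp add: G_def g_def)
  have K: "K = ide N \<parallel> cnot" using gt_left[of 2 "{0}" 1 N] by (simp add: K_def)
  have d: "I \<cdot> K = ide N \<parallel> ((ide 1 \<parallel> un) \<cdot> cnot)"
    by (simp add: I_def K ide_tens_comp ide_ide_tens)
  have IKE: "I \<cdot> (K \<cdot> E) = ide (N + 1)"
  proof -
    have "I \<cdot> (K \<cdot> E) = ide N \<parallel> ((ide 1 \<parallel> un) \<cdot> cnot \<cdot> (ide 1 \<parallel> ep))"
      by (simp add: I_def K E_def ide_tens_comp ide_ide_tens comp_assoc)
    then show ?thesis by (simp only: counit_right tens_ide)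
  qed
  have IKF: "I \<cdot> (K \<cdot> F) = ide (N + 1)"
  proof -
    have "I \<cdot> (K \<cdot> F) = ide N \<parallel> ((ide 1 \<parallel> un) \<cdot> cnot \<cdot> (ep \<parallel> ide 1))"
      by (simp add: I_def K F_def ide_tens_comp ide_ide_tens comp_assoc tens_assoc)
    then show ?thesis by (simp only: counit_left tens_ide)
  qed
  have GK: "G \<cdot> K = G' \<cdot> (K \<cdot> G)"
    unfolding G_def K_def G'_def using gt_split[of "N + 2" X N "{}" "N + 1"] gates notin by (simp add: comp_assoc)
  have G'K: "G' \<cdot> K = K \<cdot> G'" and G'G: "G' \<cdot> G = G \<cdot> G'"
    unfolding G'_def K_def G_def using gates notin by (auto intro!: gt_commute)
  have gI: "g \<cdot> I = I \<cdot> G"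
    unfolding I_def G using slide[of g "N + 1" un 0 "N + 1" 1] by simp
  have GE: "G \<cdot> E = E \<cdot> g"
    unfolding E_def G using slide[of g "N + 1" ep 1 "N + 1" 0] by simp
  have "g = g \<cdot> (I \<cdot> (K \<cdot> E))" unfolding IKE by simp
  also have "\<dots> = I \<cdot> (G \<cdot> (K \<cdot> E))" by (simp add: comp_eq_assoc[OF gI] comp_assoc)
  also have "\<dots> = I \<cdot> (K \<cdot> (G' \<cdot> (G \<cdot> E)))"
    by (simp add: comp_eq_assoc[OF GK] comp_eq_assoc[OF G'K] comp_assoc)
  also have "\<dots> = I \<cdot> (K \<cdot> (G' \<cdot> E)) \<cdot> g" by (simp add: GE comp_assoc)
  finally have "g \<cdot> g = I \<cdot> (K \<cdot> (G' \<cdot> E)) \<cdot> g \<cdot> g" by simp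
  then have *: "I \<cdot> (K \<cdot> (G' \<cdot> E)) = ide (N + 1)" by (simp add: comp_assoc gg)
  have Ee: "E \<cdot> e = F \<cdot> e"
    using slide1[of "ide N \<parallel> ep" N ep 1] slide2[of "ide N \<parallel> ep" "N + 1" ep 0]
    by (simp add: E_def F_def e_def)
  have G'F: "G' \<cdot> F = F \<cdot> g"
    unfolding G'_def F_def g_def using gt_skip[of ep X N] assms by simp
  have "e = I \<cdot> (K \<cdot> (G' \<cdot> (E \<cdot> e)))"
    using arg_cong[OF *, of "\<lambda>x. x \<cdot> e"] by (simp add: comp_assoc)
  also have "\<dots> = I \<cdot> (K \<cdot> (F \<cdot> (g \<cdot> e)))"
    unfolding Ee by (simp add: comp_eq_assoc[OF G'F] comp_assoc)
  also have "\<dots> = g \<cdot> e"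
    using arg_cong[OF IKF, of "\<lambda>x. x \<cdot> (g \<cdot> e)"] by (simp add: comp_assoc)
  finally show ?thesis by (simp add: e_def g_def)
qed

lemma et_gt:
  assumes "X \<subseteq> {..<N}"
  shows "(ide N \<parallel> et) \<cdot> gt (N + 1) X N = ide N \<parallel> et"
  using arg_cong[OF gt_ep[OF assms], of rev] by simp

section \<open>Words of gates\<close>

primrec etk :: "nat \<Rightarrow> arr" where
  "etk 0 = ide 0"
| "etk (Suc k) = etk k \<parallel> et"

primrec epk :: "nat \<Rightarrow> arr" where
  "epk 0 = ide 0"
| "epk (Suc k) = epk k \<parallel> ep"

lemma etk_simps [simp]: "dom (etk k) = 0" "cod (etk k) = k" "rev (etk k) = epk k"
  by (induction k) auto

lemma epk_simps [simp]: "dom (epk k) = k" "cod (epk k) = 0" "rev (epk k) = etk k"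
  by (induction k) auto

lemma etk_add: "etk (j + k) = etk j \<parallel> etk k"
  by (induction k) (auto simp: tens_assoc)

lemma epk_add: "epk (j + k) = epk j \<parallel> epk k"
  by (induction k) (auto simp: tens_assoc)

definition push :: "nat \<Rightarrow> nat \<Rightarrow> arr" where "push n k = ide n \<parallel> etk k"
definition pop :: "nat \<Rightarrow> nat \<Rightarrow> arr" where "pop n k = ide n \<parallel> epk k"

lemma push_simps [simp]: "dom (push n k) = n" "cod (push n k) = n + k" "rev (push n k) = pop n k"
  by (simp_all add: push_def pop_def)

lemma pop_simps [simp]: "dom (pop n k) = n + k" "cod (pop n k) = n" "rev (pop n k) = push n k"
  by (simp_all add: push_def pop_def)

lemma push_0 [simp]: "push n 0 = ide n" and pop_0 [simp]: "pop n 0 = ide n"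
  by (simp_all add: push_def pop_def)

lemma push_add: "push n (j + k) = push n j \<cdot> push (n + j) k"
proof -
  have "push n (j + k) = (ide n \<parallel> etk j) \<parallel> etk k" by (simp add: push_def etk_add tens_assoc)
  also have "\<dots> = ((ide n \<parallel> etk j) \<parallel> ide 0) \<cdot> (ide (n + j) \<parallel> etk k)"
    by (rule slide1[symmetric]) auto
  finally show ?thesis by (simp add: push_def)
qed

lemma pop_add: "pop n (j + k) = pop (n + j) k \<cdot> pop n j"
  using arg_cong[OF push_add[of n j k], of rev] by simp

lemma push_tens: "push n j \<parallel> etk k = push n (j + k)"
  by (simp add: push_def etk_add tens_assoc)

lemma push_slide: "dom f = n \<Longrightarrow> cod f = m \<Longrightarrow> f \<cdot> push m k = push n k \<cdot> (f \<parallel> ide k)"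
  using slide[of f m "etk k" 0 n k] by (simp add: push_def)

lemma pop_slide: "dom f = n \<Longrightarrow> cod f = m \<Longrightarrow> pop n k \<cdot> f = (f \<parallel> ide k) \<cdot> pop m k"
  using slide[of f m "epk k" k n 0] by (simp add: pop_def)

lemma push_1: "push n 1 = ide n \<parallel> et" and pop_1: "pop n 1 = ide n \<parallel> ep"
  by (simp_all add: push_def pop_def)

lemma gt_by_sw:
  assumes "is_gate N X x" "N = n + 2 + m"
  shows "gt N X x = sw n m \<cdot> gt N (transpose n (n + 1) ` X) (transpose n (n + 1) x) \<cdot> sw n m"
proof -
  have "sw n m \<cdot> gt N (transpose n (n + 1) ` X) (transpose n (n + 1) x) \<cdot> sw n m = gt N X x \<cdot> (sw n m \<cdot> sw n m)"
    using gt_wires[of n m X x] assms by (simp add: comp_assoc)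
  then show ?thesis using assms by (simp add: sw_inverse)
qed

lemma swp_involutory [simp]: "n + 1 < length xs \<Longrightarrow> swp n (swp n xs) = xs"
  by (rule nth_equalityI) (auto simp: nth_swp transpose_def)

text \<open>Exchanges of adjacent wires carry the gate to the controls \<open>{..<x}\<close> with
  target \<open>x\<close>, as in \<open>bx_gt_initial\<close>. Controls weigh twice as much as the
  target in the measure: moving a control down past the target raises the target by one and must
  still be a decrease.\<close>

lemma gt_bx:
  assumes "is_gate N X x"
  shows "gt N X x \<cdot> bx N P = bx N (\<lambda>xs. P (gfun X x xs)) \<cdot> gt N X x"
  using assms
proof (induction "2 * \<Sum>X + x" arbitrary: X x P rule: less_induct)
  case less
  have X: "finite X" "X \<subseteq> {..<N}" "x < N" "x \<notin> X"
    using less.prems finite_subset by (auto simp: is_gate_def)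
  have step: ?case
    if n: "n + 1 < N"
      and dec: "2 * \<Sum>(transpose n (n + 1) ` X) + transpose n (n + 1) x < 2 * \<Sum>X + x" for n
  proof -
    obtain m where m: "N = n + 2 + m" using n by (metis Suc_1 Suc_eq_plus1 add_Suc_right less_iff_Suc_add add.assoc add.commute plus_1_eq_Suc)
    let ?X = "transpose n (n + 1) ` X" and ?x = "transpose n (n + 1) x"
    have g: "is_gate N ?X ?x" by (rule is_gate_transpose[OF less.prems n])
    have IH: "gt N ?X ?x \<cdot> bx N Q = bx N (\<lambda>xs. Q (gfun ?X ?x xs)) \<cdot> gt N ?X ?x" for Q
      by (rule less.hyps[OF dec g])
    have S: "sw n m \<cdot> bx N Q = bx N (\<lambda>xs. Q (swp n xs)) \<cdot> sw n m" for Q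
      unfolding m by (rule bx_sw)
    note eq = gt_by_sw[OF less.prems m]
    have "gt N X x \<cdot> bx N P = sw n m \<cdot> (gt N ?X ?x \<cdot> (sw n m \<cdot> bx N P))"
      unfolding eq by (simp add: comp_assoc m)
    also have "\<dots> = sw n m \<cdot> (gt N ?X ?x \<cdot> bx N (\<lambda>xs. P (swp n xs))) \<cdot> sw n m"
      unfolding S by (simp add: comp_assoc m)
    also have "\<dots> = (sw n m \<cdot> bx N (\<lambda>xs. P (swp n (gfun ?X ?x xs)))) \<cdot> (gt N ?X ?x \<cdot> sw n m)"
      unfolding IH by (simp add: comp_assoc m)
    also have "\<dots> = bx N (\<lambda>xs. P (swp n (gfun ?X ?x (swp n xs)))) \<cdot> (sw n m \<cdot> gt N ?X ?x \<cdot> sw n m)"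
      unfolding S by (simp add: comp_assoc m)
    also have "sw n m \<cdot> gt N ?X ?x \<cdot> sw n m = gt N X x" by (rule eq[symmetric])
    also have "bx N (\<lambda>xs. P (swp n (gfun ?X ?x (swp n xs)))) = bx N (\<lambda>xs. P (gfun X x xs))"
      by (rule bx_cong) (use X n in \<open>simp add: swp_gfun[simplified]\<close>)
    finally show ?thesis .
  qed
  show ?case
  \<comment> \<open>Either some control can move down, or the controls form an initial segment; then
    the target moves down until it follows them directly.\<close>
  proof (cases "\<exists>n. n + 1 \<in> X \<and> n \<notin> X")
    case True
    then obtain n where n: "n + 1 \<in> X" "n \<notin> X" by blast
    have "\<Sum>(transpose n (n + 1) ` X) = (\<Sum>j \<in> X. transpose n (n + 1) j)"
      by (rule sum.reindex_cong[of "transpose n (n + 1)"]) auto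
    also have "\<dots> < \<Sum>X"
      using n X by (intro sum_strict_mono_ex1) (auto simp: transpose_def intro!: bexI[of _ "n + 1"])
    finally have "2 * \<Sum>(transpose n (n + 1) ` X) + transpose n (n + 1) x < 2 * \<Sum>X + x"
      using n X(4) by (auto simp: transpose_def)
    then show ?thesis using n X by (intro step) auto
  next
    case False
    then have down: "n \<in> X" if "n + 1 \<in> X" for n using that by blast
    have down': "j \<in> X" if "i \<in> X" "j \<le> i" for i j
      using that(2,1) by (induction rule: inc_induct) (auto intro: down)
    show ?thesis
    proof (cases "x = 0 \<or> x - 1 \<in> X")
      case True
      have "X = {..<x}"
      proof
        show "X \<subseteq> {..<x}" using down' X(4) by (metis lessThan_iff not_le subsetI)
        show "{..<x} \<subseteq> X" using True down'[of "x - 1"] by auto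
      qed
      then show ?thesis using bx_gt_initial[OF X(3)] by simp
    next
      case False
      define n where "n = x - 1"
      have n: "x = n + 1" "n \<notin> X" using False by (auto simp: n_def)
      have "transpose n (n + 1) ` X = (\<lambda>i. i) ` X"
        using n X(4) by (intro image_cong) (auto simp: transpose_def)
      then have "transpose n (n + 1) ` X = X" by simp
      then show ?thesis using n X by (intro step[of n]) (auto simp: transpose_def)
    qed
  qed
qed

text \<open>The targets avoid the first \<open>n\<close> wires, the inputs of a normal form, while
  the controls may lie anywhere. This is the condition under which \<open>push\<close> absorbs the
  word.\<close>

inductive gword :: "nat \<Rightarrow> nat \<Rightarrow> arr \<Rightarrow> bool" for n N where
  gword_ide: "gword n N (ide N)"
| gword_gt: "is_gate N X x \<Longrightarrow> n \<le> x \<Longrightarrow> gword n N w \<Longrightarrow> gword n N (gt N X x \<cdot> w)"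

lemma gword_dom: "gword n N w \<Longrightarrow> dom w = N \<and> cod w = N"
  by (induction rule: gword.induct) auto

lemma gword_comp: "gword n N v \<Longrightarrow> gword n N w \<Longrightarrow> gword n N (v \<cdot> w)"
proof (induction rule: gword.induct)
  case gword_ide
  then show ?case using gword_dom[OF gword_ide] by simp
next
  case (gword_gt X x v)
  then show ?case using gword_dom by (auto simp: comp_assoc intro: gword.gword_gt)
qed

lemma gword_gate: "is_gate N X x \<Longrightarrow> n \<le> x \<Longrightarrow> gword n N (gt N X x)"
  using gword_gt[OF _ _ gword_ide] by simp

lemma gword_tens_ide: "gword n N w \<Longrightarrow> gword n (N + k) (w \<parallel> ide k)"
proof (induction rule: gword.induct)
  case gword_ide
  then show ?case using gword.gword_ide by (simp add: tens_ide)
next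
  case (gword_gt X x w)
  then have "is_gate (N + k) X x" by (auto simp: is_gate_def)
  then show ?case using gword_gt gword_dom[OF gword_gt(3)]
    by (simp add: comp_tens_ide gt_right gword.gword_gt)
qed

lemma ide_tens_gword: "gword n N w \<Longrightarrow> gword (k + n) (k + N) (ide k \<parallel> w)"
proof (induction rule: gword.induct)
  case gword_ide
  then show ?case using gword.gword_ide by (simp add: tens_ide)
next
  case (gword_gt X x w)
  then have "is_gate (k + N) ((+) k ` X) (k + x)" by (auto simp: is_gate_def)
  then show ?case using gword_gt gword_dom[OF gword_gt(3)]
    by (simp add: ide_tens_comp gt_left gword.gword_gt)
qed

lemma gword_swap11: "gword 0 2 (swap 1 1)"
  unfolding swap_eq_gates by (intro gword_comp gword_gate) auto

text \<open>Since the symmetry is a product of controlled-nots, permutations of the wires beyond the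
  inputs pass boxes and are absorbed just like gates.\<close>

lemma gword_swap: "gword 0 (b + c) (swap b c)"
proof -
  have 1: "gword 0 (1 + c) (swap 1 c)" for c
  proof (induction c)
    case 0
    show ?case using gword_ide[of 0 1] by simp
  next
    case (Suc c)
    have "gword 0 (1 + c + 1) (swap 1 c \<parallel> ide 1)" by (rule gword_tens_ide[OF Suc])
    moreover have "gword (c + 0) (c + 2) (ide c \<parallel> swap 1 1)" by (rule ide_tens_gword[OF gword_swap11])
    moreover have "gword 0 N w" if "gword n N w" for n N w
      using that by (induction rule: gword.induct) (auto intro: gword.intros)
    ultimately show ?case using swap_hexagon[of 1 c 1] by (auto intro!: gword_comp)
  qed
  show ?thesis
  proof (induction b)
    case 0
    show ?case using gword_ide[of 0 c] by simp
  next
    case (Suc b)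
    have "gword 0 (b + c + 1) (swap b c \<parallel> ide 1)" by (rule gword_tens_ide[OF Suc])
    moreover have "gword (b + 0) (b + (1 + c)) (ide b \<parallel> swap 1 c)" by (rule ide_tens_gword[OF 1])
    moreover have "gword 0 N w" if "gword n N w" for n N w
      using that by (induction rule: gword.induct) (auto intro: gword.intros)
    ultimately show ?case using swap_hexagon_left[of b 1 c] by (auto intro!: gword_comp)
  qed
qed

lemma gword_swaps: "gword a (a + (b + c) + d) (ide a \<parallel> swap b c \<parallel> ide d)"
  using gword_tens_ide[OF ide_tens_gword[OF gword_swap]] by simp

lemma gword_bx: "gword n N w \<Longrightarrow> \<exists>Q. bx N P \<cdot> w = w \<cdot> bx N Q"
proof (induction arbitrary: P rule: gword.induct)
  case gword_ide
  show ?case by (intro exI[of _ P]) simp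
next
  case (gword_gt X x w)
  \<comment> \<open>As the gate is an involution, \<open>gt_bx\<close> also carries a box from the
    left of the gate to its right.\<close>
  have "x \<notin> X" using gword_gt by (simp add: is_gate_def)
  then have *: "gt N X x \<cdot> bx N (\<lambda>xs. P (gfun X x xs)) = bx N P \<cdot> gt N X x"
    using gt_bx[OF gword_gt(1)] by simp
  obtain Q where "bx N (\<lambda>xs. P (gfun X x xs)) \<cdot> w = w \<cdot> bx N Q" using gword_gt.IH by blast
  then have "bx N P \<cdot> (gt N X x \<cdot> w) = (gt N X x \<cdot> w) \<cdot> bx N Q"
    using gword_dom[OF gword_gt(3)] by (simp add: comp_assoc comp_eq_assoc[OF *[symmetric]])
  then show ?case by blast
qed

text \<open>Both exchanged wires are newly created, and a pair of units absorbs the symmetry by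
  naturality.\<close>

lemma push_sw:
  assumes "n \<le> i" "n + k = i + 2 + m"
  shows "push n k \<cdot> sw i m = push n k"
proof -
  have k: "k = (i - n) + (2 + m)" using assms by simp
  have e2: "etk 2 = et \<parallel> et" by (simp add: numeral_2_eq_2)
  have "push n k = push n (i - n) \<parallel> etk 2 \<parallel> etk m"
    unfolding k push_tens by (simp add: add.assoc)
  moreover have "(et \<parallel> et) \<cdot> swap 1 1 = et \<parallel> et" by (simp add: swap_natural del: One_nat_def)
  ultimately show ?thesis
    using assms by (simp add: e2 sw_def tens_comp[symmetric] del: One_nat_def)
qed

lemma absorb_conjugate:
  "p \<cdot> s = p \<Longrightarrow> p \<cdot> g = p \<Longrightarrow> cod p = N \<Longrightarrow> dom s = N \<Longrightarrow> cod s = N \<Longrightarrow> dom g = N \<Longrightarrow> cod g = N \<Longrightarrow>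
   p \<cdot> (s \<cdot> (g \<cdot> s)) = p"
  by (simp add: comp_eq_assoc)

text \<open>\<open>et_gt\<close> is the case of a target on the last wire. Otherwise the target is
  exchanged with the next wire; both are new, so \<open>push_sw\<close> absorbs the exchange, and
  the target comes closer to the end.\<close>

lemma push_gt: "is_gate (n + k) X x \<Longrightarrow> n \<le> x \<Longrightarrow> push n k \<cdot> gt (n + k) X x = push n k"
proof (induction "n + k - x" arbitrary: X x rule: less_induct)
  case less
  have x: "x < n + k" using less.prems by (simp add: is_gate_def)
  show ?case
  proof (cases "x + 1 = n + k")
    case True
    define j where "j = k - 1"
    have j: "k = j + 1" "x = n + j" using True less.prems by (auto simp: j_def)
    have "X \<subseteq> {..<n + j}"
    proof
      fix i assume "i \<in> X"
      then have "i < n + k" "i \<noteq> x" using less.prems by (auto simp: is_gate_def)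
      then show "i \<in> {..<n + j}" using j by simp
    qed
    from et_gt[OF this] show ?thesis
      unfolding j push_add by (simp add: comp_assoc push_1[symmetric] add.assoc del: One_nat_def)
  next
    case False
    obtain m where m: "n + k = x + 2 + m"
      using False x by (metis Suc_1 Suc_eq_plus1 Suc_leI add.assoc le_Suc_ex linorder_neqE_nat not_less_eq plus_1_eq_Suc add_Suc_right)
    let ?X = "transpose x (x + 1) ` X"
    have "is_gate (n + k) ?X (transpose x (x + 1) x)" by (rule is_gate_transpose) (use less.prems m in auto)
    then have g: "is_gate (n + k) ?X (x + 1)" by simp
    have IH: "push n k \<cdot> gt (n + k) ?X (x + 1) = push n k"
      by (rule less.hyps) (use g less.prems x in auto)
    have "push n k \<cdot> gt (n + k) X x = push n k \<cdot> (sw x m \<cdot> (gt (n + k) ?X (x + 1) \<cdot> sw x m))"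
      using gt_by_sw[OF less.prems(1) m] m by (simp add: comp_assoc)
    also have "\<dots> = push n k"
      by (rule absorb_conjugate[OF push_sw[OF less.prems(2) m] IH]) (simp_all add: m)
    finally show ?thesis .
  qed
qed

lemma push_gword: "gword n N w \<Longrightarrow> N = n + k \<Longrightarrow> push n k \<cdot> w = push n k"
proof (induction rule: gword.induct)
  case (gword_gt X x w)
  then show ?case using push_gt[of n k X x] gword_dom[OF gword_gt(3)]
    by (simp add: comp_eq_assoc[OF push_gt])
qed simp

section \<open>Eliminating a determined wire\<close>

text \<open>The oracle (xs, y) |-> (xs, y + f xs), recorded by what the elimination of a wire uses:
  its reverse is its inverse, a unit on the last wire absorbs it, and it passes boxes by
  substitution.\<close>

definition adds :: "nat \<Rightarrow> (bit list \<Rightarrow> bit) \<Rightarrow> arr \<Rightarrow> bool" where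
  "adds N f w \<longleftrightarrow> dom w = N + 1 \<and> cod w = N + 1 \<and> push N 1 \<cdot> w = push N 1 \<and> rev w \<cdot> w = ide (N + 1) \<and> w \<cdot> rev w = ide (N + 1) \<and>
     (\<forall>P. w \<cdot> bx (N + 1) P = bx (N + 1) (\<lambda>xs. P (take N xs @ [xs ! N + f (take N xs)])) \<cdot> w)"

text \<open>Every \<open>f\<close> is a polynomial function. There is one gate per monomial, and the
  properties in \<open>adds\<close> survive each further gate; the contributions add up because the
  controls are never changed.\<close>

lemma adds_exists: "\<exists>w. adds N f w"
proof -
  obtain p where p: "p \<in> polys N" "\<forall>xs \<in> cube N. peval (nth xs) p = 0 \<longleftrightarrow> f xs = 0"
    using ex_poly_zeros[of N "\<lambda>xs. f xs = 0"] by blast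
  have pf: "peval (nth xs) p = f xs" if "length xs = N" for xs
  proof -
    have "peval (nth xs) p = 0 \<longleftrightarrow> f xs = 0" using p(2) that by simp
    then show ?thesis by (cases "f xs"; cases "peval (nth xs) p") auto
  qed
  have sum: "\<exists>w. adds N (\<lambda>xs. \<Sum>m \<in> A. meval (nth xs) m) w"
    if "finite A" "A \<subseteq> Poly_Mapping.keys p" for A
    using that
  proof (induction A rule: finite_induct)
    case empty
    have "bx (N + 1) P = bx (N + 1) (\<lambda>xs. P (take N xs @ [xs ! N + 0]))" for P
      by (rule bx_cong) (metis add.right_neutral lessI take_Suc_conv_app_nth take_all_iff order_refl Suc_eq_plus1)
    then have "adds N (\<lambda>xs. \<Sum>m \<in> {}. meval (nth xs) m) (ide (N + 1))"
      unfolding adds_def by simp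
    then show ?case by blast
  next
    case (insert m A)
    then obtain w where w: "adds N (\<lambda>xs. \<Sum>m \<in> A. meval (nth xs) m) w" by auto
    have m: "Poly_Mapping.keys m \<subseteq> {..<N}" using insert.prems p(1) by (auto simp: polys_def)
    let ?g = "gt (N + 1) (Poly_Mapping.keys m) N"
    have g: "is_gate (N + 1) (Poly_Mapping.keys m) N" using m by (auto simp: is_gate_def)
    have "gfun (Poly_Mapping.keys m) N xs = take N xs @ [xs ! N + meval (nth (take N xs)) m]"
      if "length xs = N + 1" for xs
    proof -
      have "(\<forall>i \<in> Poly_Mapping.keys m. xs ! i = 1) \<longleftrightarrow> (\<forall>i \<in> Poly_Mapping.keys m. take N xs ! i = 1)"
        using m by (intro ball_cong refl) auto
      moreover have "xs[N := b] = take N xs @ [b]" for b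
        using that by (simp add: upd_conv_take_nth_drop)
      ultimately show ?thesis unfolding gfun_def meval_bit by simp
    qed
    then have gbx: "?g \<cdot> bx (N + 1) P = bx (N + 1) (\<lambda>xs. P (take N xs @ [xs ! N + meval (nth (take N xs)) m])) \<cdot> ?g" for P
      unfolding gt_bx[OF g] by (intro arg_cong[of _ _ "\<lambda>a. a \<cdot> ?g"] bx_cong) simp
    have "adds N (\<lambda>xs. \<Sum>m \<in> insert m A. meval (nth xs) m) (w \<cdot> ?g)"
      unfolding adds_def
    proof (intro conjI allI)
      have W: "dom w = N + 1" "cod w = N + 1" "push N 1 \<cdot> w = push N 1" "rev w \<cdot> w = ide (N + 1)"
        "w \<cdot> rev w = ide (N + 1)"
        "\<And>P. w \<cdot> bx (N + 1) P = bx (N + 1) (\<lambda>xs. P (take N xs @ [xs ! N + (\<Sum>m \<in> A. meval (nth (take N xs)) m)])) \<cdot> w"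
        using w unfolding adds_def by blast+
      show "dom (w \<cdot> ?g) = N + 1" "cod (w \<cdot> ?g) = N + 1" using W by simp_all
      have "push N 1 \<cdot> ?g = push N 1" by (rule push_gt[OF g]) simp
      then show "push N 1 \<cdot> (w \<cdot> ?g) = push N 1"
        using W by (simp add: comp_eq_assoc[OF W(3)] del: One_nat_def)
      show "rev (w \<cdot> ?g) \<cdot> (w \<cdot> ?g) = ide (N + 1)" "(w \<cdot> ?g) \<cdot> rev (w \<cdot> ?g) = ide (N + 1)"
        using W(1,2) by (simp_all add: comp_assoc comp_eq_assoc[OF W(4)] comp_eq_assoc[OF gt_inverse] gt_inverse W(5) del: One_nat_def add_Suc_right)
      fix P
      have "(w \<cdot> ?g) \<cdot> bx (N + 1) P = w \<cdot> bx (N + 1) (\<lambda>xs. P (take N xs @ [xs ! N + meval (nth (take N xs)) m])) \<cdot> ?g"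
        using W(1,2) by (simp add: comp_assoc gbx del: One_nat_def add_Suc_right)
      also have "\<dots> = bx (N + 1) (\<lambda>xs. P (take N xs @ [xs ! N + (\<Sum>m \<in> insert m A. meval (nth (take N xs)) m)])) \<cdot> (w \<cdot> ?g)"
        unfolding W(6) comp_assoc[of "bx (N + 1) _" w ?g, unfolded cod_bx dom_gt W(1,2), OF refl refl]
      proof (intro arg_cong[of _ _ "\<lambda>a. a \<cdot> (w \<cdot> ?g)"] bx_cong)
        fix xs :: "bit list" assume "length xs = N + 1"
        then have "take N (take N xs @ [c]) = take N xs" "(take N xs @ [c]) ! N = c" for c
          by (simp_all add: nth_append)
        then show "P (take N (take N xs @ [xs ! N + (\<Sum>m \<in> A. meval (nth (take N xs)) m)]) @
            [(take N xs @ [xs ! N + (\<Sum>m \<in> A. meval (nth (take N xs)) m)]) ! N +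
              meval (nth (take N (take N xs @ [xs ! N + (\<Sum>m \<in> A. meval (nth (take N xs)) m)]))) m]) \<longleftrightarrow>
          P (take N xs @ [xs ! N + (\<Sum>m \<in> insert m A. meval (nth (take N xs)) m)])"
          by (simp only: sum.insert[OF insert.hyps] add_ac)
      qed
      finally show "(w \<cdot> ?g) \<cdot> bx (N + 1) P =
        bx (N + 1) (\<lambda>xs. P (take N xs @ [xs ! N + (\<Sum>m \<in> insert m A. meval (nth (take N xs)) m)])) \<cdot> (w \<cdot> ?g)" .
    qed
    then show ?case by blast
  qed
  obtain w where w: "adds N (\<lambda>xs. \<Sum>m \<in> Poly_Mapping.keys p. meval (nth xs) m) w"
    using sum[OF finite_keys subset_refl] by blast
  have "f xs = (\<Sum>m \<in> Poly_Mapping.keys p. meval (nth xs) m)" if "length xs = N" for xs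
    using pf[OF that] peval_eq_sum_meval by metis
  then have "bx (N + 1) (\<lambda>xs. P (take N xs @ [xs ! N + (\<Sum>m \<in> Poly_Mapping.keys p. meval (nth (take N xs)) m)])) =
     bx (N + 1) (\<lambda>xs. P (take N xs @ [xs ! N + f (take N xs)]))" for P
    by (intro bx_cong) simp
  then have "adds N f w" using w unfolding adds_def by simp
  then show ?thesis by blast
qed

text \<open>The box splits into \<open>?E\<close> on the first \<open>N\<close> wires and the graph
  of \<open>?f\<close>. The oracle for \<open>?f\<close> straightens the graph to the condition that
  the last bit is 0, and is itself absorbed at both ends. What remains on the last wire is a unit
  followed by \<open>ud\<close>, which is empty.\<close>

lemma eliminate1:
  assumes "\<And>xs. length xs = N \<Longrightarrow> \<not> (P (xs @ [0]) \<and> P (xs @ [1]))"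
  shows "push N 1 \<cdot> bx (N + 1) P \<cdot> pop N 1 = bx N (\<lambda>xs. P (xs @ [0]) \<or> P (xs @ [1]))"
proof -
  let ?E = "\<lambda>xs. P (xs @ [0]) \<or> P (xs @ [1])"
  \<comment> \<open>The last bit allowed by \<open>P\<close>. Where \<open>P\<close> allows none the
    default is 1, which does no harm because \<open>?E\<close> fails there.\<close>
  let ?f = "\<lambda>xs. of_bool (\<not> P (xs @ [0])) :: bit"
  obtain w where w: "adds N ?f w" using adds_exists by blast
  have W: "dom w = N + 1" "cod w = N + 1" "push N 1 \<cdot> w = push N 1" "rev w \<cdot> w = ide (N + 1)"
    "w \<cdot> rev w = ide (N + 1)"
    "\<And>P. w \<cdot> bx (N + 1) P = bx (N + 1) (\<lambda>xs. P (take N xs @ [xs ! N + ?f (take N xs)])) \<cdot> w"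
    using w unfolding adds_def by blast+
  have pop: "rev w \<cdot> pop N 1 = pop N 1" using arg_cong[OF W(3), of rev] W(1,2) by (simp del: One_nat_def)
  have P: "P xs \<longleftrightarrow> ?E (take N xs) \<and> xs ! N + ?f (take N xs) = 0" if l: "length xs = N + 1" for xs
  proof -
    obtain ys b where xs: "xs = ys @ [b]" "length ys = N"
      using l by (cases xs rule: rev_cases) auto
    then have "take N xs = ys" "xs ! N = b" by auto
    then show ?thesis using assms[OF xs(2)] xs(1) by (cases b) auto
  qed
  have "bx (N + 1) (\<lambda>xs. xs ! N + ?f (take N xs) = 0) = w \<cdot> bx (N + 1) (\<lambda>xs. xs ! N = 0) \<cdot> rev w"
  proof -
    have "bx (N + 1) (\<lambda>xs. xs ! N + ?f (take N xs) = 0) =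
        bx (N + 1) (\<lambda>xs. (take N xs @ [xs ! N + ?f (take N xs)]) ! N = 0)"
      by (rule bx_cong) (simp add: nth_append)
    also have "\<dots> = bx (N + 1) (\<lambda>xs. (take N xs @ [xs ! N + ?f (take N xs)]) ! N = 0) \<cdot> (w \<cdot> rev w)"
      unfolding W(5) by simp
    also have "\<dots> = w \<cdot> bx (N + 1) (\<lambda>xs. xs ! N = 0) \<cdot> rev w"
      unfolding W(6) using W(1,2) by (simp add: comp_assoc)
    finally show ?thesis .
  qed
  moreover have "bx (N + 1) P = bx (N + 1) (\<lambda>xs. ?E (take N xs)) \<cdot> bx (N + 1) (\<lambda>xs. xs ! N + ?f (take N xs) = 0)"
    unfolding bx_bx by (rule bx_cong) (rule P)
  moreover have "bx (N + 1) (\<lambda>xs. ?E (take N xs)) = bx N ?E \<parallel> ide 1"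
    using bx_tens[of N ?E 1 "\<lambda>_. True"] bx_True[of 1 "\<lambda>_. True"] by simp
  moreover have "bx (N + 1) (\<lambda>xs. xs ! N = 0) = ide N \<parallel> z0"
  proof -
    have "bx (N + 1) (\<lambda>xs. xs ! N = 0) = bx (N + 1) (\<lambda>xs. True \<and> drop N xs ! 0 = 0)"
      by (rule bx_cong) simp
    also have "\<dots> = bx N (\<lambda>_. True) \<parallel> z0" unfolding z0_def by (rule bx_tens[symmetric])
    finally show ?thesis using bx_True[of N "\<lambda>_. True"] by simp
  qed
  ultimately have "push N 1 \<cdot> bx (N + 1) P \<cdot> pop N 1 =
      push N 1 \<cdot> ((bx N ?E \<parallel> ide 1) \<cdot> (w \<cdot> ((ide N \<parallel> z0) \<cdot> (rev w \<cdot> pop N 1))))"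
    using W(1,2) by (simp add: comp_assoc del: One_nat_def)
  also have "\<dots> = bx N ?E \<cdot> (push N 1 \<cdot> (w \<cdot> ((ide N \<parallel> z0) \<cdot> (rev w \<cdot> pop N 1))))"
    using W(1,2) push_slide[of "bx N ?E" N N 1, symmetric] by (simp add: comp_eq_assoc[OF push_slide[symmetric]] comp_assoc del: One_nat_def)
  also have "\<dots> = bx N ?E \<cdot> (push N 1 \<cdot> ((ide N \<parallel> z0) \<cdot> pop N 1))"
    unfolding pop using W(1,2) by (simp add: comp_eq_assoc[OF W(3)] del: One_nat_def)
  also have "push N 1 \<cdot> ((ide N \<parallel> z0) \<cdot> pop N 1) = ide N \<parallel> (et \<cdot> (z0 \<cdot> ep))"
    unfolding push_1 pop_1 by (simp add: ide_tens_comp)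
  also have "et \<cdot> (z0 \<cdot> ep) = ide 0" by (simp add: ud_eq[symmetric] et_ud)
  finally show ?thesis by simp
qed

text \<open>Wires go one at a time from the end. Uniqueness of the whole block gives uniqueness of
  its last bit, and persists for the shorter block once that bit is quantified away.\<close>

lemma eliminate:
  assumes "\<And>xs ys ys'. length xs = N \<Longrightarrow> length ys = k \<Longrightarrow> length ys' = k \<Longrightarrow> P (xs @ ys) \<Longrightarrow> P (xs @ ys') \<Longrightarrow> ys = ys'"
  shows "push N k \<cdot> bx (N + k) P \<cdot> pop N k = bx N (\<lambda>xs. \<exists>ys. length ys = k \<and> P (xs @ ys))"
  using assms
proof (induction k arbitrary: P)
  case 0
  then show ?case by simp
next
  case (Suc k)
  let ?Q = "\<lambda>xs. P (xs @ [0]) \<or> P (xs @ [1])"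
  have "push (N + k) 1 \<cdot> bx (N + k + 1) P \<cdot> pop (N + k) 1 = bx (N + k) ?Q"
  proof (rule eliminate1)
    fix xs :: "bit list" assume xs: "length xs = N + k"
    show "\<not> (P (xs @ [0]) \<and> P (xs @ [1]))"
    proof
      assume "P (xs @ [0]) \<and> P (xs @ [1])"
      moreover have "xs @ [b] = take N xs @ (drop N xs @ [b])" for b by simp
      ultimately have "drop N xs @ [0] = drop N xs @ [1]"
        using xs by (intro Suc.prems[of "take N xs"]) auto
      then show False by simp
    qed
  qed
  moreover have "push N (k + 1) \<cdot> bx (N + (k + 1)) P \<cdot> pop N (k + 1) =
      push N k \<cdot> (push (N + k) 1 \<cdot> bx (N + k + 1) P \<cdot> pop (N + k) 1) \<cdot> pop N k"
    unfolding push_add pop_add by (simp add: comp_assoc)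
  ultimately have "push N (k + 1) \<cdot> bx (N + (k + 1)) P \<cdot> pop N (k + 1) = push N k \<cdot> bx (N + k) ?Q \<cdot> pop N k"
    by simp
  also have "\<dots> = bx N (\<lambda>xs. \<exists>ys. length ys = k \<and> ?Q (xs @ ys))"
  proof (rule Suc.IH)
    fix xs ys ys' :: "bit list"
    assume l: "length xs = N" "length ys = k" "length ys' = k" and "?Q (xs @ ys)" "?Q (xs @ ys')"
    then obtain b b' where "P (xs @ (ys @ [b]))" "P (xs @ (ys' @ [b']))" by auto
    from Suc.prems[OF _ _ _ this] show "ys = ys'" using l by simp
  qed
  also have "\<dots> = bx N (\<lambda>xs. \<exists>ys. length ys = Suc k \<and> P (xs @ ys))"
  proof (rule bx_cong)
    fix xs :: "bit list"
    show "(\<exists>ys. length ys = k \<and> ?Q (xs @ ys)) \<longleftrightarrow> (\<exists>ys. length ys = Suc k \<and> P (xs @ ys))"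
    proof
      assume "\<exists>ys. length ys = k \<and> ?Q (xs @ ys)"
      then obtain ys b where "length ys = k" "P (xs @ (ys @ [b]))" by auto
      then show "\<exists>ys. length ys = Suc k \<and> P (xs @ ys)" by (intro exI[of _ "ys @ [b]"]) simp
    next
      assume "\<exists>ys. length ys = Suc k \<and> P (xs @ ys)"
      then obtain ys where ys: "length ys = Suc k" "P (xs @ ys)" by blast
      then obtain zs b where "ys = zs @ [b]" by (cases ys rule: rev_cases) auto
      then show "\<exists>ys. length ys = k \<and> ?Q (xs @ ys)"
        using ys by (intro exI[of _ zs]) (cases b; simp)
    qed
  qed
  finally show ?case by simp
qed

section \<open>Exchanging blocks of wires\<close>

definition swapf :: "nat \<Rightarrow> nat \<Rightarrow> nat \<Rightarrow> 'a list \<Rightarrow> 'a list" where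
  "swapf a b c xs = take a xs @ take c (drop (a + b) xs) @ take b (drop a xs) @ drop (a + b + c) xs"

lemma swapf_append:
  "length A = a \<Longrightarrow> length B = b \<Longrightarrow> length C = c \<Longrightarrow> swapf a b c (A @ B @ C @ D) = A @ C @ B @ D"
  by (simp add: swapf_def)

lemma length_split4:
  assumes "length xs = a + b + c + d"
  obtains A B C D where "xs = A @ B @ C @ D" "length A = a" "length B = b" "length C = c" "length D = d"
proof
  show "xs = take a xs @ take b (drop a xs) @ take c (drop (a + b) xs) @ drop (a + b + c) xs"
    by (metis add.commute append_assoc append_take_drop_id take_add)
qed (use assms in auto)

text \<open>\<open>gword_bx\<close> only asserts that some predicate exists. Here the map on bit
  lists is recorded, because \<open>nf_eq\<close> needs the exact predicate after a block
  exchange.\<close>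

definition acts :: "nat \<Rightarrow> (bit list \<Rightarrow> bit list) \<Rightarrow> arr \<Rightarrow> bool" where
  "acts N \<phi> w \<longleftrightarrow> dom w = N \<and> cod w = N \<and> (\<forall>P. w \<cdot> bx N P = bx N (\<lambda>xs. P (\<phi> xs)) \<cdot> w)"

lemma acts_cong:
  assumes "acts N \<phi> w" "\<And>xs. length xs = N \<Longrightarrow> \<phi> xs = \<psi> xs"
  shows "acts N \<psi> w"
proof -
  have "bx N (\<lambda>xs. P (\<phi> xs)) = bx N (\<lambda>xs. P (\<psi> xs))" for P
    by (rule bx_cong) (simp add: assms(2))
  then show ?thesis using assms(1) by (simp add: acts_def)
qed

lemma acts_comp: "acts N \<phi> v \<Longrightarrow> acts N \<psi> w \<Longrightarrow> acts N (\<lambda>xs. \<psi> (\<phi> xs)) (v \<cdot> w)"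
proof -
  assume "acts N \<phi> v" "acts N \<psi> w"
  then have v: "dom v = N" "cod v = N" "\<And>P. v \<cdot> bx N P = bx N (\<lambda>xs. P (\<phi> xs)) \<cdot> v"
    and w: "dom w = N" "cod w = N" "\<And>P. w \<cdot> bx N P = bx N (\<lambda>xs. P (\<psi> xs)) \<cdot> w"
    by (auto simp: acts_def)
  show ?thesis unfolding acts_def
    using v(1,2) w(1,2) by (simp add: comp_assoc w(3) comp_eq_assoc[OF v(3)])
qed

lemma acts_ide: "acts N (\<lambda>xs. xs) (ide N)"
  by (simp add: acts_def)

lemma acts_swap11: "acts (a + 2 + d) (swapf a 1 1) (ide a \<parallel> swap 1 1 \<parallel> ide d)"
proof (rule acts_cong)
  show "acts (a + 2 + d) (swp a) (ide a \<parallel> swap 1 1 \<parallel> ide d)"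
    using bx_sw[of a d] by (simp add: acts_def sw_def)
  fix xs :: "bit list" assume "length xs = a + 2 + d"
  then have "length xs = a + 1 + 1 + d" by simp
  then obtain A B C D where xs: "xs = A @ B @ C @ D" "length A = a" "length B = 1" "length C = 1" "length D = d"
    by (rule length_split4)
  obtain x y where BC: "B = [x]" "C = [y]" using xs(3,4) by (auto simp: length_Suc_conv)
  have "swp a xs = A @ C @ B @ D"
  proof (rule nth_equalityI)
    fix i assume "i < length (swp a xs)"
    then have i: "i < length xs" by simp
    consider "i < a" | "i = a" | "i = a + 1" | j where "i = a + 2 + j"
      by (metis One_nat_def Suc_1 add_Suc_right add.right_neutral le_Suc_ex linorder_neqE_nat not_less_eq not_le_imp_less Suc_leI)
    then show "swp a xs ! i = (A @ C @ B @ D) ! i"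
      using i by cases (auto simp: nth_swp xs BC nth_append transpose_def)
  qed (simp add: xs)
  then show "swp a xs = swapf a 1 1 xs" using xs by (simp add: swapf_append)
qed

lemma acts_swap1: "acts (a + (1 + c) + d) (swapf a 1 c) (ide a \<parallel> swap 1 c \<parallel> ide d)"
proof (induction c arbitrary: d)
  case 0
  show ?case
    by (simp add: tens_ide) (rule acts_cong[OF acts_ide], simp add: swapf_def take_add[symmetric] flip: append_assoc)
next
  case (Suc c)
  have "acts (a + (1 + c) + (1 + d)) (\<lambda>xs. swapf (a + c) 1 1 (swapf a 1 c xs))
    ((ide a \<parallel> swap 1 c \<parallel> ide (1 + d)) \<cdot> (ide (a + c) \<parallel> swap 1 1 \<parallel> ide d))"
    using acts_comp[OF Suc[of "1 + d"], of "swapf (a + c) 1 1"] acts_swap11[of "a + c" d] by (simp add: add_ac)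
  moreover have "(ide a \<parallel> swap 1 c \<parallel> ide (1 + d)) \<cdot> (ide (a + c) \<parallel> swap 1 1 \<parallel> ide d) = ide a \<parallel> swap 1 (c + 1) \<parallel> ide d"
    unfolding swap_hexagon[of 1 c 1]
    by (simp add: ide_tens_comp comp_tens_ide tens_assoc ide_ide_tens tens_ide del: One_nat_def)
  ultimately have "acts (a + (1 + Suc c) + d) (\<lambda>xs. swapf (a + c) 1 1 (swapf a 1 c xs)) (ide a \<parallel> swap 1 (Suc c) \<parallel> ide d)"
    by (simp add: add_ac)
  then show ?case
  proof (rule acts_cong)
    fix xs :: "bit list" assume "length xs = a + (1 + Suc c) + d"
    then have "length xs = a + 1 + Suc c + d" by simp
    then obtain A B C D where xs: "xs = A @ B @ C @ D" "length A = a" "length B = 1" "length C = Suc c" "length D = d"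
      by (rule length_split4)
    obtain C' y where C: "C = C' @ [y]" "length C' = c" using xs(4) by (cases C rule: rev_cases) auto
    show "swapf (a + c) 1 1 (swapf a 1 c xs) = swapf a 1 (Suc c) xs"
      using swapf_append[of A a B 1 C' c "[y] @ D"] swapf_append[of "A @ C'" "a + c" B 1 "[y]" 1 D]
        swapf_append[of A a B 1 C "Suc c" D] xs C by simp
  qed
qed

lemma acts_swap: "acts (a + (b + c) + d) (swapf a b c) (ide a \<parallel> swap b c \<parallel> ide d)"
proof (induction b arbitrary: d)
  case 0
  show ?case
    by (simp add: tens_ide) (rule acts_cong[OF acts_ide], simp add: swapf_def take_add[symmetric] flip: append_assoc)
next
  case (Suc b)
  have "acts (a + (b + c) + (1 + d)) (\<lambda>xs. swapf a b c (swapf (a + b) 1 c xs))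
    ((ide (a + b) \<parallel> swap 1 c \<parallel> ide d) \<cdot> (ide a \<parallel> swap b c \<parallel> ide (1 + d)))"
    using acts_comp[OF _ Suc[of "1 + d"], of "swapf (a + b) 1 c"] acts_swap1[of "a + b" c d] by (simp add: add_ac)
  moreover have "(ide (a + b) \<parallel> swap 1 c \<parallel> ide d) \<cdot> (ide a \<parallel> swap b c \<parallel> ide (1 + d)) = ide a \<parallel> swap (b + 1) c \<parallel> ide d"
    unfolding swap_hexagon_left[of b 1 c]
    by (simp add: ide_tens_comp comp_tens_ide tens_assoc ide_ide_tens tens_ide del: One_nat_def)
  ultimately have "acts (a + (Suc b + c) + d) (\<lambda>xs. swapf a b c (swapf (a + b) 1 c xs)) (ide a \<parallel> swap (Suc b) c \<parallel> ide d)"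
    by (simp add: add_ac)
  then show ?case
  proof (rule acts_cong)
    fix xs :: "bit list" assume "length xs = a + (Suc b + c) + d"
    then have "length xs = a + Suc b + c + d" by simp
    then obtain A B C D where xs: "xs = A @ B @ C @ D" "length A = a" "length B = Suc b" "length C = c" "length D = d"
      by (rule length_split4)
    obtain B' x where B: "B = B' @ [x]" "length B' = b" using xs(3) by (cases B rule: rev_cases) auto
    show "swapf a b c (swapf (a + b) 1 c xs) = swapf a (Suc b) c xs"
      using swapf_append[of "A @ B'" "a + b" "[x]" 1 C c D] swapf_append[of A a B' b C c "[x] @ D"]
        swapf_append[of A a B "Suc b" C c D] xs B by simp
  qed
qed

section \<open>Normal forms\<close>

text \<open>The first \<open>n\<close> of the \<open>n + d\<close> outputs are the inputs passed
  through, the other \<open>d\<close> are new; \<open>k\<close> counts the hidden wires.\<close>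

definition nf :: "nat \<Rightarrow> nat \<Rightarrow> nat \<Rightarrow> (bit list \<Rightarrow> bool) \<Rightarrow> arr" where
  "nf n d k P = push n (d + k) \<cdot> bx (n + d + k) P \<cdot> pop (n + d) k"

lemma dom_nf [simp]: "dom (nf n d k P) = n" and cod_nf [simp]: "cod (nf n d k P) = n + d"
  by (simp_all add: nf_def add.assoc)

lemma gword_mono: "gword n N w \<Longrightarrow> n' \<le> n \<Longrightarrow> gword n' N w"
  by (induction rule: gword.induct) (auto intro: gword.intros)

text \<open>Isolates the last \<open>k'\<close> hidden wires in the form treated by
  \<open>eliminate\<close>.\<close>

lemma nf_pop:
  "push n (d + (k + k')) \<cdot> bx (n + d + (k + k')) R \<cdot> pop (n + d) (k + k') =
   push n (d + k) \<cdot> (push (n + d + k) k' \<cdot> bx (n + d + k + k') R \<cdot> pop (n + d + k) k') \<cdot> pop (n + d) k"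
proof -
  have "push n (d + (k + k')) = push n (d + k) \<cdot> push (n + d + k) k'"
    using push_add[of n "d + k" k'] by (simp add: add.assoc)
  then show ?thesis unfolding pop_add by (simp add: comp_assoc add.assoc)
qed

lemma nf_eq:
  assumes bij: "bij_betw \<phi> {xs. length xs = n + d + k \<and> P xs} {xs. length xs = n + d + k' \<and> P' xs}"
    and \<phi>: "\<And>xs. length xs = n + d + k \<Longrightarrow> P xs \<Longrightarrow> take (n + d) (\<phi> xs) = take (n + d) xs"
  shows "nf n d k P = nf n d k' P'"
proof -
  let ?M = "n + d"
  \<comment> \<open>The graph of \<open>\<phi>\<close> on three blocks: the \<open>?M\<close>
    visible wires common to both sides, the hidden wires of the first form, and those of the
    second.\<close>
  define R where "R = (\<lambda>w. P (take (?M + k) w) \<and> take ?M w @ drop (?M + k) w = \<phi> (take (?M + k) w))"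
  \<comment> \<open>The same graph with the hidden blocks in the other order, so that the wires to
    be eliminated come last again.\<close>
  define R' where "R' = (\<lambda>w. R (swapf ?M k' k w))"
  have im: "length (\<phi> xs) = ?M + k' \<and> P' (\<phi> xs)" if "length xs = ?M + k" "P xs" for xs
    using bij that unfolding bij_betw_def by blast
  have inj: "xs = ys" if "length xs = ?M + k" "P xs" "length ys = ?M + k" "P ys" "\<phi> xs = \<phi> ys" for xs ys
    using bij that unfolding bij_betw_def inj_on_def by blast
  have surj: "\<exists>xs. length xs = ?M + k \<and> P xs \<and> \<phi> xs = ys" if "length ys = ?M + k'" "P' ys" for ys
  proof -
    have "ys \<in> \<phi> ` {xs. length xs = n + d + k \<and> P xs}" using bij that unfolding bij_betw_def by simp
    then show ?thesis by blast
  qed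
  \<comment> \<open>\<open>\<phi>\<close> is a function, so the second hidden block is determined by
    the other wires.\<close>
  have 1: "push (?M + k) k' \<cdot> bx (?M + k + k') R \<cdot> pop (?M + k) k' = bx (?M + k) P"
  proof (subst eliminate)
    fix xs ys ys' :: "bit list"
    assume "length xs = ?M + k" "length ys = k'" "length ys' = k'" "R (xs @ ys)" "R (xs @ ys')"
    then have "take ?M xs @ ys = \<phi> xs" "take ?M xs @ ys' = \<phi> xs" by (simp_all add: R_def)
    then show "ys = ys'" by (metis same_append_eq)
  next
    show "bx (?M + k) (\<lambda>xs. \<exists>ys. length ys = k' \<and> R (xs @ ys)) = bx (?M + k) P"
    proof (rule bx_cong)
      fix xs :: "bit list" assume xs: "length xs = ?M + k"
      show "(\<exists>ys. length ys = k' \<and> R (xs @ ys)) \<longleftrightarrow> P xs"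
      proof
        assume P: "P xs"
        have "take ?M xs @ drop ?M (\<phi> xs) = \<phi> xs" using \<phi>[OF xs P] by (metis append_take_drop_id)
        then show "\<exists>ys. length ys = k' \<and> R (xs @ ys)"
          using xs P im[OF xs P] by (intro exI[of _ "drop ?M (\<phi> xs)"]) (simp add: R_def)
      qed (use xs in \<open>auto simp: R_def\<close>)
    qed
  qed
  have R'_iff: "R' (xs @ ys) \<longleftrightarrow> P (take ?M xs @ ys) \<and> xs = \<phi> (take ?M xs @ ys)"
    if "length xs = ?M + k'" "length ys = k" for xs ys
  proof -
    have "swapf ?M k' k (take ?M xs @ drop ?M xs @ ys @ []) = take ?M xs @ ys @ drop ?M xs @ []"
      by (rule swapf_append) (use that in auto)
    moreover have "take ?M xs @ drop ?M xs @ ys @ [] = xs @ ys"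
      by (metis append_Nil2 append_assoc append_take_drop_id)
    ultimately have "swapf ?M k' k (xs @ ys) = (take ?M xs @ ys) @ drop ?M xs"
      by (simp only: append_Nil2 append_assoc)
    then show ?thesis using that by (simp add: R'_def R_def)
  qed
  \<comment> \<open>Now injectivity determines the first hidden block, as \<open>\<phi>\<close>
    fixes the visible bits, and surjectivity makes \<open>P'\<close> the set that remains.\<close>
  have 2: "push (?M + k') k \<cdot> bx (?M + k' + k) R' \<cdot> pop (?M + k') k = bx (?M + k') P'"
  proof (subst eliminate)
    fix xs ys ys' :: "bit list"
    assume l: "length xs = ?M + k'" "length ys = k" "length ys' = k" and r: "R' (xs @ ys)" "R' (xs @ ys')"
    have r1: "P (take ?M xs @ ys)" "xs = \<phi> (take ?M xs @ ys)" using r(1) R'_iff[OF l(1,2)] by blast+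
    have r2: "P (take ?M xs @ ys')" "xs = \<phi> (take ?M xs @ ys')" using r(2) R'_iff[OF l(1,3)] by blast+
    have "take ?M xs @ ys = take ?M xs @ ys'"
      by (rule inj[OF _ r1(1) _ r2(1) trans[OF r1(2)[symmetric] r2(2)]]) (use l in auto)
    then show "ys = ys'" by simp
  next
    show "bx (?M + k') (\<lambda>xs. \<exists>ys. length ys = k \<and> R' (xs @ ys)) = bx (?M + k') P'"
    proof (rule bx_cong)
      fix xs :: "bit list" assume xs: "length xs = ?M + k'"
      show "(\<exists>ys. length ys = k \<and> R' (xs @ ys)) \<longleftrightarrow> P' xs"
      proof
        assume "\<exists>ys. length ys = k \<and> R' (xs @ ys)"
        then obtain ys where ys: "length ys = k" "R' (xs @ ys)" by blast
        then show "P' xs" using R'_iff[OF xs ys(1)] im[of "take ?M xs @ ys"] xs by simp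
      next
        assume "P' xs"
        then obtain zs where zs: "length zs = ?M + k" "P zs" "\<phi> zs = xs" using surj xs by blast
        have "take ?M zs = take ?M xs" using \<phi>[OF zs(1,2)] zs(3) by simp
        then have "take ?M xs @ drop ?M zs = zs" by (metis append_take_drop_id)
        then show "\<exists>ys. length ys = k \<and> R' (xs @ ys)"
          using zs R'_iff[OF xs, of "drop ?M zs"] by (intro exI[of _ "drop ?M zs"]) simp
      qed
    qed
  qed
  let ?W = "ide ?M \<parallel> swap k k'"
  have "acts (?M + (k + k')) (swapf ?M k k') ?W" using acts_swap[of ?M k k' 0] by simp
  then have "?W \<cdot> bx (?M + (k + k')) R' = bx (?M + (k + k')) (\<lambda>xs. R' (swapf ?M k k' xs)) \<cdot> ?W"
    by (simp add: acts_def)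
  also have "bx (?M + (k + k')) (\<lambda>xs. R' (swapf ?M k k' xs)) = bx (?M + (k + k')) R"
  proof (rule bx_cong)
    fix xs :: "bit list" assume "length xs = ?M + (k + k')"
    then have "length xs = ?M + k + k' + 0" by simp
    then obtain A B C D where xs: "xs = A @ B @ C @ D" "length A = ?M" "length B = k" "length C = k'" "length D = 0"
      by (rule length_split4)
    then show "R' (swapf ?M k k' xs) \<longleftrightarrow> R xs" unfolding R'_def
      using swapf_append[of A ?M B k C k' "[]"] swapf_append[of A ?M C k' B k "[]"] by simp
  qed
  finally have W: "?W \<cdot> bx (?M + (k + k')) R' = bx (?M + (k + k')) R \<cdot> ?W" .
  \<comment> \<open>The block exchange relating the two orders disappears at both ends:
    \<open>push\<close> absorbs it as a word of gates, and discarded wires may be permuted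
    freely.\<close>
  have pW: "push n (d + (k + k')) \<cdot> ?W = push n (d + (k + k'))"
  proof (rule push_gword)
    show "gword n (?M + (k + k')) ?W"
      using gword_mono[OF gword_swaps[of ?M k k' 0], of n] by simp
  qed (simp add: add.assoc)
  have Wp: "pop ?M (k + k') = ?W \<cdot> pop ?M (k' + k)"
  proof -
    have "swap k k' \<cdot> (epk k' \<parallel> epk k) = epk k \<parallel> epk k'"
      using swap_natural[of "epk k" 0 "epk k'" 0] by simp
    then show ?thesis by (simp add: pop_def epk_add ide_tens_comp[symmetric])
  qed
  have "nf n d k P = push n (d + (k + k')) \<cdot> bx (?M + (k + k')) R \<cdot> pop ?M (k + k')"
    unfolding nf_pop 1 nf_def ..
  also have "\<dots> = push n (d + (k + k')) \<cdot> (bx (?M + (k + k')) R \<cdot> ?W) \<cdot> pop ?M (k' + k)"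
    unfolding Wp by (simp add: comp_assoc add_ac)
  also have "\<dots> = (push n (d + (k + k')) \<cdot> ?W) \<cdot> bx (?M + (k + k')) R' \<cdot> pop ?M (k' + k)"
    unfolding W[symmetric] by (simp add: comp_assoc add_ac)
  also have "\<dots> = push n (d + (k' + k)) \<cdot> bx (?M + (k' + k)) R' \<cdot> pop ?M (k' + k)"
    unfolding pW by (simp add: add.commute[of k k'])
  also have "\<dots> = nf n d k' P'"
    unfolding nf_pop 2 nf_def ..
  finally show ?thesis .
qed

definition is_nf :: "nat \<Rightarrow> nat \<Rightarrow> arr \<Rightarrow> bool" where
  "is_nf n d f \<longleftrightarrow> (\<exists>k P. f = nf n d k P)"

text \<open>The word slides back through the discarding and the box to the newly created wires.
  Which predicate the box then carries is immaterial, so the bare existence in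
  \<open>gword_bx\<close> is enough.\<close>

lemma is_nf_gword:
  assumes "is_nf n d f" "gword n (n + d) w" shows "is_nf n d (f \<cdot> w)"
proof -
  obtain k P where f: "f = nf n d k P" using assms(1) by (auto simp: is_nf_def)
  note w = gword_dom[OF assms(2)]
  have g: "gword n (n + d + k) (w \<parallel> ide k)" by (rule gword_tens_ide[OF assms(2)])
  obtain Q where Q: "bx (n + d + k) P \<cdot> (w \<parallel> ide k) = (w \<parallel> ide k) \<cdot> bx (n + d + k) Q"
    using gword_bx[OF g] by blast
  have p: "push n (d + k) \<cdot> (w \<parallel> ide k) = push n (d + k)"
    by (rule push_gword[OF g]) simp
  have "pop (n + d) k \<cdot> w = (w \<parallel> ide k) \<cdot> pop (n + d) k" using w by (intro pop_slide) auto
  then have "f \<cdot> w = push n (d + k) \<cdot> (bx (n + d + k) P \<cdot> ((w \<parallel> ide k) \<cdot> pop (n + d) k))"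
    using w by (simp add: f nf_def comp_assoc add.assoc)
  also have "\<dots> = push n (d + k) \<cdot> ((w \<parallel> ide k) \<cdot> (bx (n + d + k) Q \<cdot> pop (n + d) k))"
    using w by (simp add: comp_eq_assoc[OF Q] comp_assoc)
  also have "\<dots> = nf n d k Q"
    using w by (simp add: comp_eq_assoc[OF p] nf_def comp_assoc add.assoc)
  finally show ?thesis by (auto simp: is_nf_def)
qed

lemma bx_tens_ide: "bx n P \<parallel> ide k = bx (n + k) (\<lambda>xs. P (take n xs))"
  using bx_tens[of n P k "\<lambda>_. True"] bx_True[of k "\<lambda>_. True"] by simp

lemma ide_tens_bx: "ide k \<parallel> bx n P = bx (k + n) (\<lambda>xs. P (drop k xs))"
  using bx_tens[of k "\<lambda>_. True" n P] bx_True[of k "\<lambda>_. True"] by simp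

lemma is_nf_bx:
  assumes "is_nf n d f" shows "is_nf n d (f \<cdot> bx (n + d) Q)"
proof -
  obtain k P where f: "f = nf n d k P" using assms(1) by (auto simp: is_nf_def)
  have "pop (n + d) k \<cdot> bx (n + d) Q = (bx (n + d) Q \<parallel> ide k) \<cdot> pop (n + d) k" by (intro pop_slide) auto
  then have "f \<cdot> bx (n + d) Q = push n (d + k) \<cdot> (bx (n + d + k) P \<cdot> bx (n + d + k) (\<lambda>xs. Q (take (n + d) xs))) \<cdot> pop (n + d) k"
    by (simp add: f nf_def comp_assoc add.assoc bx_tens_ide)
  then show ?thesis unfolding bx_bx is_nf_def nf_def by blast
qed

lemma is_nf_pop:
  assumes "is_nf n (d + 1) f" shows "is_nf n d (f \<cdot> pop (n + d) 1)"
proof -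
  obtain k P where f: "f = nf n (d + 1) k P" using assms(1) by (auto simp: is_nf_def)
  have "f \<cdot> pop (n + d) 1 = push n (d + (1 + k)) \<cdot> bx (n + d + (1 + k)) P \<cdot> pop (n + d) (1 + k)"
    unfolding pop_add[of "n + d" 1 k] f nf_def by (simp add: comp_assoc)
  then show ?thesis unfolding is_nf_def nf_def by blast
qed

lemma is_nf_push:
  assumes "is_nf n d f" shows "is_nf n (d + 1) (f \<cdot> push (n + d) 1)"
proof -
  obtain k P where f: "f = nf n d k P" using assms(1) by (auto simp: is_nf_def)
  let ?M = "n + d"
  let ?W = "ide ?M \<parallel> swap k 1"
  \<comment> \<open>The new wire arises behind the hidden ones and has to be moved in front of them;
    \<open>push\<close> absorbs this block exchange in turn.\<close>
  have pp: "pop ?M k \<cdot> push ?M 1 = push (?M + k) 1 \<cdot> (?W \<cdot> pop (?M + 1) k)"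
  proof -
    have "epk k \<cdot> et = et \<parallel> epk k" using slide2[of et 0 "epk k" 0] slide1[of "epk k" 0 et 0]
      by (metis cod_ar_simps(4) dom_ar epk_simps gen_src.simps(6) slide1 slide2 tens_ide0_left tens_ide0_right)
    moreover have "(ide k \<parallel> et) \<cdot> (swap k 1 \<cdot> (ide 1 \<parallel> epk k)) = et \<parallel> epk k"
      by (simp add: comp_eq_assoc[OF swap_into] slide1 del: One_nat_def)
    ultimately have "ide ?M \<parallel> (epk k \<cdot> et) = ide ?M \<parallel> ((ide k \<parallel> et) \<cdot> (swap k 1 \<cdot> (ide 1 \<parallel> epk k)))" by simp
    then show ?thesis
      by (simp add: ide_tens_comp ide_ide_tens pop_def push_def del: One_nat_def) (simp add: push_def)
  qed
  have g: "gword n (?M + k + 1) ?W" using gword_mono[OF gword_swaps[of ?M k 1 0], of n] by (simp add: add.assoc)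
  obtain Q where Q: "bx (?M + k + 1) (\<lambda>xs. P (take (?M + k) xs)) \<cdot> ?W = ?W \<cdot> bx (?M + k + 1) Q"
    using gword_bx[OF g] by blast
  have p: "push n (d + k + 1) \<cdot> ?W = push n (d + k + 1)" by (rule push_gword[OF g]) simp
  have b: "bx (?M + k) P \<cdot> push (?M + k) 1 = push (?M + k) 1 \<cdot> bx (?M + k + 1) (\<lambda>xs. P (take (?M + k) xs))"
    unfolding bx_tens_ide[symmetric] by (rule push_slide) simp_all
  have a: "push n (d + k) \<cdot> push (?M + k) 1 = push n (d + k + 1)"
    using push_add[of n "d + k" 1] by (simp add: add.assoc)
  have "f \<cdot> push ?M 1 = push n (d + k) \<cdot> (bx (?M + k) P \<cdot> (push (?M + k) 1 \<cdot> (?W \<cdot> pop (?M + 1) k)))"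
    unfolding pp[symmetric] by (simp add: f nf_def comp_assoc add.assoc)
  also have "\<dots> = push n (d + k) \<cdot> (push (?M + k) 1 \<cdot> (bx (?M + k + 1) (\<lambda>xs. P (take (?M + k) xs)) \<cdot> (?W \<cdot> pop (?M + 1) k)))"
    by (simp add: comp_eq_assoc[OF b] comp_assoc del: One_nat_def)
  also have "\<dots> = push n (d + k + 1) \<cdot> (?W \<cdot> (bx (?M + k + 1) Q \<cdot> pop (?M + 1) k))"
    by (simp add: comp_eq_assoc[OF a] comp_eq_assoc[OF Q] comp_assoc del: One_nat_def)
  also have "\<dots> = push n (d + k + 1) \<cdot> (bx (?M + k + 1) Q \<cdot> pop (?M + 1) k)"
    by (simp add: comp_eq_assoc[OF p] del: One_nat_def)
  also have "\<dots> = nf n (d + 1) k Q"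
    by (simp add: nf_def comp_assoc add_ac)
  finally show ?thesis by (auto simp: is_nf_def)
qed

lemma is_nf_ide: "is_nf n 0 (ide n)"
  unfolding is_nf_def by (rule exI[of _ 0], rule exI[of _ "\<lambda>_. True"]) (simp add: nf_def bx_True)

lemma is_nf_dom: "is_nf n d f \<Longrightarrow> dom f = n \<and> cod f = n + d"
  by (auto simp: is_nf_def)

text \<open>The spare wires \<open>a\<close> and \<open>b\<close> on both sides of \<open>g\<close>
  make the property stable under tensor products, hence provable by induction on terms.\<close>

definition appendable :: "arr \<Rightarrow> bool" where
  "appendable g \<longleftrightarrow> (\<forall>n a b f. is_nf n (a + dom g + b) f \<longrightarrow>
     is_nf n (a + cod g + b) (f \<cdot> (ide (n + a) \<parallel> g \<parallel> ide b)))"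

lemma appendableI:
  "(\<And>n a b f. is_nf n (a + dom g + b) f \<Longrightarrow> is_nf n (a + cod g + b) (f \<cdot> (ide (n + a) \<parallel> g \<parallel> ide b))) \<Longrightarrow> appendable g"
  by (auto simp: appendable_def)

lemma appendableD:
  "appendable g \<Longrightarrow> is_nf n (a + dom g + b) f \<Longrightarrow> is_nf n (a + cod g + b) (f \<cdot> (ide (n + a) \<parallel> g \<parallel> ide b))"
  by (auto simp: appendable_def)

lemma appendable_gword: "gword 0 N w \<Longrightarrow> appendable w"
proof (rule appendableI)
  fix n a b f assume w: "gword 0 N w" and f: "is_nf n (a + dom w + b) f"
  have d: "dom w = N" "cod w = N" using gword_dom[OF w] by auto
  have "gword (n + a + 0) (n + a + N + b) (ide (n + a) \<parallel> w \<parallel> ide b)"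
    by (intro gword_tens_ide ide_tens_gword w)
  then have "gword n (n + (a + N + b)) (ide (n + a) \<parallel> w \<parallel> ide b)"
    using gword_mono[of "n + a" _ _ n] by (simp add: add.assoc)
  then show "is_nf n (a + cod w + b) (f \<cdot> (ide (n + a) \<parallel> w \<parallel> ide b))"
    using f unfolding d by (intro is_nf_gword)
qed

lemma appendable_bx: "appendable (bx N P)"
proof (rule appendableI)
  fix n a b f assume f: "is_nf n (a + dom (bx N P) + b) f"
  have "is_nf n (a + N + b) (f \<cdot> bx (n + (a + N + b)) (\<lambda>xs. P (drop (n + a) (take (n + a + N) xs))))"
    using f by (intro is_nf_bx) simp
  then show "is_nf n (a + cod (bx N P) + b) (f \<cdot> (ide (n + a) \<parallel> bx N P \<parallel> ide b))"
    by (simp add: ide_tens_bx bx_tens_ide add.assoc)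
qed

lemma appendable_comp: "appendable g \<Longrightarrow> appendable h \<Longrightarrow> cod g = dom h \<Longrightarrow> appendable (g \<cdot> h)"
proof (rule appendableI)
  fix n a b f assume gh: "appendable g" "appendable h" "cod g = dom h" and f: "is_nf n (a + dom (g \<cdot> h) + b) f"
  have "is_nf n (a + cod g + b) (f \<cdot> (ide (n + a) \<parallel> g \<parallel> ide b))"
    using f by (intro appendableD[OF gh(1)]) simp
  then have "is_nf n (a + cod h + b) (f \<cdot> (ide (n + a) \<parallel> g \<parallel> ide b) \<cdot> (ide (n + a) \<parallel> h \<parallel> ide b))"
    by (intro appendableD[OF gh(2)]) (simp add: gh(3))
  then show "is_nf n (a + cod (g \<cdot> h) + b) (f \<cdot> (ide (n + a) \<parallel> (g \<cdot> h) \<parallel> ide b))"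
    using gh(3) is_nf_dom[OF f] by (simp add: ide_tens_comp comp_tens_ide comp_assoc add.assoc)
qed

lemma appendable_tens: "appendable g \<Longrightarrow> appendable h \<Longrightarrow> appendable (g \<parallel> h)"
proof (rule appendableI)
  fix n a b f assume gh: "appendable g" "appendable h" and f: "is_nf n (a + dom (g \<parallel> h) + b) f"
  have "is_nf n (a + cod g + (dom h + b)) (f \<cdot> (ide (n + a) \<parallel> g \<parallel> ide (dom h + b)))"
    using f by (intro appendableD[OF gh(1)]) (simp add: add.assoc)
  then have "is_nf n (a + cod g + cod h + b)
      (f \<cdot> (ide (n + a) \<parallel> g \<parallel> ide (dom h + b)) \<cdot> (ide (n + (a + cod g)) \<parallel> h \<parallel> ide b))"
    by (intro appendableD[OF gh(2)]) (simp add: add.assoc)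
  moreover have "(ide (n + a) \<parallel> g \<parallel> ide (dom h + b)) \<cdot> (ide (n + (a + cod g)) \<parallel> h \<parallel> ide b) = ide (n + a) \<parallel> (g \<parallel> h) \<parallel> ide b"
    using slide1[of g "cod g" "h \<parallel> ide b" "dom h + b"]
    by (simp add: tens_assoc add.assoc[symmetric] ide_tens_comp[symmetric] ide_ide_tens[symmetric])
  ultimately show "is_nf n (a + cod (g \<parallel> h) + b) (f \<cdot> (ide (n + a) \<parallel> (g \<parallel> h) \<parallel> ide b))"
    using is_nf_dom[OF f] by (simp add: comp_assoc add.assoc)
qed

lemma appendable_ide: "appendable (ide N)"
  using appendable_gword[OF gword_ide] .

lemma appendable_et: "appendable et"
proof (rule appendableI)
  fix n a b f assume "is_nf n (a + dom et + b) f"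
  then have f: "is_nf n (a + b) f" by simp
  have eq: "ide (n + a) \<parallel> et \<parallel> ide b = push (n + a + b) 1 \<cdot> (ide (n + a) \<parallel> swap b 1)"
  proof -
    have "ide (n + a) \<parallel> et \<parallel> ide b = ide (n + a) \<parallel> ((ide b \<parallel> et) \<cdot> swap b 1)"
      by (simp add: swap_into tens_assoc del: One_nat_def)
    then show ?thesis by (simp add: ide_tens_comp ide_ide_tens push_def del: One_nat_def) (simp add: push_def)
  qed
  have "gword n (n + (a + b + 1)) (ide (n + a) \<parallel> swap b 1)"
    using gword_mono[OF gword_swaps[of "n + a" b 1 0], of n] by (simp add: add.assoc)
  then have "is_nf n (a + b + 1) (f \<cdot> push (n + (a + b)) 1 \<cdot> (ide (n + a) \<parallel> swap b 1))"
    by (intro is_nf_gword is_nf_push f)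
  then show "is_nf n (a + cod et + b) (f \<cdot> (ide (n + a) \<parallel> et \<parallel> ide b))"
    using is_nf_dom[OF f] unfolding eq by (simp add: comp_assoc add_ac)
qed

lemma appendable_ep: "appendable ep"
proof (rule appendableI)
  fix n a b f assume "is_nf n (a + dom ep + b) f"
  then have f: "is_nf n (a + b + 1) f" by (simp add: add_ac)
  have eq: "ide (n + a) \<parallel> ep \<parallel> ide b = (ide (n + a) \<parallel> swap 1 b) \<cdot> pop (n + a + b) 1"
  proof -
    have "ide (n + a) \<parallel> ep \<parallel> ide b = ide (n + a) \<parallel> (swap 1 b \<cdot> (ide b \<parallel> ep))"
      by (simp add: swap_out' tens_assoc del: One_nat_def)
    then show ?thesis by (simp add: ide_tens_comp ide_ide_tens pop_def del: One_nat_def) (simp add: pop_def)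
  qed
  have "gword n (n + (a + b + 1)) (ide (n + a) \<parallel> swap 1 b)"
    using gword_mono[OF gword_swaps[of "n + a" 1 b 0], of n] by (simp add: add_ac)
  then have "is_nf n (a + b) (f \<cdot> (ide (n + a) \<parallel> swap 1 b) \<cdot> pop (n + (a + b)) 1)"
    by (intro is_nf_gword is_nf_pop f)
  then show "is_nf n (a + cod ep + b) (f \<cdot> (ide (n + a) \<parallel> ep \<parallel> ide b))"
    using is_nf_dom[OF f] unfolding eq by (simp add: comp_assoc add_ac)
qed

lemma appendable_un: "appendable un" and appendable_ud: "appendable ud"
  unfolding un_eq ud_eq z0_def by (intro appendable_comp appendable_et appendable_ep appendable_bx; simp)+

lemma appendable_ev: "wtm t \<Longrightarrow> appendable (ev t)"
proof (induction t)
  case (Gen g)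
  then show ?case
  proof (cases g)
    case (Gate n X x)
    then show ?thesis using Gen by (auto intro: appendable_gword gword_gate)
  next
    case (Box n p)
    then show ?thesis using Gen by (simp add: box_bx appendable_bx)
  qed (simp_all add: appendable_un appendable_ud appendable_et appendable_ep)
next
  case (Swap n m)
  show ?case using appendable_gword[OF gword_swap] by simp
qed (auto intro: appendable_comp appendable_tens appendable_ide simp: cod_ev)

lemma appendable: "appendable f"
  using appendable_ev arr_ev by metis

text \<open>Each step copies one further input onto a new wire, as the diagonal does. The inputs
  serve only as controls, so the gates satisfy \<open>gword\<close> and the result is a normal
  form.\<close>

primrec copy :: "nat \<Rightarrow> nat \<Rightarrow> arr" where
  "copy n 0 = ide n"
| "copy n (Suc j) = copy n j \<cdot> ((ide (n + j) \<parallel> un) \<cdot> gt (n + j + 1) {j} (n + j))"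

lemma copy_dom [simp]: "dom (copy n j) = n" "cod (copy n j) = n + j"
  by (induction j) auto

lemma is_nf_copy: "j \<le> n \<Longrightarrow> is_nf n j (copy n j)"
proof (induction j)
  case 0
  show ?case using is_nf_ide by simp
next
  case (Suc j)
  then have "is_nf n (j + dom un + 0) (copy n j)" by simp
  then have "is_nf n (j + cod un + 0) (copy n j \<cdot> (ide (n + j) \<parallel> un \<parallel> ide 0))"
    by (rule appendableD[OF appendable])
  then have nf: "is_nf n (j + 1) (copy n j \<cdot> (ide (n + j) \<parallel> un))" by simp
  have g: "gword n (n + (j + 1)) (gt (n + j + 1) {j} (n + j))"
    using Suc.prems gword_gate[of "n + j + 1" "{j}" "n + j" n] by (auto simp: is_gate_def add.assoc)
  have "is_nf n (j + 1) (copy n j \<cdot> (ide (n + j) \<parallel> un) \<cdot> gt (n + j + 1) {j} (n + j))"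
    by (rule is_nf_gword[OF nf g])
  then show ?case by (simp add: comp_assoc)
qed

lemma swap_gt: "(ide 1 \<parallel> swap 1 s) \<cdot> gt (s + 2) {0} (s + 1) = gt (s + 2) {0} 1 \<cdot> (ide 1 \<parallel> swap 1 s)"
proof (induction s)
  case 0
  show ?case by (simp add: tens_ide numeral_2_eq_2)
next
  case (Suc s)
  let ?A = "ide 1 \<parallel> swap 1 s" and ?N = "s + 3"
  have sw: "ide 1 \<parallel> swap 1 (s + 1) = (?A \<parallel> ide 1) \<cdot> sw (s + 1) 0"
    unfolding swap_hexagon[of 1 s 1]
    by (simp add: ide_tens_comp sw_def tens_assoc ide_ide_tens del: One_nat_def) (simp add: ide_ide_tens add.commute)
  have g: "is_gate (s + 1 + 2 + 0) {0} (s + 1)" by (auto simp: is_gate_def)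
  have t: "transpose (s + 1) (s + 1 + 1) ` {0} = {0}" by (auto simp: transpose_def)
  have S: "sw (s + 1) 0 \<cdot> gt ?N {0} (s + 2) = gt ?N {0} (s + 1) \<cdot> sw (s + 1) 0"
    using gt_wires[OF g] unfolding t by (simp add: numeral_3_eq_3 numeral_2_eq_2)
  have gs: "gt (s + 2) {0} i \<parallel> ide 1 = gt ?N {0} i" if "i = s + 1 \<or> i = 1" for i
    using gt_right[of "s + 2" "{0}" i 1] that by (auto simp: is_gate_def numeral_3_eq_3 numeral_2_eq_2)
  have A: "(?A \<parallel> ide 1) \<cdot> gt ?N {0} (s + 1) = gt ?N {0} 1 \<cdot> (?A \<parallel> ide 1)"
  proof -
    have "(?A \<cdot> gt (s + 2) {0} (s + 1)) \<parallel> ide 1 = (gt (s + 2) {0} 1 \<cdot> ?A) \<parallel> ide 1"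
      using Suc by simp
    then show ?thesis by (simp add: comp_tens_ide gs[simplified])
  qed
  have "(ide 1 \<parallel> swap 1 (s + 1)) \<cdot> gt ?N {0} (s + 2) = (?A \<parallel> ide 1) \<cdot> (gt ?N {0} (s + 1) \<cdot> sw (s + 1) 0)"
    unfolding sw S[symmetric] by (rule comp_assoc) auto
  also have "\<dots> = (gt ?N {0} 1 \<cdot> (?A \<parallel> ide 1)) \<cdot> sw (s + 1) 0"
    unfolding A[symmetric] by (rule comp_assoc[symmetric]) auto
  also have "\<dots> = gt ?N {0} 1 \<cdot> (ide 1 \<parallel> swap 1 (s + 1))"
    unfolding sw by (rule comp_assoc) auto
  finally show ?case by (simp add: numeral_3_eq_3 numeral_2_eq_2)
qed

text \<open>Copying the first wire to the far end and discarding the original just moves it there: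
  once the copy is placed next to the original, the counit law applies.\<close>

lemma copy_first:
  "(ide (1 + s) \<parallel> un) \<cdot> (gt (s + 2) {0} (s + 1) \<cdot> (ep \<parallel> ide (1 + s))) = swap 1 s"
proof -
  let ?W = "ide 1 \<parallel> swap 1 s"
  have I: "ide (1 + s) \<parallel> un = (ide 1 \<parallel> un \<parallel> ide s) \<cdot> ?W"
  proof -
    have "ide (1 + s) \<parallel> un = ide 1 \<parallel> ((un \<parallel> ide s) \<cdot> swap 1 s)"
      by (simp add: swap_into' ide_ide_tens del: One_nat_def)
    then show ?thesis by (simp add: ide_tens_comp tens_assoc)
  qed
  have c: "gt (s + 2) {0} 1 = cnot \<parallel> ide s"
    using gt_right[of 2 "{0}" 1 s] by (simp add: add.commute)
  have e: "?W \<cdot> (ep \<parallel> ide (1 + s)) = (ep \<parallel> ide 1 \<parallel> ide s) \<cdot> swap 1 s"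
    using slide2[of ep 1 "swap 1 s" "1 + s"] slide1[of ep 0 "swap 1 s" "1 + s"]
    by (simp add: add.commute tens_assoc tens_ide)
  have "(ide (1 + s) \<parallel> un) \<cdot> (gt (s + 2) {0} (s + 1) \<cdot> (ep \<parallel> ide (1 + s))) =
      (ide 1 \<parallel> un \<parallel> ide s) \<cdot> (gt (s + 2) {0} 1 \<cdot> (?W \<cdot> (ep \<parallel> ide (1 + s))))"
    unfolding I by (simp add: comp_assoc comp_eq_assoc[OF swap_gt] del: One_nat_def add_2_eq_Suc')
  also have "\<dots> = (((ide 1 \<parallel> un) \<cdot> cnot \<cdot> (ep \<parallel> ide 1)) \<parallel> ide s) \<cdot> swap 1 s"
    unfolding e c by (simp add: comp_tens_ide comp_assoc)
  also have "\<dots> = swap 1 s" unfolding counit_left by (simp add: tens_ide)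
  finally show ?thesis .
qed

text \<open>Moving the first \<open>j\<close> wires to the end and then the next one moves
  \<open>j + 1\<close> wires in their order. This is the induction step of
  \<open>copy_epk\<close>.\<close>

lemma swap_swap_rotate: "swap j (1 + r) \<cdot> swap 1 (r + j) = swap (j + 1) r"
proof -
  have a: "swap j (1 + r) = (swap j 1 \<parallel> ide r) \<cdot> (ide 1 \<parallel> swap j r)" by (rule swap_hexagon)
  have b: "swap 1 (r + j) = (swap 1 r \<parallel> ide j) \<cdot> (ide r \<parallel> swap 1 j)" by (rule swap_hexagon)
  have c: "swap (1 + j) r = (ide 1 \<parallel> swap j r) \<cdot> (swap 1 r \<parallel> ide j)" by (rule swap_hexagon_left)
  have nat: "(swap j 1 \<parallel> ide r) \<cdot> swap (1 + j) r = swap (j + 1) r \<cdot> (ide r \<parallel> swap j 1)"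
    by (simp add: swap_natural)
  have "swap j (1 + r) \<cdot> swap 1 (r + j) = (swap j 1 \<parallel> ide r) \<cdot> (swap (1 + j) r \<cdot> (ide r \<parallel> swap 1 j))"
    unfolding a b c by (simp add: comp_assoc)
  also have "\<dots> = swap (j + 1) r \<cdot> ((ide r \<parallel> swap j 1) \<cdot> (ide r \<parallel> swap 1 j))"
    by (simp add: comp_eq_assoc[OF nat] comp_assoc del: One_nat_def)
  also have "\<dots> = swap (j + 1) r"
    by (simp add: ide_tens_comp[symmetric] swap_swap tens_ide del: One_nat_def)
  finally show ?thesis .
qed

text \<open>The induction needs the stage at which only \<open>j\<close> inputs are copied:
  discarding their originals leaves the other wires followed by the copies, which is a block
  exchange. Once all inputs are copied it is an identity.\<close>

lemma copy_epk: "n = j + r \<Longrightarrow> copy n j \<cdot> (epk j \<parallel> ide n) = swap j r"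
proof (induction j arbitrary: r)
  case 0
  then show ?case by simp
next
  case (Suc j)
  let ?s = "j + r"
  have n: "n = 1 + ?s" using Suc.prems by simp
  have IH: "copy n j \<cdot> (epk j \<parallel> ide n) = swap j (1 + r)" by (rule Suc.IH) (use Suc.prems in simp)
  let ?I = "ide (n + j) \<parallel> un" and ?K = "gt (n + j + 1) {j} (n + j)"
  have E: "epk (Suc j) \<parallel> ide n = (epk j \<parallel> ide (n + 1)) \<cdot> (ep \<parallel> ide n)"
    using slide1[of "epk j" 0 "ep \<parallel> ide n" "n + 1"] by (simp add: tens_assoc)
  have K: "?K = ide j \<parallel> gt (n + 1) {0} n"
    using gt_left[of "n + 1" "{0}" n j] n by (simp add: is_gate_def add_ac)
  have KE: "?K \<cdot> (epk j \<parallel> ide (n + 1)) = (epk j \<parallel> ide (n + 1)) \<cdot> gt (n + 1) {0} n"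
    unfolding K using slide1[of "epk j" 0 "gt (n + 1) {0} n" "n + 1"] slide2[of "epk j" j "gt (n + 1) {0} n" "n + 1"] by simp
  have I: "?I = ide j \<parallel> (ide n \<parallel> un)" by (simp add: ide_ide_tens add.commute)
  have IE: "?I \<cdot> (epk j \<parallel> ide (n + 1)) = (epk j \<parallel> ide n) \<cdot> (ide n \<parallel> un)"
    unfolding I using slide1[of "epk j" 0 "ide n \<parallel> un" n] slide2[of "epk j" j "ide n \<parallel> un" "n + 1"] by simp
  have "copy n (Suc j) \<cdot> (epk (Suc j) \<parallel> ide n) =
      copy n j \<cdot> (?I \<cdot> (?K \<cdot> ((epk j \<parallel> ide (n + 1)) \<cdot> (ep \<parallel> ide n))))"
    unfolding E copy.simps by (simp add: comp_assoc)
  also have "\<dots> = copy n j \<cdot> (?I \<cdot> ((epk j \<parallel> ide (n + 1)) \<cdot> (gt (n + 1) {0} n \<cdot> (ep \<parallel> ide n))))"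
    by (simp add: comp_eq_assoc[OF KE] comp_assoc del: One_nat_def add_Suc_right)
  also have "\<dots> = copy n j \<cdot> ((epk j \<parallel> ide n) \<cdot> ((ide n \<parallel> un) \<cdot> (gt (n + 1) {0} n \<cdot> (ep \<parallel> ide n))))"
    by (simp add: comp_eq_assoc[OF IE] comp_assoc del: One_nat_def add_Suc_right)
  also have "\<dots> = swap j (1 + r) \<cdot> ((ide n \<parallel> un) \<cdot> (gt (n + 1) {0} n \<cdot> (ep \<parallel> ide n)))"
    by (simp add: comp_eq_assoc[OF IH] del: One_nat_def add_Suc_right)
  also have "(ide n \<parallel> un) \<cdot> (gt (n + 1) {0} n \<cdot> (ep \<parallel> ide n)) = swap 1 (r + j)"
    using copy_first[of ?s] unfolding n by (simp add: numeral_2_eq_2 add.commute)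
  also have "swap j (1 + r) \<cdot> swap 1 (r + j) = swap (Suc j) r"
    using swap_swap_rotate[of j r] by simp
  finally show ?case .
qed

definition hat :: "arr \<Rightarrow> arr" where
  "hat f = copy (dom f) (dom f) \<cdot> (ide (dom f) \<parallel> f)"

lemma is_nf_hat: "is_nf (dom f) (cod f) (hat f)"
  using appendableD[OF appendable[of f], of "dom f" 0 0 "copy (dom f) (dom f)"] is_nf_copy[of "dom f" "dom f"]
  by (simp add: hat_def)

lemma hat_epk: "hat f \<cdot> (epk (dom f) \<parallel> ide (cod f)) = f"
proof -
  have "(ide (dom f) \<parallel> f) \<cdot> (epk (dom f) \<parallel> ide (cod f)) = (epk (dom f) \<parallel> ide (dom f)) \<cdot> f"
    using slide1[of "epk (dom f)" 0 f "dom f"] slide2[of "epk (dom f)" "dom f" f "cod f"] by simp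
  then have "hat f \<cdot> (epk (dom f) \<parallel> ide (cod f)) = copy (dom f) (dom f) \<cdot> (epk (dom f) \<parallel> ide (dom f)) \<cdot> f"
    by (simp add: hat_def comp_assoc)
  then show ?thesis using copy_epk[of "dom f" "dom f" 0] by simp
qed

section \<open>Semantics of normal forms\<close>

lemma asem_ar: "wf_gen g \<Longrightarrow> asem (ar g) = gsem g"
  using asem_ev[of "Gen g"] by simp

lemma asem_et: "asem et = span_class (cube 1, \<lambda>_. [], \<lambda>xs. xs)"
  by (simp add: asem_ar gsem_def)

lemma asem_rev: "asem (rev f) = dag (asem f)"
  by transfer (auto simp: tm_eq_refl_iff typed_iff sem_op)

lemma is_span_cubeI: "A \<subseteq> cube N \<Longrightarrow> (\<And>xs. xs \<in> A \<Longrightarrow> length (l xs) = n) \<Longrightarrow> (\<And>xs. xs \<in> A \<Longrightarrow> length (r xs) = m) \<Longrightarrow>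
    is_span (cube n) (cube m) (A, l, r)"
  using finite_subset[of A "cube N"] by (auto simp: is_span_def)

lemma asem_etk: "asem (etk k) = span_class (cube k, \<lambda>_. [], \<lambda>xs. xs)"
proof (induction k)
  case 0
  have "span_iso (span_id (cube 0)) (cube 0, \<lambda>_. [], \<lambda>xs. xs)"
    unfolding span_id_def by (rule span_isoI_witness[where f = "\<lambda>x. x" and g = "\<lambda>x. x"]) auto
  from span_class_eq[OF this] show ?case by (simp add: asem_ide)
next
  case (Suc k)
  have 1: "is_span (cube 0) (cube k) (cube k, \<lambda>_. [], \<lambda>xs. xs)" for k by (rule is_span_cubeI[of _ k]) auto
  have "span_iso (span_times (cube k, \<lambda>_. [], \<lambda>xs. xs) (cube 1, \<lambda>_. [], \<lambda>xs. xs)) (cube (Suc k), \<lambda>_. [], \<lambda>xs. xs)"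
    unfolding span_times_def prod.case
    by (rule span_isoI_witness[where f = "\<lambda>(a, b). a @ b" and g = "\<lambda>xs. (take k xs, drop k xs)"]) auto
  from span_class_eq[OF this] show ?case by (simp add: asem_tens Suc asem_et span_tensor_class[OF 1 1])
qed

lemma asem_epk: "asem (epk k) = span_class (cube k, \<lambda>xs. xs, \<lambda>_. [])"
  using asem_rev[of "etk k"] by (simp add: asem_etk dag_class span_op_def)

lemma asem_push: "asem (push n k) = span_class (cube (n + k), take n, \<lambda>xs. xs)"
proof -
  have 1: "is_span (cube 0) (cube k) (cube k, \<lambda>_. [], \<lambda>xs. xs)" by (rule is_span_cubeI[of _ k]) auto
  have "span_iso (span_times (span_id (cube n)) (cube k, \<lambda>_. [], \<lambda>xs. xs)) (cube (n + k), take n, \<lambda>xs. xs)"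
    unfolding span_times_def span_id_def prod.case
    by (rule span_isoI_witness[where f = "\<lambda>(a, b). a @ b" and g = "\<lambda>xs. (take n xs, drop n xs)"]) auto
  from span_class_eq[OF this] show ?thesis
    by (simp add: push_def asem_tens asem_etk asem_ide span_tensor_class[OF is_span_id 1])
qed

lemma asem_pop: "asem (pop n k) = span_class (cube (n + k), \<lambda>xs. xs, take n)"
  using asem_rev[of "push n k"] by (simp add: asem_push dag_class span_op_def)

lemma asem_epk_ide: "asem (epk n \<parallel> ide m) = span_class (cube (n + m), \<lambda>xs. xs, drop n)"
proof -
  have 1: "is_span (cube n) (cube 0) (cube n, \<lambda>xs. xs, \<lambda>_. [])" by (rule is_span_cubeI[of _ n]) auto
  have "span_iso (span_times (cube n, \<lambda>xs. xs, \<lambda>_. []) (span_id (cube m))) (cube (n + m), \<lambda>xs. xs, drop n)"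
    unfolding span_times_def span_id_def prod.case
    by (rule span_isoI_witness[where f = "\<lambda>(a, b). a @ b" and g = "\<lambda>xs. (take n xs, drop n xs)"]) auto
  from span_class_eq[OF this] show ?thesis
    by (simp add: asem_tens asem_epk asem_ide span_tensor_class[OF 1 is_span_id])
qed

lemma asem_bx: "asem (bx n P) = span_class ({xs. length xs = n \<and> P xs}, \<lambda>xs. xs, \<lambda>xs. xs)"
proof -
  obtain p where p: "p \<in> polys n" "\<And>xs. length xs = n \<Longrightarrow> peval (nth xs) p = 0 \<longleftrightarrow> P xs" "bx n P = ar (Box n p)"
    by (rule bx_poly[of n P]) (rule that)
  have "span_iso (pspan n (pg (Box n p))) ({xs. length xs = n \<and> P xs}, \<lambda>xs. xs, \<lambda>xs. xs)"
    unfolding pspan_def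
    by (rule span_isoI_witness[where f = "\<lambda>x. x" and g = "\<lambda>x. x"]) (auto simp: p(2) split: if_splits)
  from span_class_eq[OF this] show ?thesis using p(1) by (simp add: p(3) asem_ar gsem_def)
qed

lemma asem_nf:
  "asem (nf n d k P) = span_class ({xs. length xs = n + d + k \<and> P xs}, take n, take (n + d))"
proof -
  let ?Z = "{xs. length xs = n + d + k \<and> P xs}"
  have s1: "is_span (cube n) (cube (n + d + k)) (cube (n + d + k), take n, \<lambda>xs. xs)"
    by (rule is_span_cubeI[of _ "n + d + k"]) auto
  have s2: "is_span (cube (n + d + k)) (cube (n + d + k)) (?Z, \<lambda>xs. xs, \<lambda>xs. xs)"
    by (rule is_span_cubeI[of _ "n + d + k"]) auto
  have s3: "is_span (cube (n + d + k)) (cube (n + d)) (cube (n + d + k), \<lambda>xs. xs, take (n + d))"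
    by (rule is_span_cubeI[of _ "n + d + k"]) auto
  have "span_iso (span_pullback (span_pullback (cube (n + d + k), take n, \<lambda>xs. xs) (?Z, \<lambda>xs. xs, \<lambda>xs. xs))
      (cube (n + d + k), \<lambda>xs. xs, take (n + d))) (?Z, take n, take (n + d))"
    unfolding span_pullback_def prod.case
    by (rule span_isoI_witness[where f = snd and g = "\<lambda>xs. ((xs, xs), xs)"]) auto
  from span_class_eq[OF this] show ?thesis
    unfolding nf_def using asem_push[of n "d + k"]
    by (simp add: asem_comp asem_bx asem_pop add.assoc[symmetric] span_comp_class[OF s1 s2]
      span_comp_class[OF is_span_pullback[OF s1 s2] s3])
qed

text \<open>The left leg of a normal form is part of its right leg, so an isomorphism of spans is a
  bijection preserving the visible bits, exactly what \<open>nf_eq\<close> asks for.\<close>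

lemma nf_eqI:
  assumes "asem (nf n d k P) = asem (nf n d k' P')"
  shows "nf n d k P = nf n d k' P'"
proof -
  have "is_span (cube n) (cube (n + d)) ({xs. length xs = n + d + k \<and> P xs}, take n, take (n + d))"
    by (rule is_span_cubeI[of _ "n + d + k"]) auto
  from assms[unfolded asem_nf span_class_eq_iff[OF this]] obtain \<phi> where
    "bij_betw \<phi> {xs. length xs = n + d + k \<and> P xs} {xs. length xs = n + d + k' \<and> P' xs}"
    "\<And>xs. xs \<in> {xs. length xs = n + d + k \<and> P xs} \<Longrightarrow> take (n + d) (\<phi> xs) = take (n + d) xs"
    by (elim span_isoE) blast
  then show ?thesis by (intro nf_eq[where \<phi> = \<phi>]) auto
qed

lemma asem_faithful:
  assumes "dom f = dom g" "cod f = cod g" "asem f = asem g"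
  shows "f = g"
proof -
  obtain k P where f: "hat f = nf (dom f) (cod f) k P" using is_nf_hat[of f] by (auto simp: is_nf_def)
  obtain k' P' where g: "hat g = nf (dom f) (cod f) k' P'"
    using is_nf_hat[of g] assms by (auto simp: is_nf_def)
  have "asem (hat f) = asem (hat g)"
    using assms by (simp add: hat_def asem_comp asem_tens)
  then have "hat f = hat g" unfolding f g by (rule nf_eqI)
  then show ?thesis using hat_epk[of f] hat_epk[of g] assms by metis
qed

lemma asem_full:
  assumes "C \<in> span_hom (cube n) (cube m)"
  obtains f where "dom f = n" "cod f = m" "asem f = C"
proof -
  obtain T :: "(nat, bit list, bit list) span" where T: "is_span (cube n) (cube m) T" "C = span_class T"
    using assms by (elim span_homE) blast
  obtain S l r where S: "T = (S, l, r)" by (metis prod_cases3)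
  have fin: "finite S" using T by (simp add: S is_span_def)
  have len: "length (l s) = n" "length (r s) = m" if "s \<in> S" for s
    using is_span_cubeD[OF T(1)[unfolded S] that] by auto
  \<comment> \<open>One hidden wire for each number up to the largest apex element. This leaves room
    for the one-hot codes \<open>c\<close>, which tell apart apex elements with equal legs and so
    preserve multiplicities.\<close>
  define k where "k = Suc (Max S)"
  have k: "s < k" if "s \<in> S" for s using fin that by (simp add: k_def less_Suc_eq_le)
  define c :: "nat \<Rightarrow> bit list" where "c = (\<lambda>s. map (\<lambda>i. of_bool (i = s)) [0..<k])"
  have c: "length (c s) = k" for s by (simp add: c_def)
  have inj: "s = s'" if "c s = c s'" "s \<in> S" for s s'
    using arg_cong[OF that(1), of "\<lambda>xs. xs ! s"] k[OF that(2)] by (simp add: c_def split: if_splits)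
  define e where "e = (\<lambda>s. l s @ r s @ c s)"
  define P where "P = (\<lambda>xs. xs \<in> e ` S)"
  \<comment> \<open>The box keeps exactly the encoded apex elements; a normal form passes its inputs
    through, so they are discarded at the end.\<close>
  let ?f = "nf n m k P \<cdot> (epk n \<parallel> ide m)"
  let ?Z = "{xs. length xs = n + m + k \<and> P xs}"
  have Z: "?Z = e ` S" using len c by (auto simp: P_def e_def)
  have e_inj: "inj_on e S"
  proof (rule inj_onI)
    fix s s' assume s: "s \<in> S" "s' \<in> S" "e s = e s'"
    then have "drop (n + m) (e s) = drop (n + m) (e s')" by simp
    then have "c s = c s'" using len s by (simp add: e_def)
    then show "s = s'" using inj s by blast
  qed
  have s1: "is_span (cube n) (cube (n + m)) (?Z, take n, take (n + m))"
    by (rule is_span_cubeI[of _ "n + m + k"]) auto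
  have s2: "is_span (cube (n + m)) (cube m) (cube (n + m), \<lambda>xs. xs, drop n)"
    by (rule is_span_cubeI[of _ "n + m"]) auto
  have te: "take n (e s) = l s" "take (n + m) (e s) = l s @ r s" "drop n (l s @ r s) = r s"
    if "s \<in> S" for s
    using len[OF that] by (simp_all add: e_def)
  have "span_iso T (span_pullback (?Z, take n, take (n + m)) (cube (n + m), \<lambda>xs. xs, drop n))"
    unfolding S span_pullback_def prod.case Z
    by (rule span_isoI_witness[where f = "\<lambda>s. (e s, l s @ r s)" and g = "\<lambda>(xs, ys). inv_into S e xs"])
      (auto simp: len te inv_into_f_f[OF e_inj])
  from span_class_eq[OF this] have "asem ?f = C"
    by (simp add: asem_comp asem_nf asem_epk_ide span_comp_class[OF s1 s2] T(2))
  moreover have "dom ?f = n" "cod ?f = m" by simp_all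
  ultimately show thesis using that by blast
qed

theorem lemma3p22:
  shows "is_presentation_for spf2 FSpan2"
proof -
  \<comment> \<open>A class is interpreted by an arbitrary member; by \<open>sem_sound\<close> the
    choice is immaterial.\<close>
  define F :: "nat \<Rightarrow> nat \<Rightarrow> tm set \<Rightarrow> (nat, bit list, bit list) span set" where
    "F = (\<lambda>_ _ C. sem (SOME t. t \<in> C))"
  have F: "F n m (tm_class spf2 t) = sem t" if "typed spf2 t n' m'" for n m t n' m'
  proof -
    have "t \<in> tm_class spf2 t" using eq_refl[OF that] by (simp add: tm_class_def)
    then have "(SOME s. s \<in> tm_class spf2 t) \<in> tm_class spf2 t" by (rule someI)
    then show ?thesis unfolding F_def using sem_sound by (simp add: tm_class_def)
  qed
  have "prop_iso (prop_of spf2) FSpan2 F"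
    unfolding prop_iso_def
  proof (intro conjI allI ballI)
    fix n m
    show "bij_betw (F n m) (Hom (prop_of spf2) n m) (Hom FSpan2 n m)"
      unfolding bij_betw_def
    proof
      show "inj_on (F n m) (Hom (prop_of spf2) n m)"
      proof (rule inj_onI)
        fix C D assume "C \<in> Hom (prop_of spf2) n m" "D \<in> Hom (prop_of spf2) n m" and eq: "F n m C = F n m D"
        then obtain s t where s: "C = tm_class spf2 s" "typed spf2 s n m" and t: "D = tm_class spf2 t" "typed spf2 t n m"
          by auto
        have w: "wtm s" "wtm t" "tsrc s = tsrc t" "ttgt s = ttgt t" using s(2) t(2) by (auto simp: typed_iff)
        have "sem s = sem t" using eq s t F by metis
        then have "ev s = ev t" using w by (intro asem_faithful) (simp_all add: asem_ev cod_ev)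
        then show "C = D" using w s(1) t(1) by (simp add: ev_eq_iff tm_class_eqI)
      qed
      show "F n m ` Hom (prop_of spf2) n m = Hom FSpan2 n m"
      proof
        show "F n m ` Hom (prop_of spf2) n m \<subseteq> Hom FSpan2 n m"
          using sem_in F by auto
        show "Hom FSpan2 n m \<subseteq> F n m ` Hom (prop_of spf2) n m"
        proof
          fix C assume "C \<in> Hom FSpan2 n m"
          then obtain f where f: "dom f = n" "cod f = m" "asem f = C" by (auto elim: asem_full)
          obtain t where t: "wtm t" "f = ev t" by (rule arr_ev)
          have ty: "typed spf2 t n m" using f t by (simp add: typed_iff cod_ev)
          have "C = F n m (tm_class spf2 t)" using f(3) t F[OF ty] by (simp add: asem_ev)
          then show "C \<in> F n m ` Hom (prop_of spf2) n m" using ty by auto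
        qed
      qed
    qed
  next
    fix n show "F n n (Ide (prop_of spf2) n) = Ide FSpan2 n"
      using F[OF typed_Id] by simp
  next
    fix n m show "F (n + m) (m + n) (Symm (prop_of spf2) n m) = Symm FSpan2 n m"
      using F[OF typed_Swap] by simp
  next
    fix n m k f g assume "f \<in> Hom (prop_of spf2) n m" "g \<in> Hom (prop_of spf2) m k"
    then obtain s t where st: "typed spf2 s n m" "typed spf2 t m k" "f = tm_class spf2 s" "g = tm_class spf2 t"
      by auto
    show "F n k (Comp (prop_of spf2) f g) = Comp FSpan2 (F n m f) (F m k g)"
      by (simp add: st(3,4) prop_of_Comp[OF st(1,2)] F[OF st(1)] F[OF st(2)] F[OF typed_Seq[OF st(1,2)]])
  next
    fix n m n' m' f g assume "f \<in> Hom (prop_of spf2) n m" "g \<in> Hom (prop_of spf2) n' m'"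
    then obtain s t where st: "typed spf2 s n m" "typed spf2 t n' m'" "f = tm_class spf2 s" "g = tm_class spf2 t"
      by auto
    show "F (n + n') (m + m') (Tens (prop_of spf2) f g) = Tens FSpan2 (F n m f) (F n' m' g)"
      by (simp add: st(3,4) prop_of_Tens[OF st(1,2)] F[OF st(1)] F[OF st(2)] F[OF typed_Par[OF st(1,2)]])
  qed
  then show ?thesis
    unfolding is_presentation_for_def prop_isomorphic_def using is_prop_prop_of is_prop_FSpan2 by blast
qed

end
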